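(* Let $n\ge 4$ and let $C_n$ be a cycle with $n$ vertices. Then the binomial edge ideal $J_{C_n}$ is sequentially Cohen-Macaulay.
   Context: $K$ is a field. For a finite simple graph $G$ on the vertex set $[n]=\{1,\dots,n\}$, let $S=K[x_1,\dots,x_n,y_1,\dots,y_n]$, standard graded. The binomial edge ideal $J_G\subset S$ is generated by all $f_{ij}=x_iy_j-x_jy_i$ with $i<j$ and $\{i,j\}\in E(G)$. A finitely generated graded $S$-module $M$ is sequentially Cohen-Macaulay if there is a finite filtration of graded submodules $0=M_0\subset M_1\subset\cdots\subset M_r=M$ (strict inclusions) such that each quotient $M_i/M_{i-1}$ is Cohen-Macaulay and $\dim M_i/M_{i-1}<\dim M_{i+1}/M_i$ for all $i$. An ideal $I\subset S$ is called sequentially Cohen-Macaulay if $S/I$ is. *)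

theory Defs
  imports
    "HOL-Algebra.Module"
    "HOL-Algebra.QuotRing"
    "HOL-Library.Poly_Mapping"
    "HOL-Library.Extended_Nat"
begin

section \<open>Modules over a commutative ring\<close>

definition ring_module :: "('a, 'b) ring_scheme \<Rightarrow> ('a, 'a) module" where
  "ring_module R =
    \<lparr>carrier = carrier R, mult = mult R, one = one R, zero = zero R, add = add R,
     smult = mult R\<rparr>"

text \<open>Submodules are turned into modules in the library's way, by \<open>M\<lparr>carrier := N\<rparr>\<close>.
  In the quotient module the fields \<open>mult\<close> and \<open>one\<close>, which module records inherit from ring
  records, have no meaning.  The scalar multiplication follows the pattern of
  \<^const>\<open>rcoset_mult\<close>.\<close>

definition quot_module :: "('a, 'b, 'c) module_scheme \<Rightarrow> 'b set \<Rightarrow> ('a, 'b set) module" where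
  "quot_module M N =
    \<lparr>carrier = a_rcosets\<^bsub>M\<^esub> N, mult = (\<lambda>_ _. undefined), one = undefined,
     zero = N, add = set_add M,
     smult = (\<lambda>a X. \<Union>x\<in>X. N +>\<^bsub>M\<^esub> (a \<odot>\<^bsub>M\<^esub> x))\<rparr>"

definition submodule_span ::
    "('a, 'r) ring_scheme \<Rightarrow> ('a, 'b, 'c) module_scheme \<Rightarrow> 'b set \<Rightarrow> 'b set" where
  "submodule_span R M A = \<Inter>{N. submodule N R M \<and> A \<subseteq> N}"

definition fin_gen_module ::
    "('a, 'r) ring_scheme \<Rightarrow> ('a, 'b, 'c) module_scheme \<Rightarrow> bool" where
  "fin_gen_module R M \<longleftrightarrow>
    (\<exists>A. finite A \<and> A \<subseteq> carrier M \<and> submodule_span R M A = carrier M)"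

definition annihilator ::
    "('a, 'r) ring_scheme \<Rightarrow> ('a, 'b, 'c) module_scheme \<Rightarrow> 'a set" where
  "annihilator R M = {a \<in> carrier R. \<forall>x\<in>carrier M. a \<odot>\<^bsub>M\<^esub> x = \<zero>\<^bsub>M\<^esub>}"


section \<open>Krull dimension, depth and the Cohen-Macaulay property\<close>

text \<open>The supremum of the lengths of strict chains of prime ideals; the zero ring gets the
  value \<open>0\<close>.\<close>

definition krull_dim :: "('a, 'r) ring_scheme \<Rightarrow> enat" where
  "krull_dim R = Sup {enat k | k. \<exists>P :: nat \<Rightarrow> 'a set.
     (\<forall>i\<le>k. primeideal (P i) R) \<and> (\<forall>i<k. P i \<subset> P (Suc i))}"

definition module_dim ::
    "('a, 'r) ring_scheme \<Rightarrow> ('a, 'b, 'c) module_scheme \<Rightarrow> enat" where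
  "module_dim R M = krull_dim (R Quot (annihilator R M))"

definition module_nonzerodivisor ::
    "('a, 'b, 'c) module_scheme \<Rightarrow> 'a \<Rightarrow> bool" where
  "module_nonzerodivisor M a \<longleftrightarrow>
    (\<forall>x\<in>carrier M. a \<odot>\<^bsub>M\<^esub> x = \<zero>\<^bsub>M\<^esub> \<longrightarrow> x = \<zero>\<^bsub>M\<^esub>)"

text \<open>The submodule \<open>(a\<^sub>1, \<dots>, a\<^sub>k)M\<close> for \<open>A = {a\<^sub>1, \<dots>, a\<^sub>k}\<close>.\<close>

definition smult_submodule ::
    "('a, 'r) ring_scheme \<Rightarrow> ('a, 'b, 'c) module_scheme \<Rightarrow> 'a set \<Rightarrow> 'b set" where
  "smult_submodule R M A = submodule_span R M {a \<odot>\<^bsub>M\<^esub> x | a x. a \<in> A \<and> x \<in> carrier M}"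

definition regular_sequence ::
    "('a, 'r) ring_scheme \<Rightarrow> ('a, 'b, 'c) module_scheme \<Rightarrow> 'a list \<Rightarrow> bool" where
  "regular_sequence R M as \<longleftrightarrow>
    set as \<subseteq> carrier R \<and>
    (\<forall>i<length as. module_nonzerodivisor
       (quot_module M (smult_submodule R M (set (take i as)))) (as ! i)) \<and>
    smult_submodule R M (set as) \<noteq> carrier M"

definition depth ::
    "('a, 'r) ring_scheme \<Rightarrow> 'a set \<Rightarrow> ('a, 'b, 'c) module_scheme \<Rightarrow> enat" where
  "depth R I M = Sup {enat (length as) | as. set as \<subseteq> I \<and> regular_sequence R M as}"

definition irrelevant_ideal :: "('a, 'r) ring_scheme \<Rightarrow> (int \<Rightarrow> 'a set) \<Rightarrow> 'a set" where
  "irrelevant_ideal R Rg = Idl\<^bsub>R\<^esub> (\<Union>d\<in>{0<..}. Rg d)"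

text \<open>For a finitely generated graded module over a standard graded algebra over a field, the
  depth is taken with respect to the graded maximal ideal, which is the irrelevant ideal.\<close>

definition cohen_macaulay ::
    "('a, 'r) ring_scheme \<Rightarrow> (int \<Rightarrow> 'a set) \<Rightarrow> ('a, 'b, 'c) module_scheme \<Rightarrow> bool" where
  "cohen_macaulay R Rg M \<longleftrightarrow> depth R (irrelevant_ideal R Rg) M = module_dim R M"


section \<open>Graded modules\<close>

text \<open>A grading of \<open>M\<close> is given by the family \<open>Mg\<close> of its homogeneous components: \<open>M\<close> is
  their internal direct sum.  Rings are graded by the integers as well, with zero components in
  negative degrees in the case of interest.\<close>

definition graded_module ::
    "('a, 'r) ring_scheme \<Rightarrow> (int \<Rightarrow> 'a set) \<Rightarrow>
     ('a, 'b, 'c) module_scheme \<Rightarrow> (int \<Rightarrow> 'b set) \<Rightarrow> bool" where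
  "graded_module R Rg M Mg \<longleftrightarrow>
    Module.module R M \<and>
    (\<forall>d. additive_subgroup (Mg d) M) \<and>
    (\<forall>x\<in>carrier M. \<exists>!f. (\<forall>d. f d \<in> Mg d) \<and> finite {d. f d \<noteq> \<zero>\<^bsub>M\<^esub>} \<and>
       x = finsum M f {d. f d \<noteq> \<zero>\<^bsub>M\<^esub>}) \<and>
    (\<forall>i j. \<forall>a\<in>Rg i. \<forall>x\<in>Mg j. a \<odot>\<^bsub>M\<^esub> x \<in> Mg (i + j))"

definition graded_submodule ::
    "('a, 'r) ring_scheme \<Rightarrow> (int \<Rightarrow> 'a set) \<Rightarrow>
     ('a, 'b, 'c) module_scheme \<Rightarrow> (int \<Rightarrow> 'b set) \<Rightarrow> 'b set \<Rightarrow> bool" where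
  "graded_submodule R Rg M Mg N \<longleftrightarrow>
    submodule N R M \<and> graded_module R Rg (M\<lparr>carrier := N\<rparr>) (\<lambda>d. Mg d \<inter> N)"


section \<open>Sequentially Cohen-Macaulay modules and ideals\<close>

abbreviation subquot :: "('a, 'b, 'c) module_scheme \<Rightarrow> 'b set \<Rightarrow> 'b set \<Rightarrow> ('a, 'b set) module" where
  "subquot M N N' \<equiv> quot_module (M\<lparr>carrier := N\<rparr>) N'"

definition seq_cohen_macaulay ::
    "('a, 'r) ring_scheme \<Rightarrow> (int \<Rightarrow> 'a set) \<Rightarrow>
     ('a, 'b, 'c) module_scheme \<Rightarrow> (int \<Rightarrow> 'b set) \<Rightarrow> bool" where
  "seq_cohen_macaulay R Rg M Mg \<longleftrightarrow>
    graded_module R Rg M Mg \<and> fin_gen_module R M \<and>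
    (\<exists>(r :: nat) (N :: nat \<Rightarrow> 'b set).
       N 0 = {\<zero>\<^bsub>M\<^esub>} \<and> N r = carrier M \<and>
       (\<forall>i\<le>r. graded_submodule R Rg M Mg (N i)) \<and>
       (\<forall>i<r. N i \<subset> N (Suc i)) \<and>
       (\<forall>i<r. cohen_macaulay R Rg (subquot M (N (Suc i)) (N i))) \<and>
       (\<forall>i. 0 < i \<and> i < r \<longrightarrow>
          module_dim R (subquot M (N i) (N (i - 1)))
          < module_dim R (subquot M (N (Suc i)) (N i))))"

definition seq_cohen_macaulay_ideal ::
    "('a, 'r) ring_scheme \<Rightarrow> (int \<Rightarrow> 'a set) \<Rightarrow> 'a set \<Rightarrow> bool" where
  "seq_cohen_macaulay_ideal R Rg I \<longleftrightarrow>
    seq_cohen_macaulay R Rg (quot_module (ring_module R) I) (\<lambda>d. (\<lambda>a. I +>\<^bsub>R\<^esub> a) ` Rg d)"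


section \<open>The polynomial ring $K[x_1,\dots,x_n,y_1,\dots,y_n]$\<close>

datatype var = X nat | Y nat

type_synonym 'k mpoly = "(var \<Rightarrow>\<^sub>0 nat) \<Rightarrow>\<^sub>0 'k"

definition vars_upto :: "nat \<Rightarrow> var set" where
  "vars_upto n = X ` {1..n} \<union> Y ` {1..n}"

definition poly_ring :: "nat \<Rightarrow> 'k::field mpoly ring" where
  "poly_ring n =
    \<lparr>carrier = {p. \<forall>m\<in>Poly_Mapping.keys p. Poly_Mapping.keys m \<subseteq> vars_upto n},
     mult = (*), one = 1, zero = 0, add = (+)\<rparr>"

definition monom_degree :: "(var \<Rightarrow>\<^sub>0 nat) \<Rightarrow> nat" where
  "monom_degree m = (\<Sum>v\<in>Poly_Mapping.keys m. Poly_Mapping.lookup m v)"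

definition poly_grading :: "nat \<Rightarrow> int \<Rightarrow> 'k::field mpoly set" where
  "poly_grading n d =
    {p \<in> carrier (poly_ring n). \<forall>m\<in>Poly_Mapping.keys p. int (monom_degree m) = d}"

definition mvar :: "var \<Rightarrow> 'k::field mpoly" where
  "mvar v = Poly_Mapping.single (Poly_Mapping.single v 1) 1"


section \<open>Binomial edge ideals and cycles\<close>

text \<open>A simple graph on the vertex set \<open>{1..n}\<close> is given by its set \<open>E\<close> of edges, each of
  which is a two-element set of vertices.\<close>

definition binomial_edge_ideal :: "nat \<Rightarrow> nat set set \<Rightarrow> 'k::field mpoly set" where
  "binomial_edge_ideal n E = Idl\<^bsub>poly_ring n\<^esub>
    {mvar (X i) * mvar (Y j) - mvar (X j) * mvar (Y i) | i j.
       i \<in> {1..n} \<and> j \<in> {1..n} \<and> i < j \<and> {i, j} \<in> E}"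

text \<open>A cycle through all vertices \<open>1, \<dots>, n\<close>, visited in an arbitrary order
  \<open>c 0, \<dots>, c (n - 1)\<close>; meaningful for \<open>n \<ge> 3\<close>.\<close>

definition cycle_graph :: "nat \<Rightarrow> nat set set \<Rightarrow> bool" where
  "cycle_graph n E \<longleftrightarrow>
    (\<exists>c. bij_betw c {..<n} {1..n} \<and> E = {{c i, c (Suc i mod n)} | i. i < n})"

end

theory Submission
  imports Defs "HOL-Library.Product_Lexorder"
begin

text \<open>Let \<open>J\<close> be the ideal of the cycle and \<open>U\<close> the ideal of the complete graph.  The filtration is
  \<open>0 \<subset> U/J \<subset> S/J\<close>, with steps \<open>U/J\<close> of dimension \<open>n\<close> and \<open>S/U\<close> of dimension \<open>n + 1\<close>.  Each step is
  a finite free module over a polynomial ring in linear forms: along the cycle \<open>c\<^sub>0, \<dots>, c\<^sub>n\<^sub>-\<^sub>1\<close> the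
  forms \<open>x(c\<^sub>i\<^sub>+\<^sub>1) + y(c\<^sub>i)\<close>, with cyclic indices, for \<open>U/J\<close>, and, for a linear order of the vertices,
  the forms \<open>x\<^sub>1\<close>, \<open>x\<^sub>i\<^sub>+\<^sub>1 + y\<^sub>i\<close>, \<open>y\<^sub>n\<close> for \<open>S/U\<close>.  Both ideals are spanned by differences of
  monomials, so the quotients have bases indexed by normal forms of monomials.  As in a shelling, the
  normal forms fall into finitely many types, each consisting of the multiples of one monomial in one
  variable chosen from each linear form, and a linear form multiplies a normal form by its chosen
  variable up to terms of lower rank.  Freeness makes the linear forms a regular sequence, the growth
  of the basis bounds the dimension from above, and depth is at most dimension in general.\<close>

section \<open>Subrings of a commutative ring type\<close>

text \<open>\<open>S/U\<close> carries the one component of dimension \<open>n + 1\<close>; the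
  other minimal primes of \<open>J\<close> have dimension \<open>n\<close>. On monomials of full
  support both ideals have the same normal forms, so \<open>U/J\<close> lives on monomials that miss
  a vertex. A vertex order fixed in advance could cut a path of the support along which the edge
  swaps act. The order therefore starts at a missing vertex, chosen per monomial, and the linear
  forms have cyclic indices so that one sequence serves all starting points. Triangularity rests on
  a weight that is equal on the two variables of a linear form: both products with a normal form
  tie, while every reduction strictly lowers the weight. A tie survives only if the unchosen product
  is itself a normal form, and then its type has moved in a fixed direction. Where a form wraps
  around the start, one product fills the start vertex, so that the start drops or no vertex is
  missing and the term has no coordinate in \<open>U/J\<close>. Uniqueness of normal forms comes
  from invariants of the swaps, namely vertex degrees and numbers of \<open>X\<close> before missing
  vertices, not from confluence.\<close>

locale subring_type =
  fixes R :: "'a::comm_ring_1 ring" and S :: "'a set"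
  assumes R_def: "R = \<lparr>carrier = S, mult = (*), one = 1, zero = 0, add = (+)\<rparr>"
    and zero_in [simp, intro]: "0 \<in> S"
    and one_in [simp, intro]: "1 \<in> S"
    and add_in [simp, intro]: "\<And>a b. a \<in> S \<Longrightarrow> b \<in> S \<Longrightarrow> a + b \<in> S"
    and uminus_in [simp, intro]: "\<And>a. a \<in> S \<Longrightarrow> - a \<in> S"
    and mult_in [simp, intro]: "\<And>a b. a \<in> S \<Longrightarrow> b \<in> S \<Longrightarrow> a * b \<in> S"
begin

lemma R_simps [simp]:
  "carrier R = S" "mult R = (*)" "one R = 1" "zero R = 0" "add R = (+)"
  by (simp_all add: R_def)

lemma diff_in [simp, intro]: "a \<in> S \<Longrightarrow> b \<in> S \<Longrightarrow> a - b \<in> S"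
  using add_in[of a "- b"] by simp

lemma power_in [simp, intro]: "a \<in> S \<Longrightarrow> a ^ k \<in> S"
  by (induction k) auto

lemma sum_in: "(\<And>i. i \<in> A \<Longrightarrow> f i \<in> S) \<Longrightarrow> sum f A \<in> S"
  by (induction A rule: infinite_finite_induct) auto

lemma prod_in: "(\<And>i. i \<in> A \<Longrightarrow> f i \<in> S) \<Longrightarrow> prod f A \<in> S"
  by (induction A rule: infinite_finite_induct) auto

lemma cring_R: "cring R"
proof (rule cringI)
  show "abelian_group R"
    by (rule abelian_groupI) (auto simp: algebra_simps intro: bexI[of _ "- x" for x])
  show "Group.comm_monoid R"
    by unfold_locales (auto simp: algebra_simps)
qed (auto simp: algebra_simps)

lemma ring_R: "ring R"
  using cring_R by (rule cring.axioms)

lemma a_inv_R: "a \<in> S \<Longrightarrow> \<ominus>\<^bsub>R\<^esub> a = - a"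
proof -
  assume a: "a \<in> S"
  interpret cring R by (rule cring_R)
  show ?thesis using a minus_equality[of "- a" a] by simp
qed

text \<open>Ideals as plain sets with the type class operations, so that computations are ordinary
  algebra; \<open>ideal_iff\<close> translates to the library notion.\<close>

definition ideal_of :: "'a set \<Rightarrow> bool" where
  "ideal_of I \<longleftrightarrow> I \<subseteq> S \<and> 0 \<in> I \<and> (\<forall>a\<in>I. \<forall>b\<in>I. a + b \<in> I) \<and> (\<forall>r\<in>S. \<forall>a\<in>I. r * a \<in> I)"

lemma ideal_ofD:
  assumes "ideal_of I"
  shows "a \<in> I \<Longrightarrow> a \<in> S" "0 \<in> I" "a \<in> I \<Longrightarrow> b \<in> I \<Longrightarrow> a + b \<in> I"
    "r \<in> S \<Longrightarrow> a \<in> I \<Longrightarrow> r * a \<in> I" "a \<in> I \<Longrightarrow> - a \<in> I"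
    "a \<in> I \<Longrightarrow> b \<in> I \<Longrightarrow> a - b \<in> I"
proof -
  show *: "a \<in> I \<Longrightarrow> a \<in> S" "0 \<in> I" "a \<in> I \<Longrightarrow> b \<in> I \<Longrightarrow> a + b \<in> I"
    "r \<in> S \<Longrightarrow> a \<in> I \<Longrightarrow> r * a \<in> I" for a b r
    using assms by (auto simp: ideal_of_def)
  show **: "a \<in> I \<Longrightarrow> - a \<in> I" for a
    using *(4)[of "- 1" a] by simp
  show "a \<in> I \<Longrightarrow> b \<in> I \<Longrightarrow> a - b \<in> I"
    using *(3)[of a "- b"] **[of b] by simp
qed

lemma ideal_of_sum:
  assumes "ideal_of I" "\<And>i. i \<in> A \<Longrightarrow> f i \<in> I"
  shows "sum f A \<in> I"
  using assms(2) by (induction A rule: infinite_finite_induct) (auto intro: ideal_ofD[OF assms(1)])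

lemma ideal_of_S: "ideal_of S"
  by (auto simp: ideal_of_def)

lemma ideal_of_zero: "ideal_of {0}"
  by (auto simp: ideal_of_def)

lemma ideal_iff: "ideal I R \<longleftrightarrow> ideal_of I"
proof
  assume "ideal I R"
  then interpret ideal I R .
  show "ideal_of I"
    unfolding ideal_of_def
  proof (intro conjI ballI)
    show "I \<subseteq> S" using a_subset by simp
    show "0 \<in> I" using additive_subgroup.zero_closed[OF is_additive_subgroup] by simp
    show "a + b \<in> I" if "a \<in> I" "b \<in> I" for a b using additive_subgroup.a_closed[OF is_additive_subgroup that] by simp
    show "r * a \<in> I" if "r \<in> S" "a \<in> I" for r a using I_l_closed[of a r] that by simp
  qed
next
  assume I: "ideal_of I"
  show "ideal I R"
  proof (rule idealI[OF ring_R])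
    interpret cring R by (rule cring_R)
    show "subgroup I (add_monoid R)"
    proof (rule add.subgroupI)
      show "I \<subseteq> carrier R" "I \<noteq> {}" using I by (auto simp: ideal_of_def)
      show "\<ominus>\<^bsub>R\<^esub> a \<in> I" if "a \<in> I" for a
        using that ideal_ofD[OF I] by (simp add: a_inv_R)
      show "a \<oplus>\<^bsub>R\<^esub> b \<in> I" if "a \<in> I" "b \<in> I" for a b
        using that ideal_ofD[OF I] by simp
    qed
    show "x \<otimes>\<^bsub>R\<^esub> a \<in> I" "a \<otimes>\<^bsub>R\<^esub> x \<in> I" if "a \<in> I" "x \<in> carrier R" for a x
      using that ideal_ofD(4)[OF I, of x a] by (simp_all add: mult.commute)
  qed
qed

section \<open>Prime ideals and their existence\<close>

definition prime_of :: "'a set \<Rightarrow> bool" where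
  "prime_of P \<longleftrightarrow> ideal_of P \<and> 1 \<notin> P \<and> (\<forall>a\<in>S. \<forall>b\<in>S. a * b \<in> P \<longrightarrow> a \<in> P \<or> b \<in> P)"

lemma primeideal_iff: "primeideal P R \<longleftrightarrow> prime_of P"
proof
  assume "primeideal P R"
  then interpret primeideal P R .
  have "1 \<notin> P" using I_notcarr one_imp_carrier by auto
  then show "prime_of P"
    using I_prime is_ideal by (auto simp: prime_of_def ideal_iff)
next
  assume P: "prime_of P"
  show "primeideal P R"
    by (rule primeidealI) (use P cring_R in \<open>auto simp: prime_of_def ideal_iff\<close>)
qed

text \<open>An ideal maximal among those disjoint from a multiplicatively closed set is prime.\<close>

lemma exists_prime_avoiding:
  assumes I: "ideal_of I" and T: "T \<subseteq> S" "1 \<in> T" "\<And>a b. a \<in> T \<Longrightarrow> b \<in> T \<Longrightarrow> a * b \<in> T"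
    and disj: "I \<inter> T = {}"
  shows "\<exists>P. prime_of P \<and> I \<subseteq> P \<and> P \<inter> T = {}"
proof -
  let ?A = "{J. ideal_of J \<and> I \<subseteq> J \<and> J \<inter> T = {}}"
  have "\<exists>M\<in>?A. \<forall>X\<in>?A. M \<subseteq> X \<longrightarrow> X = M"
  proof (rule subset_Zorn_nonempty)
    show "?A \<noteq> {}" using I disj by auto
  next
    fix C assume C: "C \<noteq> {}" "subset.chain ?A C"
    then have sub: "C \<subseteq> ?A" and lin: "\<And>X Y. X \<in> C \<Longrightarrow> Y \<in> C \<Longrightarrow> X \<subseteq> Y \<or> Y \<subseteq> X"
      by (auto simp: subset_chain_def)
    have "ideal_of (\<Union>C)"
      unfolding ideal_of_def
    proof (intro conjI ballI)
      show "\<Union>C \<subseteq> S" "0 \<in> \<Union>C" using sub C(1) by (auto simp: ideal_of_def)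
      fix a assume "a \<in> \<Union>C"
      then obtain X where X: "X \<in> C" "a \<in> X" by auto
      show "r * a \<in> \<Union>C" if "r \<in> S" for r
        using X that sub ideal_ofD(4)[of X r a] by blast
      fix b assume "b \<in> \<Union>C"
      then obtain Y where Y: "Y \<in> C" "b \<in> Y" by auto
      from lin[OF X(1) Y(1)] show "a + b \<in> \<Union>C"
        using X Y sub ideal_ofD(3)[of X a b] ideal_ofD(3)[of Y a b] by blast
    qed
    then show "\<Union>C \<in> ?A" using sub C(1) by auto
  qed
  then obtain M where M: "ideal_of M" "I \<subseteq> M" "M \<inter> T = {}"
    and max: "\<And>X. ideal_of X \<Longrightarrow> I \<subseteq> X \<Longrightarrow> X \<inter> T = {} \<Longrightarrow> M \<subseteq> X \<Longrightarrow> X = M"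
    by auto
  \<comment> \<open>By maximality the ideal generated by \<open>M\<close> and \<open>a\<close> meets
    \<open>T\<close>. If \<open>a * b\<close> were in \<open>M\<close>, two such elements of
    \<open>T\<close> would multiply into \<open>M\<close>.\<close>
  have ext: "\<exists>m\<in>M. \<exists>r\<in>S. m + a * r \<in> T" if a: "a \<in> S" "a \<notin> M" for a
  proof (rule ccontr)
    assume neg: "\<not> ?thesis"
    let ?X = "{m + a * r | m r. m \<in> M \<and> r \<in> S}"
    have "ideal_of ?X"
      unfolding ideal_of_def
    proof (intro conjI ballI)
      show "?X \<subseteq> S" using a ideal_ofD[OF M(1)] by auto
      show "0 \<in> ?X" using ideal_ofD(2)[OF M(1)] by force
      fix x assume "x \<in> ?X"
      then obtain m r where x: "x = m + a * r" "m \<in> M" "r \<in> S" by auto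
      { fix y assume "y \<in> ?X"
        then obtain m' r' where y: "y = m' + a * r'" "m' \<in> M" "r' \<in> S" by auto
        have "x + y = (m + m') + a * (r + r')" by (simp add: x y algebra_simps)
        then show "x + y \<in> ?X" using x y ideal_ofD[OF M(1)] by blast }
      { fix s assume s: "s \<in> S"
        have "s * x = s * m + a * (s * r)" by (simp add: x algebra_simps)
        then show "s * x \<in> ?X" using x s ideal_ofD[OF M(1)] by blast }
    qed
    moreover have MX: "M \<subseteq> ?X" by force
    moreover have "?X \<inter> T = {}" using neg by auto
    ultimately have "?X = M" using max M(2) by blast
    moreover have "0 + a * 1 \<in> ?X" using ideal_ofD(2)[OF M(1)] one_in by blast
    ultimately show False using a by simp
  qed
  have "prime_of M"
    unfolding prime_of_def
  proof (intro conjI ballI impI)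
    show "ideal_of M" "1 \<notin> M" using M T by auto
    fix a b assume ab: "a \<in> S" "b \<in> S" "a * b \<in> M"
    show "a \<in> M \<or> b \<in> M"
    proof (rule ccontr)
      assume "\<not> ?thesis"
      then obtain m r m' r' where *: "m \<in> M" "r \<in> S" "m + a * r \<in> T" "m' \<in> M" "r' \<in> S" "m' + b * r' \<in> T"
        using ext[of a] ext[of b] ab by blast
      have "(m + a * r) * (m' + b * r') = (m' + b * r') * m + (a * r) * m' + (r * r') * (a * b)"
        by (simp add: algebra_simps)
      also have "\<dots> \<in> M"
      proof (intro ideal_ofD(3)[OF M(1)])
        show "(m' + b * r') * m \<in> M" using * T(1) by (blast intro: ideal_ofD(4)[OF M(1)])
        show "(a * r) * m' \<in> M" using * ab by (blast intro: ideal_ofD(4)[OF M(1)])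
        show "(r * r') * (a * b) \<in> M" using * ab by (blast intro: ideal_ofD(4)[OF M(1)])
      qed
      finally show False using T(3)[OF *(3,6)] M(3) by auto
    qed
  qed
  then show ?thesis using M by blast
qed

section \<open>Regular sequences on a quotient of ideals\<close>

text \<open>For ideals \<open>V \<subseteq> U\<close>, the module \<open>U/V\<close> is handled through the pair \<open>(U, V)\<close>:
  passing to \<open>(U/V)/a(U/V)\<close> replaces \<open>V\<close> by \<open>V + aU\<close>.\<close>

definition add_mult :: "'a set \<Rightarrow> 'a set \<Rightarrow> 'a \<Rightarrow> 'a set" where
  "add_mult U V a = {v + a * u | v u. v \<in> V \<and> u \<in> U}"

fun regular_on :: "'a set \<Rightarrow> 'a set \<Rightarrow> 'a list \<Rightarrow> bool" where
  "regular_on U V [] \<longleftrightarrow> True"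
| "regular_on U V (a # as) \<longleftrightarrow>
     (\<forall>u\<in>U. a * u \<in> V \<longrightarrow> u \<in> V) \<and> regular_on U (add_mult U V a) as"

text \<open>The annihilator of \<open>U/V\<close>: the primes above it determine the dimension of
  the module.\<close>

definition colon :: "'a set \<Rightarrow> 'a set \<Rightarrow> 'a set" where
  "colon V U = {a \<in> S. \<forall>u\<in>U. a * u \<in> V}"

lemma add_multI: "v \<in> V \<Longrightarrow> u \<in> U \<Longrightarrow> v + a * u \<in> add_mult U V a"
  by (auto simp: add_mult_def)

lemma ideal_add_mult:
  assumes "ideal_of U" "ideal_of V" "a \<in> S"
  shows "ideal_of (add_mult U V a)"
  unfolding ideal_of_def
proof (intro conjI ballI)
  show "add_mult U V a \<subseteq> S"
    using assms ideal_ofD(1)[OF assms(1)] ideal_ofD(1)[OF assms(2)] by (auto simp: add_mult_def)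
  show "0 \<in> add_mult U V a"
    using add_multI[OF ideal_ofD(2)[OF assms(2)] ideal_ofD(2)[OF assms(1)], of a] by simp
  fix x assume "x \<in> add_mult U V a"
  then obtain v u where x: "x = v + a * u" "v \<in> V" "u \<in> U" by (auto simp: add_mult_def)
  { fix y assume "y \<in> add_mult U V a"
    then obtain v' u' where y: "y = v' + a * u'" "v' \<in> V" "u' \<in> U" by (auto simp: add_mult_def)
    have "x + y = (v + v') + a * (u + u')" by (simp add: x y algebra_simps)
    then show "x + y \<in> add_mult U V a"
      using add_multI[OF ideal_ofD(3)[OF assms(2) x(2) y(2)] ideal_ofD(3)[OF assms(1) x(3) y(3)]]
      by simp }
  { fix s assume s: "s \<in> S"
    have "s * x = s * v + a * (s * u)" by (simp add: x algebra_simps)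
    then show "s * x \<in> add_mult U V a"
      using add_multI[OF ideal_ofD(4)[OF assms(2) s x(2)] ideal_ofD(4)[OF assms(1) s x(3)]]
      by simp }
qed

lemma add_mult_supset: "ideal_of U \<Longrightarrow> V \<subseteq> add_mult U V a"
  using add_multI[OF _ ideal_ofD(2)[of U], of _ V a] by auto

lemma add_mult_subset: "ideal_of U \<Longrightarrow> V \<subseteq> U \<Longrightarrow> a \<in> S \<Longrightarrow> add_mult U V a \<subseteq> U"
  using ideal_ofD(3,4)[of U] by (auto simp: add_mult_def subset_iff)

lemma ideal_foldl_add_mult:
  assumes "ideal_of U" "ideal_of V" "V \<subseteq> U" "set as \<subseteq> S"
  shows "ideal_of (foldl (add_mult U) V as) \<and> V \<subseteq> foldl (add_mult U) V as \<and>
    foldl (add_mult U) V as \<subseteq> U"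
  using assms(2-)
proof (induction as arbitrary: V)
  case (Cons b as)
  then have "b \<in> S" by simp
  then show ?case
    using Cons.IH[of "add_mult U V b"] Cons.prems ideal_add_mult[OF assms(1) Cons.prems(1), of b]
      add_mult_supset[OF assms(1), of V b] add_mult_subset[OF assms(1) Cons.prems(2), of b]
    by auto
qed auto

lemma mult_in_foldl_add_mult:
  assumes "ideal_of U" "ideal_of V" "V \<subseteq> U" "set as \<subseteq> S" "a \<in> set as" "u \<in> U"
  shows "a * u \<in> foldl (add_mult U) V as"
  using assms(2-)
proof (induction as arbitrary: V)
  case (Cons b as)
  then have b: "b \<in> S" by simp
  have V': "ideal_of (add_mult U V b)" "add_mult U V b \<subseteq> U"
    using ideal_add_mult[OF assms(1) Cons.prems(1) b] add_mult_subset[OF assms(1) Cons.prems(2) b]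
    by auto
  have "b * u \<in> add_mult U V b"
    using Cons.prems add_multI[OF ideal_ofD(2)[OF Cons.prems(1)], of u U b] by simp
  then show ?case
    using Cons.IH[OF V'] Cons.prems ideal_foldl_add_mult[OF assms(1) V', of as] by auto
qed auto

text \<open>Minimality, used to identify the iterated sum with the span that defines
  \<open>smult_submodule\<close>; there \<open>W\<close> is the preimage of an arbitrary
  submodule.\<close>

lemma foldl_add_mult_least:
  assumes "V \<subseteq> W" "\<And>a u. a \<in> set as \<Longrightarrow> u \<in> U \<Longrightarrow> a * u \<in> W" "\<And>x y. x \<in> W \<Longrightarrow> y \<in> W \<Longrightarrow> x + y \<in> W"
  shows "foldl (add_mult U) V as \<subseteq> W"
  using assms
proof (induction as arbitrary: V)
  case (Cons b as)
  have "add_mult U V b \<subseteq> W"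
    using Cons.prems by (auto simp: add_mult_def)
  then show ?case using Cons by simp
qed auto

text \<open>Passes from the recursion, which suits induction along the sequence, to the initial
  segments that occur in \<open>regular_sequence\<close>.\<close>

lemma regular_on_nth:
  "regular_on U V as \<longleftrightarrow>
    (\<forall>i<length as. \<forall>u\<in>U. as ! i * u \<in> foldl (add_mult U) V (take i as) \<longrightarrow>
       u \<in> foldl (add_mult U) V (take i as))"
proof (induction as arbitrary: V)
  case (Cons a as)
  show ?case by (simp add: Cons.IH All_less_Suc2)
qed auto

lemma ideal_colon:
  assumes "ideal_of U" "ideal_of V"
  shows "ideal_of (colon V U)"
  using ideal_ofD[OF assms(1)] ideal_ofD[OF assms(2)]
  by (auto simp: ideal_of_def colon_def algebra_simps)

lemma colon_proper:
  assumes "V \<subset> U"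
  shows "1 \<notin> colon V U"
  using assms by (auto simp: colon_def)

text \<open>Chains of primes of the ring above \<open>I\<close> stand for chains of primes of the
  quotient; containment in \<open>P 0\<close> passes to all later members.\<close>

definition prime_chain :: "'a set \<Rightarrow> nat \<Rightarrow> (nat \<Rightarrow> 'a set) \<Rightarrow> bool" where
  "prime_chain I k P \<longleftrightarrow> (\<forall>i\<le>k. prime_of (P i)) \<and> (\<forall>i<k. P i \<subset> P (Suc i)) \<and> I \<subseteq> P 0"

text \<open>Depth is at most dimension: a nonzerodivisor \<open>a\<close> on \<open>U/V\<close> avoids some prime below any given
  prime over the annihilator, because no element of the multiplicative set
  \<open>{a\<^sup>k s | s \<notin> P}\<close> annihilates \<open>U/V\<close>.\<close>

lemma prime_chain_of_regular:
  assumes "ideal_of U" "ideal_of V" "V \<subseteq> U" "set as \<subseteq> S" "regular_on U V as"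
    "foldl (add_mult U) V as \<noteq> U"
  shows "\<exists>P. prime_chain (colon V U) (length as) P"
  using assms(2-)
proof (induction as arbitrary: V)
  case Nil
  have "\<exists>P. prime_of P \<and> colon V U \<subseteq> P \<and> P \<inter> {1} = {}"
    using colon_proper[of V U] Nil assms(1)
    by (intro exists_prime_avoiding ideal_colon) auto
  then obtain P where "prime_of P" "colon V U \<subseteq> P" by auto
  then show ?case by (intro exI[of _ "\<lambda>_. P"]) (auto simp: prime_chain_def)
next
  case (Cons a as)
  let ?V' = "add_mult U V a"
  have a: "a \<in> S" using Cons.prems by auto
  have "\<exists>Q. prime_chain (colon ?V' U) (length as) Q"
  proof (rule Cons.IH)
    show "ideal_of ?V'" "?V' \<subseteq> U"
      using ideal_add_mult[OF assms(1) Cons.prems(1) a] add_mult_subset[OF assms(1) Cons.prems(2) a] .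
  qed (use Cons.prems in simp_all)
  then obtain Q where Q: "prime_chain (colon ?V' U) (length as) Q" ..
  have Q0: "prime_of (Q 0)" "ideal_of (Q 0)" using Q by (auto simp: prime_chain_def prime_of_def)
  have "a \<in> colon ?V' U"
    using a add_multI[OF ideal_ofD(2)[OF Cons.prems(1)], of _ U a] by (simp add: colon_def)
  then have aQ: "a \<in> Q 0" using Q by (auto simp: prime_chain_def)
  have colQ: "colon V U \<subseteq> Q 0"
    using Q add_mult_supset[OF assms(1), of V a] unfolding prime_chain_def colon_def by blast
  let ?T = "{a ^ k * s | k s. s \<in> S \<and> s \<notin> Q 0}"
  \<comment> \<open>Powers of a nonzerodivisor are nonzerodivisors, so if \<open>a ^ k * s\<close>
    annihilates \<open>U/V\<close>, then \<open>s\<close> does.\<close>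
  have nz: "u \<in> V" if "a ^ k * u \<in> V" "u \<in> U" for k u
    using that
  proof (induction k)
    case (Suc k)
    have "a * (a ^ k * u) \<in> V" "a ^ k * u \<in> U"
      using Suc.prems a ideal_ofD(4)[OF assms(1), of "a ^ k" u] by (simp_all add: mult.assoc)
    then show ?case using Suc Cons.prems by auto
  qed auto
  have "\<exists>P. prime_of P \<and> colon V U \<subseteq> P \<and> P \<inter> ?T = {}"
  proof (rule exists_prime_avoiding)
    show "ideal_of (colon V U)" using ideal_colon assms(1) Cons.prems by auto
    show "?T \<subseteq> S" using a by auto
    have "1 = a ^ 0 * 1" by simp
    then show "1 \<in> ?T" using Q0 unfolding prime_of_def by blast
    show "x * y \<in> ?T" if x: "x \<in> ?T" and y: "y \<in> ?T" for x y
    proof -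
      obtain k s k' s' where *: "x = a ^ k * s" "y = a ^ k' * s'" "s \<in> S" "s \<notin> Q 0" "s' \<in> S" "s' \<notin> Q 0"
        using x y by blast
      have "x * y = a ^ (k + k') * (s * s')" by (simp add: * power_add algebra_simps)
      moreover have "s * s' \<in> S" "s * s' \<notin> Q 0" using * Q0 unfolding prime_of_def by auto
      ultimately show ?thesis by blast
    qed
    show "colon V U \<inter> ?T = {}"
    proof (rule ccontr)
      assume "\<not> ?thesis"
      then obtain k s where s: "s \<in> S" "s \<notin> Q 0" "a ^ k * s \<in> colon V U" by blast
      have "s \<in> colon V U"
        unfolding colon_def
      proof (intro CollectI conjI ballI)
        fix u assume "u \<in> U"
        then show "s * u \<in> V"
          using nz[of k "s * u"] s ideal_ofD(4)[OF assms(1)] by (auto simp: colon_def mult.assoc)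
      qed (use s in auto)
      then show False using s colQ by auto
    qed
  qed
  then obtain P where P: "prime_of P" "colon V U \<subseteq> P" "P \<inter> ?T = {}" by blast
  have "P \<subseteq> Q 0"
  proof
    fix p assume p: "p \<in> P"
    show "p \<in> Q 0"
    proof (rule ccontr)
      assume "p \<notin> Q 0"
      moreover have "p \<in> S" using P(1) p ideal_ofD(1) by (auto simp: prime_of_def)
      ultimately have "a ^ 0 * p \<in> ?T" by blast
      then show False using P p by auto
    qed
  qed
  moreover have "a \<notin> P"
  proof
    assume "a \<in> P"
    have "a ^ 1 * 1 \<in> ?T" using Q0 unfolding prime_of_def by blast
    then show False using P \<open>a \<in> P\<close> by auto
  qed
  \<comment> \<open>The inclusion is strict because \<open>a\<close> lies in \<open>Q 0\<close>
    while \<open>a ^ 1 * 1\<close> belongs to \<open>?T\<close>; hence \<open>P\<close> can be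
    prepended to the chain.\<close>
  ultimately have "P \<subset> Q 0" using aQ by auto
  then have "prime_chain (colon V U) (length (a # as)) (case_nat P Q)"
    using Q P unfolding prime_chain_def by (simp add: All_less_Suc2 flip: less_Suc_eq_le)
  then show ?case by blast
qed

section \<open>Krull dimension through prime chains\<close>

text \<open>Membership in an ideal above \<open>I\<close> is constant on the cosets of
  \<open>I\<close>.\<close>

lemma prime_of_image_iff:
  assumes "ideal_of I" "prime_of P" "I \<subseteq> P" "p \<in> S"
  shows "I +>\<^bsub>R\<^esub> p \<in> (\<lambda>a. I +>\<^bsub>R\<^esub> a) ` P \<longleftrightarrow> p \<in> P"
proof
  assume "I +>\<^bsub>R\<^esub> p \<in> (\<lambda>a. I +>\<^bsub>R\<^esub> a) ` P"
  then obtain p' where p': "p' \<in> P" "I +>\<^bsub>R\<^esub> p = I +>\<^bsub>R\<^esub> p'" by auto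
  have "p \<in> I +>\<^bsub>R\<^esub> p" using ideal_ofD(2)[OF assms(1)] by (force simp: a_r_coset_def')
  then have "p \<in> I +>\<^bsub>R\<^esub> p'" using p' by simp
  then obtain i where "i \<in> I" "p = i + p'" by (auto simp: a_r_coset_def')
  then show "p \<in> P" using assms p' ideal_ofD(3) by (auto simp: prime_of_def)
qed auto

text \<open>Both suprema range over the same lengths, since image and preimage under the quotient
  map transport prime chains. Images stay strictly increasing because the primes are unions of
  cosets, preimages because the map is onto.\<close>

lemma krull_dim_quot:
  assumes I: "ideal_of I"
  shows "krull_dim (R Quot I) = Sup {enat k | k. \<exists>P. prime_chain I k P}"
proof -
  interpret cring R by (rule cring_R)
  have IR: "ideal I R" using I by (simp add: ideal_iff)
  interpret I: ideal I R by (rule IR)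
  let ?\<pi> = "\<lambda>a. I +>\<^bsub>R\<^esub> a"
  interpret h: ring_hom_ring R "R Quot I" ?\<pi> by (rule I.rcos_ring_hom_ring)
  have Qcring: "cring (R Quot I)" using I.quotient_is_cring cring_R by blast
  have carr: "carrier (R Quot I) = ?\<pi> ` S"
    by (auto simp: FactRing_def A_RCOSETS_def')
  have push: "primeideal (?\<pi> ` P) (R Quot I)" if P: "prime_of P" "I \<subseteq> P" for P
  proof (rule primeidealI)
    have "ideal P R" using P by (simp add: ideal_iff prime_of_def)
    then show "ideal (?\<pi> ` P) (R Quot I)"
      using ring_ideal_imp_quot_ideal[OF IR] by simp
    show "cring (R Quot I)" by fact
    have "?\<pi> 1 \<notin> ?\<pi> ` P" using prime_of_image_iff[OF I P, of 1] P by (auto simp: prime_of_def)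
    then show "carrier (R Quot I) \<noteq> ?\<pi> ` P" using imageI[OF one_in, of ?\<pi>] unfolding carr by blast
    fix a b assume ab: "a \<in> carrier (R Quot I)" "b \<in> carrier (R Quot I)" "a \<otimes>\<^bsub>R Quot I\<^esub> b \<in> ?\<pi> ` P"
    then obtain x y where xy: "x \<in> S" "y \<in> S" "a = ?\<pi> x" "b = ?\<pi> y" by (auto simp: carr)
    then have "?\<pi> (x * y) \<in> ?\<pi> ` P" using ab h.hom_mult[of x y] by simp
    then have "x * y \<in> P" using prime_of_image_iff[OF I P, of "x * y"] xy by simp
    then have "x \<in> P \<or> y \<in> P" using P xy unfolding prime_of_def by blast
    then show "a \<in> ?\<pi> ` P \<or> b \<in> ?\<pi> ` P" using xy by blast
  qed
  have pull: "prime_of {r \<in> S. ?\<pi> r \<in> Q}" "I \<subseteq> {r \<in> S. ?\<pi> r \<in> Q}" if Q: "primeideal Q (R Quot I)" for Q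
  proof -
    show "prime_of {r \<in> S. ?\<pi> r \<in> Q}"
      using h.primeideal_vimage[OF cring_R Q] by (simp add: primeideal_iff)
    interpret Q: primeideal Q "R Quot I" by (rule Q)
    have "?\<pi> i = \<zero>\<^bsub>R Quot I\<^esub>" if "i \<in> I" for i
      using that I.a_rcos_const by (simp add: FactRing_def)
    then show "I \<subseteq> {r \<in> S. ?\<pi> r \<in> Q}" using ideal_ofD(1)[OF I] Q.zero_closed by auto
  qed
  have "(\<exists>P. (\<forall>i\<le>k. primeideal (P i) (R Quot I)) \<and> (\<forall>i<k. P i \<subset> P (Suc i))) \<longleftrightarrow>
    (\<exists>P. prime_chain I k P)" for k
  proof
    assume "\<exists>P. (\<forall>i\<le>k. primeideal (P i) (R Quot I)) \<and> (\<forall>i<k. P i \<subset> P (Suc i))"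
    then obtain P where P: "\<forall>i\<le>k. primeideal (P i) (R Quot I)" "\<forall>i<k. P i \<subset> P (Suc i)" by blast
    have sub: "P i \<subseteq> ?\<pi> ` S" if "i \<le> k" for i
    proof -
      interpret Q: primeideal "P i" "R Quot I" using P that by simp
      show ?thesis using Q.a_subset carr by simp
    qed
    have "{r \<in> S. ?\<pi> r \<in> P i} \<subset> {r \<in> S. ?\<pi> r \<in> P (Suc i)}" if "i < k" for i
    proof -
      have lt: "P i \<subset> P (Suc i)" using P(2) that by simp
      then obtain y where y: "y \<in> P (Suc i)" "y \<notin> P i" by blast
      have "y \<in> ?\<pi> ` S" using subsetD[OF sub y(1)] that by simp
      then obtain r where r: "r \<in> S" "y = ?\<pi> r" by (rule imageE)
      show ?thesis
      proof (rule psubsetI)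
        show "{r \<in> S. ?\<pi> r \<in> P i} \<subseteq> {r \<in> S. ?\<pi> r \<in> P (Suc i)}" using lt by blast
        show "{r \<in> S. ?\<pi> r \<in> P i} \<noteq> {r \<in> S. ?\<pi> r \<in> P (Suc i)}" using r y by blast
      qed
    qed
    then have "prime_chain I k (\<lambda>i. {r \<in> S. ?\<pi> r \<in> P i})"
      unfolding prime_chain_def using pull P(1) by simp
    then show "\<exists>P. prime_chain I k P" by blast
  next
    assume "\<exists>P. prime_chain I k P"
    then obtain P where P: "prime_chain I k P" by blast
    have sup: "I \<subseteq> P i" if "i \<le> k" for i
      using that
    proof (induction i)
      case (Suc i)
      then have "P i \<subset> P (Suc i)" "I \<subseteq> P i" using P by (simp_all add: prime_chain_def)
      then show ?case by blast
    qed (use P in \<open>simp add: prime_chain_def\<close>)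
    have "?\<pi> ` P i \<subset> ?\<pi> ` P (Suc i)" if i: "i < k" for i
    proof -
      have prm: "prime_of (P i)" "prime_of (P (Suc i))" "P i \<subset> P (Suc i)"
        using P i by (simp_all add: prime_chain_def)
      then obtain y where y: "y \<in> P (Suc i)" "y \<notin> P i" by blast
      have "y \<in> S" using prm y ideal_ofD(1)[of "P (Suc i)"] by (simp add: prime_of_def)
      then have "?\<pi> y \<notin> ?\<pi> ` P i"
        using prime_of_image_iff[OF I prm(1) sup, of y] y i by simp
      then show ?thesis using y prm by blast
    qed
    moreover have "primeideal (?\<pi> ` P i) (R Quot I)" if "i \<le> k" for i
      using push[OF _ sup[OF that]] P that by (simp add: prime_chain_def)
    ultimately show "\<exists>P. (\<forall>i\<le>k. primeideal (P i) (R Quot I)) \<and> (\<forall>i<k. P i \<subset> P (Suc i))"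
      by (intro exI[of _ "\<lambda>i. ?\<pi> ` P i"]) simp
  qed
  then show ?thesis by (simp add: krull_dim_def)
qed

section \<open>Modules presented as quotients of ideals\<close>

text \<open>A linear surjection \<open>\<phi>\<close> from \<open>U\<close> onto \<open>M\<close>
  with kernel \<open>V\<close>. The elements of a subquotient of \<open>S/J\<close> are cosets of
  cosets; with \<open>\<phi>\<close> on record, restriction to a submodule and passage to a quotient
  are again described by a pair of ideals of \<open>S\<close>.\<close>

definition presents :: "('a, 'b, 'c) module_scheme \<Rightarrow> 'a set \<Rightarrow> 'a set \<Rightarrow> ('a \<Rightarrow> 'b) \<Rightarrow> bool" where
  "presents M U V \<phi> \<longleftrightarrow> ideal_of U \<and> ideal_of V \<and> V \<subseteq> U \<and> carrier M = \<phi> ` U \<and> \<zero>\<^bsub>M\<^esub> = \<phi> 0 \<and>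
    (\<forall>u\<in>U. \<forall>u'\<in>U. \<phi> u \<oplus>\<^bsub>M\<^esub> \<phi> u' = \<phi> (u + u')) \<and>
    (\<forall>r\<in>S. \<forall>u\<in>U. r \<odot>\<^bsub>M\<^esub> \<phi> u = \<phi> (r * u)) \<and>
    (\<forall>u\<in>U. \<forall>u'\<in>U. \<phi> u = \<phi> u' \<longleftrightarrow> u - u' \<in> V)"

lemma presentsD:
  assumes "presents M U V \<phi>"
  shows "ideal_of U" "ideal_of V" "V \<subseteq> U" "carrier M = \<phi> ` U" "\<zero>\<^bsub>M\<^esub> = \<phi> 0"
    "u \<in> U \<Longrightarrow> u' \<in> U \<Longrightarrow> \<phi> u \<oplus>\<^bsub>M\<^esub> \<phi> u' = \<phi> (u + u')"
    "r \<in> S \<Longrightarrow> u \<in> U \<Longrightarrow> r \<odot>\<^bsub>M\<^esub> \<phi> u = \<phi> (r * u)"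
    "u \<in> U \<Longrightarrow> u' \<in> U \<Longrightarrow> \<phi> u = \<phi> u' \<longleftrightarrow> u - u' \<in> V"
  using assms unfolding presents_def by blast+

lemma presents_eq_zero_iff:
  assumes "presents M U V \<phi>" "u \<in> U"
  shows "\<phi> u = \<zero>\<^bsub>M\<^esub> \<longleftrightarrow> u \<in> V"
  using presentsD(5)[OF assms(1)] presentsD(8)[OF assms(1,2), of 0]
    ideal_ofD(2)[OF presentsD(1)[OF assms(1)]] by simp

lemma presents_module:
  assumes "presents M U V \<phi>"
  shows "Module.module R M"
proof -
  note P = presentsD[OF assms] and U = ideal_ofD[OF presentsD(1)[OF assms]]
  show ?thesis
  proof (rule moduleI)
    show "cring R" by (rule cring_R)
    show "abelian_group M"
    proof (rule abelian_groupI)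
      fix x assume "x \<in> carrier M"
      then obtain u where u: "u \<in> U" "x = \<phi> u" by (auto simp: P(4))
      show "\<zero>\<^bsub>M\<^esub> \<oplus>\<^bsub>M\<^esub> x = x" using u U(2) by (simp add: P(5,6))
      show "\<exists>y\<in>carrier M. y \<oplus>\<^bsub>M\<^esub> x = \<zero>\<^bsub>M\<^esub>"
        using u U(5)[of u] by (intro bexI[of _ "\<phi> (- u)"]) (simp_all add: P(4-6))
      fix y assume "y \<in> carrier M"
      then obtain v where v: "v \<in> U" "y = \<phi> v" by (auto simp: P(4))
      show "x \<oplus>\<^bsub>M\<^esub> y \<in> carrier M" using u v U(3)[of u v] by (simp add: P(4,6))
      show "x \<oplus>\<^bsub>M\<^esub> y = y \<oplus>\<^bsub>M\<^esub> x" using u v by (simp add: P(6) add.commute)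
      fix z assume "z \<in> carrier M"
      then obtain w where w: "w \<in> U" "z = \<phi> w" by (auto simp: P(4))
      show "(x \<oplus>\<^bsub>M\<^esub> y) \<oplus>\<^bsub>M\<^esub> z = x \<oplus>\<^bsub>M\<^esub> (y \<oplus>\<^bsub>M\<^esub> z)"
        using u v w U(3) by (simp add: P(6) add.assoc)
    next
      show "\<zero>\<^bsub>M\<^esub> \<in> carrier M" using U(2) by (simp add: P(4,5))
    qed
  next
    fix r x assume r: "r \<in> carrier R" and "x \<in> carrier M"
    then obtain u where u: "u \<in> U" "x = \<phi> u" by (auto simp: P(4))
    show "r \<odot>\<^bsub>M\<^esub> x \<in> carrier M" using r u U(4)[of r u] by (simp add: P(4,7))
    { fix s assume s: "s \<in> carrier R"
      show "(r \<oplus>\<^bsub>R\<^esub> s) \<odot>\<^bsub>M\<^esub> x = r \<odot>\<^bsub>M\<^esub> x \<oplus>\<^bsub>M\<^esub> s \<odot>\<^bsub>M\<^esub> x"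
        using r s u U(4)[of r u] U(4)[of s u] by (simp add: P(6,7) distrib_right)
      show "(r \<otimes>\<^bsub>R\<^esub> s) \<odot>\<^bsub>M\<^esub> x = r \<odot>\<^bsub>M\<^esub> (s \<odot>\<^bsub>M\<^esub> x)"
        using r s u U(4)[of s u] by (simp add: P(7) mult.assoc) }
    fix y assume "y \<in> carrier M"
    then obtain v where v: "v \<in> U" "y = \<phi> v" by (auto simp: P(4))
    show "r \<odot>\<^bsub>M\<^esub> (x \<oplus>\<^bsub>M\<^esub> y) = r \<odot>\<^bsub>M\<^esub> x \<oplus>\<^bsub>M\<^esub> r \<odot>\<^bsub>M\<^esub> y"
      using r u v U(3)[of u v] U(4)[of r u] U(4)[of r v] by (simp add: P(6,7) distrib_left)
  next
    fix x assume "x \<in> carrier M"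
    then show "\<one>\<^bsub>R\<^esub> \<odot>\<^bsub>M\<^esub> x = x" by (auto simp: P(4,7))
  qed
qed

lemma presents_a_inv:
  assumes "presents M U V \<phi>" "u \<in> U"
  shows "\<ominus>\<^bsub>M\<^esub> \<phi> u = \<phi> (- u)"
proof -
  interpret Module.module R M using assms(1) by (rule presents_module)
  note P = presentsD[OF assms(1)] and U = ideal_ofD[OF presentsD(1)[OF assms(1)]]
  show ?thesis
    using M.minus_equality[of "\<phi> (- u)" "\<phi> u"] U(5)[OF assms(2)] assms(2)
    by (simp add: P(4,5,6))
qed

lemma presents_mem_image_iff:
  assumes "presents M U V \<phi>" "ideal_of W" "V \<subseteq> W" "W \<subseteq> U" "u \<in> U"
  shows "\<phi> u \<in> \<phi> ` W \<longleftrightarrow> u \<in> W"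
proof
  assume "\<phi> u \<in> \<phi> ` W"
  then obtain w where w: "w \<in> W" "\<phi> u = \<phi> w" by auto
  then have "u - w \<in> V" using presentsD(8)[OF assms(1,5), of w] assms(4) by auto
  then have "u - w + w \<in> W" using w assms(3) ideal_ofD(3)[OF assms(2)] by blast
  then show "u \<in> W" by simp
qed auto

lemma presents_submodule:
  assumes "presents M U V \<phi>" "ideal_of W" "W \<subseteq> U"
  shows "submodule (\<phi> ` W) R M"
proof -
  interpret Module.module R M using assms(1) by (rule presents_module)
  note P = presentsD[OF assms(1)] and W = ideal_ofD[OF assms(2)]
  show ?thesis
  proof (rule submoduleI)
    show "\<phi> ` W \<subseteq> carrier M" using assms(3) by (auto simp: P(4))
    show "\<zero>\<^bsub>M\<^esub> \<in> \<phi> ` W" using W(2) by (simp add: P(5))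
    fix a assume "a \<in> \<phi> ` W"
    then obtain u where u: "u \<in> W" "a = \<phi> u" by auto
    with assms(3) have uU: "u \<in> U" by auto
    show "\<ominus>\<^bsub>M\<^esub> a \<in> \<phi> ` W" using u W(5) uU by (simp add: presents_a_inv[OF assms(1)])
    show "r \<odot>\<^bsub>M\<^esub> a \<in> \<phi> ` W" if "r \<in> carrier R" for r using that u W(4) uU by (simp add: P(7))
    fix b assume "b \<in> \<phi> ` W"
    then obtain v where v: "v \<in> W" "b = \<phi> v" by auto
    with assms(3) have vU: "v \<in> U" by auto
    show "a \<oplus>\<^bsub>M\<^esub> b \<in> \<phi> ` W" using u v W(3) uU vU by (simp add: P(6))
  qed
qed

lemma presents_ring_module: "presents (ring_module R) S {0} (\<lambda>u. u)"
  by (simp add: presents_def ideal_of_S ideal_of_zero ring_module_def)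

lemma presents_restrict:
  assumes "presents M U V \<phi>" "ideal_of W" "V \<subseteq> W" "W \<subseteq> U"
  shows "presents (M\<lparr>carrier := \<phi> ` W\<rparr>) W V \<phi>"
  unfolding presents_def using assms(2-) presentsD[OF assms(1)] by (simp add: subset_iff)

lemma presents_coset:
  assumes "presents M U V \<phi>" "W \<subseteq> U" "u \<in> U"
  shows "\<phi> ` W +>\<^bsub>M\<^esub> \<phi> u = \<phi> ` ((\<lambda>w. w + u) ` W)"
proof -
  have "\<phi> w \<oplus>\<^bsub>M\<^esub> \<phi> u = \<phi> (w + u)" if "w \<in> W" for w
    using that assms by (auto simp: presentsD(6)[OF assms(1)])
  then show ?thesis by (auto simp: a_r_coset_def' image_iff)
qed

text \<open>The third isomorphism theorem: \<open>(U/V)/(W/V)\<close> is again presented by ideals,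
  namely by \<open>U\<close> and \<open>W\<close>.\<close>

lemma presents_quot:
  assumes pr: "presents M U V \<phi>" and W: "ideal_of W" "V \<subseteq> W" "W \<subseteq> U"
  shows "presents (quot_module M (\<phi> ` W)) U W (\<lambda>u. \<phi> ` W +>\<^bsub>M\<^esub> \<phi> u)"
proof -
  note P = presentsD[OF pr] and U = ideal_ofD[OF presentsD(1)[OF pr]] and WD = ideal_ofD[OF W(1)]
  note coset = presents_coset[OF pr W(3)]
  let ?\<psi> = "\<lambda>u. \<phi> ` W +>\<^bsub>M\<^esub> \<phi> u"
  have eq: "?\<psi> u = ?\<psi> u' \<longleftrightarrow> u - u' \<in> W" if u: "u \<in> U" "u' \<in> U" for u u'
  proof
    assume "?\<psi> u = ?\<psi> u'"
    moreover have "\<phi> (0 + u) \<in> ?\<psi> u" unfolding coset[OF u(1)] using WD(2) by blast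
    ultimately obtain w where w: "w \<in> W" "\<phi> u = \<phi> (w + u')" using coset[OF u(2)] by auto
    have "w + u' \<in> U" using w u W(3) U(3) by blast
    then have "u - (w + u') \<in> V" using w u P(8) by blast
    then have "(u - (w + u')) + w \<in> W" using w W WD(3) by blast
    then show "u - u' \<in> W" by simp
  next
    assume d: "u - u' \<in> W"
    have "(\<lambda>w. w + u) ` W = (\<lambda>w. w + u') ` W"
    proof (intro equalityI subsetI)
      fix x assume "x \<in> (\<lambda>w. w + u) ` W"
      then obtain w where w: "w \<in> W" "x = w + u" by auto
      then have "x = (w + (u - u')) + u'" "w + (u - u') \<in> W" using d WD(3) by (simp, blast)
      then show "x \<in> (\<lambda>w. w + u') ` W" by blast
    next
      fix x assume "x \<in> (\<lambda>w. w + u') ` W"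
      then obtain w where w: "w \<in> W" "x = w + u'" by auto
      then have "x = (w - (u - u')) + u" "w - (u - u') \<in> W" using d WD(6) by (simp, blast)
      then show "x \<in> (\<lambda>w. w + u) ` W" by blast
    qed
    then show "?\<psi> u = ?\<psi> u'" using coset u by simp
  qed
  show ?thesis
    unfolding presents_def
  proof (intro conjI ballI)
    show "carrier (quot_module M (\<phi> ` W)) = ?\<psi> ` U"
      by (auto simp: quot_module_def A_RCOSETS_def' P(4))
    show "\<zero>\<^bsub>quot_module M (\<phi> ` W)\<^esub> = ?\<psi> 0"
      unfolding coset[OF U(2)] by (simp add: quot_module_def)
  next
    fix u u' assume u: "u \<in> U" "u' \<in> U"
    show "?\<psi> u \<oplus>\<^bsub>quot_module M (\<phi> ` W)\<^esub> ?\<psi> u' = ?\<psi> (u + u')"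
    proof -
      have sum: "\<phi> (w + u) \<oplus>\<^bsub>M\<^esub> \<phi> (w' + u') = \<phi> ((w + w') + (u + u'))" if "w \<in> W" "w' \<in> W" for w w'
        using that u W(3) U(3) P(6)[of "w + u" "w' + u'"] by (auto simp: algebra_simps subset_iff)
      have "?\<psi> u \<oplus>\<^bsub>quot_module M (\<phi> ` W)\<^esub> ?\<psi> u' =
          {\<phi> ((w + w') + (u + u')) | w w'. w \<in> W \<and> w' \<in> W}"
        unfolding coset[OF u(1)] coset[OF u(2)]
        by (simp add: quot_module_def set_add_def') (use sum in fastforce)
      also have "\<dots> = \<phi> ` ((\<lambda>w. w + (u + u')) ` W)"
      proof (intro equalityI subsetI)
        fix x assume "x \<in> {\<phi> ((w + w') + (u + u')) | w w'. w \<in> W \<and> w' \<in> W}"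
        then show "x \<in> \<phi> ` ((\<lambda>w. w + (u + u')) ` W)" using WD(3) by blast
      next
        fix x assume "x \<in> \<phi> ` ((\<lambda>w. w + (u + u')) ` W)"
        then obtain w where "w \<in> W" "x = \<phi> ((w + 0) + (u + u'))" by auto
        then show "x \<in> {\<phi> ((w + w') + (u + u')) | w w'. w \<in> W \<and> w' \<in> W}" using WD(2) by blast
      qed
      finally show ?thesis using coset[OF U(3)[OF u]] by simp
    qed
    show "?\<psi> u = ?\<psi> u' \<longleftrightarrow> u - u' \<in> W" using eq u by simp
  next
    \<comment> \<open>The scalar multiple in \<open>quot_module\<close> is a union over all
      representatives of the coset; its members coincide and there is at least one.\<close>
    fix r u assume r: "r \<in> S" and u: "u \<in> U"
    have "\<phi> ` W +>\<^bsub>M\<^esub> (r \<odot>\<^bsub>M\<^esub> x) = ?\<psi> (r * u)" if x: "x \<in> ?\<psi> u" for x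
    proof -
      obtain w where w: "w \<in> W" "x = \<phi> (w + u)" using x coset[OF u] by auto
      have wu: "w + u \<in> U" using w u W(3) U(3) by blast
      then have "r \<odot>\<^bsub>M\<^esub> x = \<phi> (r * (w + u))" using r w by (simp add: P(7))
      moreover have "?\<psi> (r * (w + u)) = ?\<psi> (r * u)"
        using eq[of "r * (w + u)" "r * u"] U(4)[OF r wu] U(4)[OF r u] WD(4)[OF r w(1)]
        by (simp add: algebra_simps)
      ultimately show ?thesis by simp
    qed
    moreover have "?\<psi> u \<noteq> {}" unfolding coset[OF u] using WD(2) by blast
    ultimately show "r \<odot>\<^bsub>quot_module M (\<phi> ` W)\<^esub> ?\<psi> u = ?\<psi> (r * u)"
      by (simp add: quot_module_def)
  qed (use P W in auto)
qed

lemma presents_smult_submodule: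
  assumes pr: "presents M U V \<phi>" and as: "set as \<subseteq> S"
  shows "smult_submodule R M (set as) = \<phi> ` foldl (add_mult U) V as"
proof -
  note P = presentsD[OF pr]
  let ?W = "foldl (add_mult U) V as"
  have W: "ideal_of ?W" "V \<subseteq> ?W" "?W \<subseteq> U"
    using ideal_foldl_add_mult[OF P(1-3) as] by auto
  have gen: "{a \<odot>\<^bsub>M\<^esub> x | a x. a \<in> set as \<and> x \<in> carrier M} \<subseteq> \<phi> ` ?W"
  proof
    fix y assume "y \<in> {a \<odot>\<^bsub>M\<^esub> x | a x. a \<in> set as \<and> x \<in> carrier M}"
    then obtain a u where "a \<in> set as" "u \<in> U" "y = a \<odot>\<^bsub>M\<^esub> \<phi> u" by (auto simp: P(4))
    then show "y \<in> \<phi> ` ?W"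
      using mult_in_foldl_add_mult[OF P(1-3) as] as by (auto simp: P(7) subset_iff)
  qed
  have "\<phi> ` ?W \<subseteq> N"
    if N: "submodule N R M" "{a \<odot>\<^bsub>M\<^esub> x | a x. a \<in> set as \<and> x \<in> carrier M} \<subseteq> N" for N
  proof -
    interpret Module.module R M using pr by (rule presents_module)
    note E = submoduleE[OF N(1)]
    have "?W \<subseteq> {u \<in> U. \<phi> u \<in> N}"
    proof (rule foldl_add_mult_least)
      have zN: "\<zero>\<^bsub>M\<^esub> \<in> N"
        using N(1) unfolding submodule_def by (auto dest: subgroup.one_closed)
      show "V \<subseteq> {u \<in> U. \<phi> u \<in> N}"
      proof
        fix v assume v: "v \<in> V"
        then have "\<phi> v = \<zero>\<^bsub>M\<^esub>" using presents_eq_zero_iff[OF pr] P(3) by auto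
        then show "v \<in> {u \<in> U. \<phi> u \<in> N}" using zN v P(3) by auto
      qed
      show "a * u \<in> {u \<in> U. \<phi> u \<in> N}" if a: "a \<in> set as" and u: "u \<in> U" for a u
      proof -
        have "a \<odot>\<^bsub>M\<^esub> \<phi> u \<in> N" using N(2) a u by (auto simp: P(4))
        then show ?thesis using a u as ideal_ofD(4)[OF P(1)] P(7) by (auto simp: subset_iff)
      qed
      show "x + y \<in> {u \<in> U. \<phi> u \<in> N}" if "x \<in> {u \<in> U. \<phi> u \<in> N}" "y \<in> {u \<in> U. \<phi> u \<in> N}" for x y
        using that E(5)[of "\<phi> x" "\<phi> y"] ideal_ofD(3)[OF P(1), of x y] P(6)[of x y] by auto
    qed
    then show ?thesis by auto
  qed
  then show ?thesis
    unfolding smult_submodule_def submodule_span_def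
    using gen presents_submodule[OF pr W(1,3)] by (intro equalityI) blast+
qed

lemma presents_regular_sequence_iff:
  assumes pr: "presents M U V \<phi>" and as: "set as \<subseteq> S"
  shows "regular_sequence R M as \<longleftrightarrow> regular_on U V as \<and> foldl (add_mult U) V as \<noteq> U"
proof -
  note P = presentsD[OF pr]
  have nzd: "module_nonzerodivisor (quot_module M (smult_submodule R M (set (take i as)))) (as ! i) \<longleftrightarrow>
    (\<forall>u\<in>U. as ! i * u \<in> foldl (add_mult U) V (take i as) \<longrightarrow> u \<in> foldl (add_mult U) V (take i as))"
    if i: "i < length as" for i
  proof -
    let ?W = "foldl (add_mult U) V (take i as)"
    have sub: "set (take i as) \<subseteq> S" using as set_take_subset[of i as] by blast
    have W: "ideal_of ?W" "V \<subseteq> ?W" "?W \<subseteq> U"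
      using ideal_foldl_add_mult[OF P(1-3) sub] by auto
    note Q = presents_quot[OF pr W]
    have ai: "as ! i \<in> S" using as i nth_mem by blast
    show ?thesis
      unfolding presents_smult_submodule[OF pr sub] module_nonzerodivisor_def presentsD(4)[OF Q]
      using ai presents_eq_zero_iff[OF Q] presentsD(7)[OF Q ai] ideal_ofD(4)[OF P(1) ai] by simp
  qed
  have "smult_submodule R M (set as) \<noteq> carrier M \<longleftrightarrow> foldl (add_mult U) V as \<noteq> U"
  proof -
    have W: "ideal_of (foldl (add_mult U) V as)" "V \<subseteq> foldl (add_mult U) V as" "foldl (add_mult U) V as \<subseteq> U"
      using ideal_foldl_add_mult[OF P(1-3) as] by auto
    have "U \<subseteq> foldl (add_mult U) V as" if "\<phi> ` U \<subseteq> \<phi> ` foldl (add_mult U) V as"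
      using that presents_mem_image_iff[OF pr W] by blast
    then show ?thesis
      unfolding presents_smult_submodule[OF pr as] P(4) using W(3) by blast
  qed
  then show ?thesis
    unfolding regular_sequence_def regular_on_nth using as nzd by auto
qed

lemma presents_annihilator:
  assumes "presents M U V \<phi>"
  shows "annihilator R M = colon V U"
  using presentsD(4,7)[OF assms] presents_eq_zero_iff[OF assms] ideal_ofD(4)[OF presentsD(1)[OF assms]]
  by (auto simp: annihilator_def colon_def)

text \<open>A squeeze: the given sequence bounds the depth from below, the assumption on chains
  bounds the dimension from above by the same number, and \<open>prime_chain_of_regular\<close>,
  applied to arbitrary regular sequences, puts the depth below the dimension.\<close>

lemma presents_cohen_macaulay:
  assumes pr: "presents M U V \<phi>"
    and as: "set as \<subseteq> irrelevant_ideal R Rg" "set as \<subseteq> S" "regular_on U V as" "foldl (add_mult U) V as \<noteq> U"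
    and dim: "\<And>k P. prime_chain (colon V U) k P \<Longrightarrow> k \<le> length as"
  shows "cohen_macaulay R Rg M" "module_dim R M = enat (length as)"
proof -
  note P = presentsD[OF pr]
  have md: "module_dim R M = Sup {enat k | k. \<exists>P. prime_chain (colon V U) k P}"
    unfolding module_dim_def presents_annihilator[OF pr]
    by (rule krull_dim_quot[OF ideal_colon[OF P(1,2)]])
  have le: "module_dim R M \<le> enat (length as)"
    unfolding md using dim by (auto intro!: Sup_least)
  have "regular_sequence R M as"
    using presents_regular_sequence_iff[OF pr as(2)] as by simp
  then have ge: "enat (length as) \<le> depth R (irrelevant_ideal R Rg) M"
    unfolding depth_def using as by (intro Sup_upper) auto
  have "depth R (irrelevant_ideal R Rg) M \<le> module_dim R M"
    unfolding depth_def
  proof (rule Sup_least, clarify)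
    fix bs assume "regular_sequence R M bs"
    moreover then have "set bs \<subseteq> S" by (simp add: regular_sequence_def)
    ultimately have "regular_on U V bs" "foldl (add_mult U) V bs \<noteq> U" "set bs \<subseteq> S"
      using presents_regular_sequence_iff[OF pr, of bs] by auto
    then obtain Q where "prime_chain (colon V U) (length bs) Q"
      using prime_chain_of_regular[OF P(1-3)] by blast
    then show "enat (length bs) \<le> module_dim R M"
      unfolding md by (intro Sup_upper) auto
  qed
  then show "cohen_macaulay R Rg M" "module_dim R M = enat (length as)"
    using le ge by (auto simp: cohen_macaulay_def)
qed

end

section \<open>Homogeneous ideals and the criterion for a filtration with two steps\<close>

locale graded_subring_type = subring_type +
  fixes Rg :: "int \<Rightarrow> 'a set" and comp :: "int \<Rightarrow> 'a \<Rightarrow> 'a"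
  assumes Rg_sub: "Rg d \<subseteq> S"
    and Rg_zero: "0 \<in> Rg d"
    and Rg_add: "a \<in> Rg d \<Longrightarrow> b \<in> Rg d \<Longrightarrow> a + b \<in> Rg d"
    and Rg_uminus: "a \<in> Rg d \<Longrightarrow> - a \<in> Rg d"
    and Rg_mult: "a \<in> Rg d \<Longrightarrow> b \<in> Rg e \<Longrightarrow> a * b \<in> Rg (d + e)"
    and comp_in: "a \<in> S \<Longrightarrow> comp d a \<in> Rg d"
    and comp_diff: "comp d (a - b) = comp d a - comp d b"
    and comp_homogeneous: "a \<in> Rg e \<Longrightarrow> comp d a = (if d = e then a else 0)"
    and comp_finite: "finite {d. comp d a \<noteq> 0}"
    and comp_sum: "a \<in> S \<Longrightarrow> a = (\<Sum>d\<in>{d. comp d a \<noteq> 0}. comp d a)"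
begin

lemma comp_zero: "comp d 0 = 0"
  using comp_diff[of d 0 0] by simp

lemma comp_add: "comp d (a + b) = comp d a + comp d b"
  using comp_diff[of d "a + b" b] by simp

lemma comp_of_sum: "comp d (sum f A) = (\<Sum>i\<in>A. comp d (f i))"
  by (induction A rule: infinite_finite_induct) (auto simp: comp_zero comp_add)

definition homogeneous_ideal :: "'a set \<Rightarrow> bool" where
  "homogeneous_ideal I \<longleftrightarrow> ideal_of I \<and> (\<forall>a\<in>I. \<forall>d. comp d a \<in> I)"

lemma presents_finsum:
  assumes "presents M U V \<phi>" "\<And>d. d \<in> A \<Longrightarrow> g d \<in> U" "finite A"
  shows "finsum M (\<lambda>d. \<phi> (g d)) A = \<phi> (sum g A)"
proof -
  interpret Module.module R M using assms(1) by (rule presents_module)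
  note P = presentsD[OF assms(1)]
  show ?thesis using assms(3,2)
  proof (induction A)
    case empty then show ?case by (simp add: P(5))
  next
    case (insert x F)
    have "finsum M (\<lambda>d. \<phi> (g d)) (insert x F) = \<phi> (g x) \<oplus>\<^bsub>M\<^esub> finsum M (\<lambda>d. \<phi> (g d)) F"
      using insert by (intro M.finsum_insert) (auto simp: P(4))
    also have "\<dots> = \<phi> (g x + sum g F)"
      using insert ideal_of_sum[OF P(1), of F g] by (simp add: P(6))
    finally show ?case using insert by simp
  qed
qed

text \<open>A decomposition of a class comes from the components of a representative. It is unique
  because two decompositions differ by an element of \<open>V\<close>, whose components lie in
  \<open>V\<close> again.\<close>

lemma presents_graded:
  assumes pr: "presents M U V \<phi>" and U: "homogeneous_ideal U" and V: "homogeneous_ideal V"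
  shows "graded_module R Rg M (\<lambda>d. \<phi> ` (Rg d \<inter> U))"
proof -
  interpret Module.module R M using pr by (rule presents_module)
  note P = presentsD[OF pr] and UD = ideal_ofD[OF presentsD(1)[OF pr]]
  show ?thesis
    unfolding graded_module_def
  proof (intro conjI allI ballI)
    show "Module.module R M" by (rule module_axioms)
    show "additive_subgroup (\<phi> ` (Rg d \<inter> U)) M" for d
    proof (rule additive_subgroup.intro, rule M.add.subgroupI)
      show "\<phi> ` (Rg d \<inter> U) \<subseteq> carrier M" by (auto simp: P(4))
      show "\<phi> ` (Rg d \<inter> U) \<noteq> {}" using Rg_zero UD(2) by auto
      fix a assume "a \<in> \<phi> ` (Rg d \<inter> U)"
      then obtain u where u: "u \<in> Rg d" "u \<in> U" "a = \<phi> u" by auto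
      show "\<ominus>\<^bsub>M\<^esub> a \<in> \<phi> ` (Rg d \<inter> U)"
        using u Rg_uminus UD(5) by (simp add: presents_a_inv[OF pr])
      fix b assume "b \<in> \<phi> ` (Rg d \<inter> U)"
      then obtain v where v: "v \<in> Rg d" "v \<in> U" "b = \<phi> v" by auto
      show "a \<oplus>\<^bsub>M\<^esub> b \<in> \<phi> ` (Rg d \<inter> U)"
        using u v Rg_add UD(3) by (simp add: P(6))
    qed
    show "a \<odot>\<^bsub>M\<^esub> x \<in> \<phi> ` (Rg (i + j) \<inter> U)" if "a \<in> Rg i" "x \<in> \<phi> ` (Rg j \<inter> U)" for i j a x
      using that Rg_mult Rg_sub UD(4) by (auto simp: P(7) subset_iff)
    show "\<exists>!f. (\<forall>d. f d \<in> \<phi> ` (Rg d \<inter> U)) \<and> finite {d. f d \<noteq> \<zero>\<^bsub>M\<^esub>} \<and>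
       x = finsum M f {d. f d \<noteq> \<zero>\<^bsub>M\<^esub>}" if x: "x \<in> carrier M" for x
    proof -
      obtain u where u: "u \<in> U" "x = \<phi> u" using x by (auto simp: P(4))
      have uS: "u \<in> S" using UD(1) u by simp
      have cU: "comp d u \<in> U" for d using U u by (auto simp: homogeneous_ideal_def)
      \<comment> \<open>The support in \<open>M\<close> can be smaller than that of the
        representative, since components may fall into \<open>V\<close>; enlarging a finite index
        set by zero terms does not change the sum.\<close>
      have sum_supp: "finsum M f {d. f d \<noteq> \<zero>\<^bsub>M\<^esub>} = finsum M f A"
        if "finite A" "{d. f d \<noteq> \<zero>\<^bsub>M\<^esub>} \<subseteq> A" "\<And>d. f d \<in> carrier M" for A f
        using that by (intro M.add.finprod_mono_neutral_cong_left) auto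
      show ?thesis
      proof (rule ex1I)
        let ?f = "\<lambda>d. \<phi> (comp d u)"
        have sub: "{d. ?f d \<noteq> \<zero>\<^bsub>M\<^esub>} \<subseteq> {d. comp d u \<noteq> 0}" by (auto simp: P(5))
        have "finsum M ?f {d. ?f d \<noteq> \<zero>\<^bsub>M\<^esub>} = finsum M ?f {d. comp d u \<noteq> 0}"
          using sub comp_finite cU by (intro sum_supp) (auto simp: P(4))
        also have "\<dots> = \<phi> u"
          using presents_finsum[OF pr _ comp_finite, of u "\<lambda>d. comp d u"] cU comp_sum[OF uS] by simp
        finally show "(\<forall>d. ?f d \<in> \<phi> ` (Rg d \<inter> U)) \<and> finite {d. ?f d \<noteq> \<zero>\<^bsub>M\<^esub>} \<and>
          x = finsum M ?f {d. ?f d \<noteq> \<zero>\<^bsub>M\<^esub>}"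
          using comp_in[OF uS] cU u finite_subset[OF sub comp_finite] by simp
      next
        fix f assume f: "(\<forall>d. f d \<in> \<phi> ` (Rg d \<inter> U)) \<and> finite {d. f d \<noteq> \<zero>\<^bsub>M\<^esub>} \<and>
          x = finsum M f {d. f d \<noteq> \<zero>\<^bsub>M\<^esub>}"
        then have "\<forall>d. \<exists>g. g \<in> Rg d \<and> g \<in> U \<and> f d = \<phi> g" by auto
        then obtain g where g: "\<And>d. g d \<in> Rg d" "\<And>d. g d \<in> U" "\<And>d. f d = \<phi> (g d)" by metis
        let ?A = "{d. f d \<noteq> \<zero>\<^bsub>M\<^esub>}"
        have fin: "finite ?A" using f by simp
        have "\<phi> u = \<phi> (sum g ?A)"
        proof -
          have "\<phi> u = finsum M f ?A" using f u by metis
          also have "finsum M f ?A = finsum M (\<lambda>d. \<phi> (g d)) ?A" using g(3) by metis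
          also have "finsum M (\<lambda>d. \<phi> (g d)) ?A = \<phi> (sum g ?A)"
            by (rule presents_finsum[OF pr g(2) fin])
          finally show ?thesis .
        qed
        then have "u - sum g ?A \<in> V"
          using P(8) u ideal_of_sum[OF P(1), of ?A g] g by simp
        then have "comp d (u - sum g ?A) \<in> V" for d using V by (auto simp: homogeneous_ideal_def)
        moreover have "comp d (sum g ?A) = (if d \<in> ?A then g d else 0)" for d
          unfolding comp_of_sum using comp_homogeneous[OF g(1)] fin by (simp add: sum.delta' eq_commute)
        ultimately have "comp d u - (if d \<in> ?A then g d else 0) \<in> V" for d by (simp add: comp_diff)
        then have "\<phi> (comp d u) = \<phi> (if d \<in> ?A then g d else 0)" for d
          using P(8)[of "comp d u" "if d \<in> ?A then g d else 0"] cU g(2) UD(2) by auto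
        then show "f = (\<lambda>d. \<phi> (comp d u))"
          using g(3) P(5) by (intro ext) auto
      qed
    qed
  qed
qed

lemma presents_graded_submodule:
  assumes pr: "presents M U V \<phi>" and U: "homogeneous_ideal U" and V: "homogeneous_ideal V"
    and W: "homogeneous_ideal W" "V \<subseteq> W" "W \<subseteq> U"
  shows "graded_submodule R Rg M (\<lambda>d. \<phi> ` (Rg d \<inter> U)) (\<phi> ` W)"
proof -
  have Wi: "ideal_of W" using W by (simp add: homogeneous_ideal_def)
  have "\<phi> ` (Rg d \<inter> U) \<inter> \<phi> ` W = \<phi> ` (Rg d \<inter> W)" for d
    using presents_mem_image_iff[OF pr Wi W(2,3)] W(3) by blast
  then show ?thesis
    unfolding graded_submodule_def
    using presents_submodule[OF pr Wi W(3)] presents_graded[OF presents_restrict[OF pr Wi W(2,3)] W(1) V]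
    by simp
qed

text \<open>Reduces the claim to ideals of \<open>S\<close>: for each of \<open>U/J\<close> and
  \<open>S/U\<close> it remains to give a regular sequence in the irrelevant ideal and to bound the
  prime chains above the annihilator by its length.\<close>

theorem seq_cohen_macaulay_ideal_two_steps:
  assumes J: "homogeneous_ideal J" and U: "homogeneous_ideal U" and "J \<subset> U" "U \<subset> S"
    and as: "set as \<subseteq> irrelevant_ideal R Rg" "set as \<subseteq> S" "regular_on U J as" "foldl (add_mult U) J as \<noteq> U"
    and asd: "\<And>k P. prime_chain (colon J U) k P \<Longrightarrow> k \<le> length as"
    and bs: "set bs \<subseteq> irrelevant_ideal R Rg" "set bs \<subseteq> S" "regular_on S U bs" "foldl (add_mult S) U bs \<noteq> S"
    and bsd: "\<And>k P. prime_chain (colon U S) k P \<Longrightarrow> k \<le> length bs"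
    and less: "length as < length bs"
  shows "seq_cohen_macaulay_ideal R Rg J"
proof -
  have Ji: "ideal_of J" and Ui: "ideal_of U" using J U by (auto simp: homogeneous_ideal_def)
  have Sh: "homogeneous_ideal S"
    using ideal_of_S comp_in Rg_sub by (auto simp: homogeneous_ideal_def)
  let ?M = "quot_module (ring_module R) J" and ?\<phi> = "\<lambda>u. J +>\<^bsub>R\<^esub> u"
  have "J +>\<^bsub>ring_module R\<^esub> u = J +>\<^bsub>R\<^esub> u" for u
    by (simp add: a_r_coset_def' ring_module_def)
  then have pr: "presents ?M S J ?\<phi>"
    using presents_quot[OF presents_ring_module Ji] ideal_ofD[OF Ji] by (auto simp: image_id subset_iff)
  have Mg: "(\<lambda>d. ?\<phi> ` Rg d) = (\<lambda>d. ?\<phi> ` (Rg d \<inter> S))"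
    using Rg_sub by (simp add: Int_absorb2)
  have gM: "graded_module R Rg ?M (\<lambda>d. ?\<phi> ` (Rg d \<inter> S))"
    by (rule presents_graded[OF pr Sh J])
  have gsub: "graded_submodule R Rg ?M (\<lambda>d. ?\<phi> ` (Rg d \<inter> S)) (?\<phi> ` W)"
    if "homogeneous_ideal W" "J \<subseteq> W" "W \<subseteq> S" for W
    using presents_graded_submodule[OF pr Sh J that] .
  have strict: "?\<phi> ` W \<subset> ?\<phi> ` W'" if W: "ideal_of W" "J \<subseteq> W" "W \<subset> W'" "W' \<subseteq> S" for W W'
  proof -
    obtain w where w: "w \<in> W'" "w \<notin> W" using W(3) by blast
    have "?\<phi> w \<notin> ?\<phi> ` W" using presents_mem_image_iff[OF pr W(1,2), of w] w W by blast
    then show ?thesis using w W by blast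
  qed
  have fg: "fin_gen_module R ?M"
    unfolding fin_gen_module_def
  proof (intro exI[of _ "{?\<phi> 1}"] conjI)
    note P = presentsD[OF pr]
    show "{?\<phi> 1} \<subseteq> carrier ?M" using P(4) by auto
    have "carrier ?M \<subseteq> N" if N: "submodule N R ?M" "{?\<phi> 1} \<subseteq> N" for N
    proof -
      interpret Module.module R ?M using pr by (rule presents_module)
      have "?\<phi> u \<in> N" if "u \<in> S" for u
        using submoduleE(4)[OF N(1), of u "?\<phi> 1"] P(7)[OF that one_in] that N(2) by simp
      then show ?thesis using P(4) by auto
    qed
    moreover have "submodule (carrier ?M) R ?M"
      using presents_module[OF pr] by (rule module.carrier_is_submodule)
    ultimately show "submodule_span R ?M {?\<phi> 1} = carrier ?M"
      unfolding submodule_span_def using P(4) by (intro equalityI) auto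
  qed simp
  define N where "N = (\<lambda>i::nat. if i = 0 then ?\<phi> ` J else if i = 1 then ?\<phi> ` U else ?\<phi> ` S)"
  have N: "N 0 = ?\<phi> ` J" "N (Suc 0) = ?\<phi> ` U" "N (Suc (Suc 0)) = ?\<phi> ` S" by (simp_all add: N_def)
  have sub: "presents (subquot ?M (?\<phi> ` W) (?\<phi> ` W')) W W'
      (\<lambda>u. ?\<phi> ` W' +>\<^bsub>?M\<lparr>carrier := ?\<phi> ` W\<rparr>\<^esub> ?\<phi> u)"
    if "ideal_of W" "ideal_of W'" "J \<subseteq> W'" "W' \<subseteq> W" "W \<subseteq> S" for W W'
    using presents_quot[OF presents_restrict[OF pr that(1)] that(2,3,4)] that by auto
  have JU: "J \<subseteq> U" "U \<subseteq> S" using assms(3,4) by auto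
  note cm1 = presents_cohen_macaulay[OF sub[OF Ui Ji subset_refl JU] as asd]
  note cm2 = presents_cohen_macaulay[OF sub[OF ideal_of_S Ui JU subset_refl] bs bsd]
  have J0: "?\<phi> ` J = {\<zero>\<^bsub>?M\<^esub>}"
    using presents_eq_zero_iff[OF pr] ideal_ofD[OF Ji] by (auto simp: image_iff intro!: bexI[of _ 0])
  show ?thesis
    unfolding seq_cohen_macaulay_ideal_def seq_cohen_macaulay_def Mg
  proof (intro conjI exI[of _ 2] exI[of _ N])
    show "graded_module R Rg ?M (\<lambda>d. ?\<phi> ` (Rg d \<inter> S))" by (rule gM)
    show "fin_gen_module R ?M" by (rule fg)
    show "N 0 = {\<zero>\<^bsub>?M\<^esub>}" using J0 N by simp
    show "N 2 = carrier ?M" using N presentsD(4)[OF pr] by (simp add: numeral_2_eq_2)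
    have "graded_submodule R Rg ?M (\<lambda>d. ?\<phi> ` (Rg d \<inter> S)) (N i)" for i
      unfolding N_def
      using gsub[OF J subset_refl] gsub[OF U JU] gsub[OF Sh _ subset_refl] JU by simp
    then show "\<forall>i\<le>2. graded_submodule R Rg ?M (\<lambda>d. ?\<phi> ` (Rg d \<inter> S)) (N i)" by simp
    have "?\<phi> ` J \<subset> ?\<phi> ` U" "?\<phi> ` U \<subset> ?\<phi> ` S"
      using strict[OF Ji subset_refl assms(3) JU(2)] strict[OF Ui JU(1) assms(4) subset_refl] .
    then show "\<forall>i<2. N i \<subset> N (Suc i)" using N by (auto simp: less_2_cases_iff)
    show "\<forall>i<2. cohen_macaulay R Rg (subquot ?M (N (Suc i)) (N i))"
      using cm1(1) cm2(1) N by (simp add: less_2_cases_iff all_conj_distrib conj_disj_distribR imp_disjL)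
    show "\<forall>i. 0 < i \<and> i < 2 \<longrightarrow> module_dim R (subquot ?M (N i) (N (i - 1)))
        < module_dim R (subquot ?M (N (Suc i)) (N i))"
    proof (intro allI impI)
      fix i :: nat assume "0 < i \<and> i < 2"
      then have "i = Suc 0" by auto
      then show "module_dim R (subquot ?M (N i) (N (i - 1)))
        < module_dim R (subquot ?M (N (Suc i)) (N i))"
        using cm1(2) cm2(2) less N by simp
    qed
  qed
qed

end

section \<open>An upper bound for the dimension\<close>

text \<open>Gaussian elimination with more unknowns than equations: the equation at \<open>z\<close>
  eliminates an unknown \<open>g\<close> with \<open>A g z\<close> nonzero, and a solution of the
  smaller system determines the value at \<open>g\<close>.\<close>

lemma exists_nontrivial_kernel_vector:
  fixes A :: "'g \<Rightarrow> 'z \<Rightarrow> 'k::field"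
  assumes "finite Z" "finite \<Gamma>" "card Z < card \<Gamma>"
  shows "\<exists>c. (\<exists>\<gamma>\<in>\<Gamma>. c \<gamma> \<noteq> 0) \<and> (\<forall>z\<in>Z. (\<Sum>\<gamma>\<in>\<Gamma>. c \<gamma> * A \<gamma> z) = 0)"
  using assms
proof (induction Z arbitrary: \<Gamma> A rule: finite_induct)
  case empty
  then obtain \<gamma> where "\<gamma> \<in> \<Gamma>" by fastforce
  then show ?case by (intro exI[of _ "\<lambda>_. 1"]) auto
next
  case (insert z Z)
  show ?case
  proof (cases "\<forall>\<gamma>\<in>\<Gamma>. A \<gamma> z = 0")
    case True
    obtain c where c: "\<exists>\<gamma>\<in>\<Gamma>. c \<gamma> \<noteq> 0" "\<forall>z\<in>Z. (\<Sum>\<gamma>\<in>\<Gamma>. c \<gamma> * A \<gamma> z) = 0"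
      using insert.IH[of \<Gamma> A] insert.prems insert.hyps by auto
    then show ?thesis using True by (intro exI[of _ c]) auto
  next
    case False
    then obtain g where g: "g \<in> \<Gamma>" "A g z \<noteq> 0" by auto
    let ?\<Gamma> = "\<Gamma> - {g}" and ?A = "\<lambda>\<gamma> y. A \<gamma> y - A \<gamma> z / A g z * A g y"
    have "card Z < card ?\<Gamma>" using insert g by (simp add: card_Diff_singleton)
    then obtain c where c: "\<exists>\<gamma>\<in>?\<Gamma>. c \<gamma> \<noteq> 0" "\<forall>y\<in>Z. (\<Sum>\<gamma>\<in>?\<Gamma>. c \<gamma> * ?A \<gamma> y) = 0"
      using insert.IH[of ?\<Gamma> ?A] insert.prems by auto
    define c' where "c' = c(g := - (\<Sum>\<gamma>\<in>?\<Gamma>. c \<gamma> * A \<gamma> z) / A g z)"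
    have sum: "(\<Sum>\<gamma>\<in>\<Gamma>. c' \<gamma> * A \<gamma> y) = (\<Sum>\<gamma>\<in>?\<Gamma>. c \<gamma> * ?A \<gamma> y)" for y
    proof -
      have "(\<Sum>\<gamma>\<in>\<Gamma>. c' \<gamma> * A \<gamma> y) = c' g * A g y + (\<Sum>\<gamma>\<in>?\<Gamma>. c' \<gamma> * A \<gamma> y)"
        using g insert.prems by (simp add: sum.remove)
      also have "(\<Sum>\<gamma>\<in>?\<Gamma>. c' \<gamma> * A \<gamma> y) = (\<Sum>\<gamma>\<in>?\<Gamma>. c \<gamma> * A \<gamma> y)"
        by (rule sum.cong) (auto simp: c'_def)
      also have "c' g * A g y = - (\<Sum>\<gamma>\<in>?\<Gamma>. c \<gamma> * (A \<gamma> z / A g z * A g y))"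
        by (simp add: c'_def sum_distrib_right sum_distrib_left sum_negf sum_divide_distrib mult.assoc)
      finally show ?thesis by (simp add: right_diff_distrib sum_subtractf)
    qed
    have "(\<Sum>\<gamma>\<in>\<Gamma>. c' \<gamma> * A \<gamma> y) = 0" if "y \<in> insert z Z" for y
      using that sum[of y] c(2) g(2) by auto
    moreover have "\<exists>\<gamma>\<in>\<Gamma>. c' \<gamma> \<noteq> 0" using c(1) by (auto simp: c'_def)
    ultimately show ?thesis by blast
  qed
qed

section \<open>Algebraic independence and growth along prime chains\<close>

locale subalgebra_type = subring_type R S for R :: "'a::comm_ring_1 ring" and S +
  fixes \<iota> :: "'k::field \<Rightarrow> 'a"
  assumes \<iota>_in: "\<iota> k \<in> S"
    and \<iota>_add: "\<iota> (k + l) = \<iota> k + \<iota> l"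
    and \<iota>_mult: "\<iota> (k * l) = \<iota> k * \<iota> l"
    and \<iota>_one: "\<iota> 1 = 1"
begin

lemma \<iota>_zero: "\<iota> 0 = 0"
  using \<iota>_add[of 0 0] by simp

lemma \<iota>_uminus: "\<iota> (- k) = - \<iota> k"
proof -
  have "\<iota> k + \<iota> (- k) = 0" using \<iota>_add[of k "- k"] by (simp add: \<iota>_zero)
  then show ?thesis by (metis add_eq_0_iff)
qed

lemma \<iota>_diff: "\<iota> (k - l) = \<iota> k - \<iota> l"
  using \<iota>_add[of "k - l" l] by simp

abbreviation power_list :: "'a list \<Rightarrow> nat list \<Rightarrow> 'a" where
  "power_list gs \<gamma> \<equiv> prod_list (map2 (^) gs \<gamma>)"

lemma power_list_in: "set gs \<subseteq> S \<Longrightarrow> power_list gs \<gamma> \<in> S"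
proof (induction gs arbitrary: \<gamma>)
  case (Cons g gs)
  then show ?case by (cases \<gamma>) auto
qed auto

text \<open>Along a chain of primes \<open>P\<^sub>0 \<subset> \<dots> \<subset> P\<^sub>d\<close>, elements \<open>g\<^sub>i \<in> P\<^sub>i\<^sub>+\<^sub>1 - P\<^sub>i\<close> are algebraically
  independent modulo \<open>P\<^sub>0\<close>: the lexicographically smallest monomial of a relation can be split off
  one variable at a time, each time passing to the next prime.\<close>

lemma no_relation_along_prime_chain:
  assumes "\<And>i. i \<le> length gs \<Longrightarrow> prime_of (P i)" "\<And>i. i < length gs \<Longrightarrow> P i \<subseteq> P (Suc i)"
    "\<And>i. i < length gs \<Longrightarrow> gs ! i \<in> P (Suc i) \<and> gs ! i \<notin> P i"
    "finite \<Gamma>" "\<Gamma> \<noteq> {}" "\<And>\<gamma>. \<gamma> \<in> \<Gamma> \<Longrightarrow> length \<gamma> = length gs" "\<And>\<gamma>. \<gamma> \<in> \<Gamma> \<Longrightarrow> c \<gamma> \<noteq> 0"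
    "(\<Sum>\<gamma>\<in>\<Gamma>. \<iota> (c \<gamma>) * power_list gs \<gamma>) \<in> P 0"
  shows False
  using assms
proof (induction gs arbitrary: P \<Gamma> c)
  case Nil
  have \<Gamma>: "\<Gamma> = {[]}" using Nil.prems(5,6) by auto
  have P0: "prime_of (P 0)" using Nil.prems(1) by simp
  then have I: "ideal_of (P 0)" by (simp add: prime_of_def)
  have "\<iota> (c []) \<in> P 0" using Nil.prems(8) \<Gamma> by simp
  then have "\<iota> (inverse (c [])) * \<iota> (c []) \<in> P 0" using ideal_ofD(4)[OF I \<iota>_in] by blast
  also have "\<iota> (inverse (c [])) * \<iota> (c []) = 1"
    using Nil.prems(7)[of "[]"] \<Gamma> by (simp add: \<iota>_one flip: \<iota>_mult)
  finally show False using P0 by (simp add: prime_of_def)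
next
  case (Cons g gs)
  have gP: "g \<in> P 1" "g \<notin> P 0" using Cons.prems(3)[of 0] by auto
  have P0: "prime_of (P 0)" and P1: "prime_of (P 1)" using Cons.prems(1)[of 0] Cons.prems(1)[of 1] by auto
  have I1: "ideal_of (P 1)" using P1 by (simp add: prime_of_def)
  have gS: "g \<in> S" using ideal_ofD(1)[OF I1] gP by simp
  have gsS: "set gs \<subseteq> S"
  proof
    fix x assume "x \<in> set gs"
    then obtain i where i: "i < length gs" "x = gs ! i" by (auto simp: in_set_conv_nth)
    then have "x \<in> P (Suc (Suc i))" "prime_of (P (Suc (Suc i)))"
      using Cons.prems(3)[of "Suc i"] Cons.prems(1)[of "Suc (Suc i)"] by auto
    then show "x \<in> S" using ideal_ofD(1) by (auto simp: prime_of_def)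
  qed
  \<comment> \<open>The least exponent of the first variable. The factor \<open>g ^ e\<close>
    cancels modulo \<open>P 0\<close>, and modulo \<open>P 1\<close>, which contains
    \<open>g\<close>, only the terms with exponent exactly \<open>e\<close> survive.\<close>
  define e where "e = Min (hd ` \<Gamma>)"
  have e_le: "e \<le> hd \<gamma>" if "\<gamma> \<in> \<Gamma>" for \<gamma>
    unfolding e_def using Cons.prems(4) that by auto
  have "e \<in> hd ` \<Gamma>" unfolding e_def using Cons.prems(4,5) by (intro Min_in) auto
  define \<Gamma>0 where "\<Gamma>0 = {\<gamma> \<in> \<Gamma>. hd \<gamma> = e}"
  have \<Gamma>0: "\<Gamma>0 \<subseteq> \<Gamma>" "\<Gamma>0 \<noteq> {}" "finite \<Gamma>0"
    using \<open>e \<in> hd ` \<Gamma>\<close> Cons.prems(4) by (auto simp: \<Gamma>0_def)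
  have split: "power_list (g # gs) \<gamma> = g ^ hd \<gamma> * power_list gs (tl \<gamma>)" if "\<gamma> \<in> \<Gamma>" for \<gamma>
    using Cons.prems(6)[OF that] by (cases \<gamma>) auto
  define x where "x = (\<Sum>\<gamma>\<in>\<Gamma>0. \<iota> (c \<gamma>) * power_list gs (tl \<gamma>))"
  \<comment> \<open>The truncated difference is exact, since the exponents of \<open>g\<close>
    outside \<open>\<Gamma>0\<close> exceed \<open>e\<close>.\<close>
  define y where "y = (\<Sum>\<gamma>\<in>\<Gamma> - \<Gamma>0. \<iota> (c \<gamma>) * (g ^ (hd \<gamma> - Suc e) * power_list gs (tl \<gamma>)))"
  have xS: "x \<in> S" and yS: "y \<in> S"
    using \<iota>_in power_list_in[OF gsS] gS by (auto simp: x_def y_def intro!: sum_in)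
  have "(\<Sum>\<gamma>\<in>\<Gamma>. \<iota> (c \<gamma>) * power_list (g # gs) \<gamma>) =
      (\<Sum>\<gamma>\<in>\<Gamma> - \<Gamma>0. \<iota> (c \<gamma>) * power_list (g # gs) \<gamma>) + (\<Sum>\<gamma>\<in>\<Gamma>0. \<iota> (c \<gamma>) * power_list (g # gs) \<gamma>)"
    using \<Gamma>0 Cons.prems(4) by (intro sum.subset_diff) auto
  also have "(\<Sum>\<gamma>\<in>\<Gamma>0. \<iota> (c \<gamma>) * power_list (g # gs) \<gamma>) = g ^ e * x"
    unfolding x_def sum_distrib_left using split by (intro sum.cong) (auto simp: \<Gamma>0_def algebra_simps)
  also have "(\<Sum>\<gamma>\<in>\<Gamma> - \<Gamma>0. \<iota> (c \<gamma>) * power_list (g # gs) \<gamma>) = g ^ e * (g * y)"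
    unfolding y_def sum_distrib_left
  proof (rule sum.cong[OF refl])
    fix \<gamma> assume \<gamma>: "\<gamma> \<in> \<Gamma> - \<Gamma>0"
    then have "hd \<gamma> = e + Suc (hd \<gamma> - Suc e)" using e_le[of \<gamma>] by (auto simp: \<Gamma>0_def)
    then have "g ^ hd \<gamma> = g ^ e * (g * g ^ (hd \<gamma> - Suc e))" by (metis power_Suc power_add)
    then show "\<iota> (c \<gamma>) * power_list (g # gs) \<gamma> =
        g ^ e * (g * (\<iota> (c \<gamma>) * (g ^ (hd \<gamma> - Suc e) * power_list gs (tl \<gamma>))))"
      using split \<gamma> by (simp add: algebra_simps)
  qed
  finally have "g ^ e * (g * y + x) \<in> P 0" using Cons.prems(8) by (simp add: algebra_simps)
  moreover have "g ^ k \<notin> P 0" for k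
  proof (induction k)
    case (Suc k)
    then show ?case using gP gS P0 by (auto simp: prime_of_def)
  qed (use P0 in \<open>auto simp: prime_of_def\<close>)
  ultimately have "g * y + x \<in> P 0"
    using P0 gS xS yS unfolding prime_of_def by (metis add_in mult_in power_in)
  then have "g * y + x \<in> P 1" using Cons.prems(2)[of 0] by auto
  moreover have "g * y \<in> P 1" using ideal_ofD(4)[OF I1 yS gP(1)] by (simp add: mult.commute)
  ultimately have "x \<in> P 1" using ideal_ofD(6)[OF I1, of "g * y + x" "g * y"] by simp
  moreover have "x = (\<Sum>\<gamma>\<in>tl ` \<Gamma>0. \<iota> (c (e # \<gamma>)) * power_list gs \<gamma>)"
  proof -
    have "inj_on tl \<Gamma>0"
    proof (rule inj_onI)
      fix \<gamma> \<gamma>' assume *: "\<gamma> \<in> \<Gamma>0" "\<gamma>' \<in> \<Gamma>0" "tl \<gamma> = tl \<gamma>'"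
      moreover have "\<gamma> \<noteq> []" "\<gamma>' \<noteq> []" using * Cons.prems(6) \<Gamma>0(1) by fastforce+
      ultimately show "\<gamma> = \<gamma>'" by (intro list.expand) (auto simp: \<Gamma>0_def)
    qed
    moreover have "e # tl \<gamma> = \<gamma>" if "\<gamma> \<in> \<Gamma>0" for \<gamma>
      using that Cons.prems(6)[of \<gamma>] \<Gamma>0(1) by (cases \<gamma>) (auto simp: \<Gamma>0_def)
    ultimately show ?thesis by (simp add: x_def sum.reindex)
  qed
  ultimately have rel: "(\<Sum>\<gamma>\<in>tl ` \<Gamma>0. \<iota> (c (e # \<gamma>)) * power_list gs \<gamma>) \<in> P (Suc 0)" by simp
  show False
  proof (rule Cons.IH[of "\<lambda>i. P (Suc i)" "tl ` \<Gamma>0" "\<lambda>\<gamma>. c (e # \<gamma>)"])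
    show "prime_of (P (Suc i))" if "i \<le> length gs" for i
      using that Cons.prems(1)[of "Suc i"] by simp
    show "P (Suc i) \<subseteq> P (Suc (Suc i))" if "i < length gs" for i
      using that Cons.prems(2)[of "Suc i"] by simp
    show "gs ! i \<in> P (Suc (Suc i)) \<and> gs ! i \<notin> P (Suc i)" if "i < length gs" for i
      using that Cons.prems(3)[of "Suc i"] by simp
    show "length \<gamma> = length gs" "c (e # \<gamma>) \<noteq> 0" if \<gamma>: "\<gamma> \<in> tl ` \<Gamma>0" for \<gamma>
    proof -
      obtain \<gamma>' where \<gamma>': "\<gamma>' \<in> \<Gamma>0" "\<gamma> = tl \<gamma>'" using \<gamma> by auto
      then have "\<gamma>' \<in> \<Gamma>" "\<gamma>' = e # \<gamma>"
        using Cons.prems(6)[of \<gamma>'] by (cases \<gamma>'; auto simp: \<Gamma>0_def)+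
      then show "length \<gamma> = length gs" "c (e # \<gamma>) \<noteq> 0"
        using Cons.prems(6,7)[of \<gamma>'] by auto
    qed
  qed (use rel \<Gamma>0 in auto)
qed

text \<open>The elements of degree at most \<open>t\<close> of \<open>U/V\<close> span a space of dimension \<open>O(t\<^sup>d)\<close>, while \<open>d + 1\<close>
  algebraically independent elements would produce more than that many independent monomials.\<close>

lemma prime_chain_le_of_growth:
  fixes cf :: "'a \<Rightarrow> 'i \<Rightarrow> 'k" and F :: "nat \<Rightarrow> 'a set" and L :: "nat \<Rightarrow> 'i set"
  assumes UV: "ideal_of U" "ideal_of V" "V \<subseteq> U"
    and cf_add: "\<And>u v m. u \<in> U \<Longrightarrow> v \<in> U \<Longrightarrow> cf (u + v) m = cf u m + cf v m"
    and cf_scal: "\<And>u k m. u \<in> U \<Longrightarrow> cf (\<iota> k * u) m = k * cf u m"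
    and cf_zero: "\<And>u. u \<in> U \<Longrightarrow> (\<And>m. cf u m = 0) \<Longrightarrow> u \<in> V"
    and cf_deg: "\<And>u t m. u \<in> U \<Longrightarrow> u \<in> F t \<Longrightarrow> cf u m \<noteq> 0 \<Longrightarrow> m \<in> L t"
    and L: "\<And>t. finite (L t)" "\<And>t. card (L t) \<le> C * Suc t ^ d"
    and F: "1 \<in> F 0" "\<And>s t a b. a \<in> F s \<Longrightarrow> b \<in> F t \<Longrightarrow> a * b \<in> F (s + t)"
      "\<And>s t a. a \<in> F s \<Longrightarrow> s \<le> t \<Longrightarrow> a \<in> F t" "\<And>a. a \<in> S \<Longrightarrow> \<exists>t. a \<in> F t"
    and G: "finite G" "G \<subseteq> U" "\<And>s. s \<in> S \<Longrightarrow> (\<And>g. g \<in> G \<Longrightarrow> s * g \<in> V) \<Longrightarrow> s \<in> colon V U"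
    and chain: "prime_chain (colon V U) k P"
  shows "k \<le> d"
proof (rule ccontr)
  assume "\<not> k \<le> d"
  then have k: "Suc d \<le> k" by simp
  have prm: "prime_of (P i)" if "i \<le> Suc d" for i using chain k that by (simp add: prime_chain_def)
  have less: "P i \<subset> P (Suc i)" if "i < Suc d" for i using chain k that by (simp add: prime_chain_def)
  have "\<forall>i. \<exists>x. i < Suc d \<longrightarrow> x \<in> P (Suc i) \<and> x \<notin> P i" using less by blast
  then obtain g where g: "\<And>i. i < Suc d \<Longrightarrow> g i \<in> P (Suc i) \<and> g i \<notin> P i" by metis
  define gs where "gs = map g [0..<Suc d]"
  have "g i \<in> S" if "i < Suc d" for i
    using g[OF that] prm[of "Suc i"] that ideal_ofD(1)[of "P (Suc i)"] by (simp add: prime_of_def)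
  then have gsS: "set gs \<subseteq> S" by (auto simp: gs_def)
  have bound: "\<exists>D. \<forall>a\<in>A. a \<in> F D" if "finite A" "A \<subseteq> S" for A
    using that
  proof (induction A)
    case (insert x A)
    then obtain D t where "\<forall>a\<in>A. a \<in> F D" "x \<in> F t" using F(4)[of x] by auto
    then show ?case using F(3) by (intro exI[of _ "max D t"]) auto
  qed auto
  obtain D where D: "\<And>a. a \<in> set gs \<Longrightarrow> a \<in> F D" using bound[of "set gs"] gsS by auto
  have GS: "G \<subseteq> S" using G(2) ideal_ofD(1)[OF UV(1)] by auto
  obtain \<delta> where \<delta>: "\<And>a. a \<in> G \<Longrightarrow> a \<in> F \<delta>" using bound[OF G(1) GS] by auto
  have pow: "a ^ j \<in> F (D * j)" if "a \<in> F D" for a j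
    using that F(1,2) by (induction j) (auto simp: algebra_simps)
  have mon: "power_list xs \<gamma> \<in> F (length xs * (D * s))"
    if "\<And>a. a \<in> set xs \<Longrightarrow> a \<in> F D" "set \<gamma> \<subseteq> {..s}" for xs \<gamma> s
    using that
  proof (induction xs arbitrary: \<gamma>)
    case (Cons x xs)
    show ?case
    proof (cases \<gamma>)
      case Nil then show ?thesis using F(1) F(3)[OF F(1)] by simp
    next
      case (Cons e \<gamma>')
      have "x ^ e \<in> F (D * s)" using pow[of x e] F(3)[of "x ^ e" "D * e" "D * s"] Cons.prems Cons by auto
      moreover have "power_list xs \<gamma>' \<in> F (length xs * (D * s))" using Cons.IH Cons.prems Cons by auto
      ultimately show ?thesis using F(2) Cons by fastforce
    qed
  qed (use F(1) in auto)
  \<comment> \<open>\<open>T\<close> bounds the degrees of all products considered. \<open>K\<close>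
    is chosen so that \<open>Suc T \<le> K * Suc s\<close>, and \<open>s\<close> so that the bound
    \<open>card G * C * (K * Suc s) ^ d\<close> for the number of equations becomes
    \<open>s * Suc s ^ d\<close>, which is below the number \<open>Suc s ^ Suc d\<close> of exponent
    vectors.\<close>
  define K where "K = Suc d * D + \<delta> + 1"
  define s where "s = card G * C * K ^ d"
  define T where "T = Suc d * (D * s) + \<delta>"
  define \<Gamma> where "\<Gamma> = {\<gamma>. set \<gamma> \<subseteq> {..s} \<and> length \<gamma> = Suc d}"
  have fin\<Gamma>: "finite \<Gamma>" and card\<Gamma>: "card \<Gamma> = Suc s ^ Suc d"
    using finite_lists_length_eq[of "{..s}" "Suc d"] card_lists_length_eq[of "{..s}" "Suc d"]
    by (simp_all add: \<Gamma>_def)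
  have "Suc T \<le> K * Suc s"
    by (simp add: T_def K_def algebra_simps)
  then have "C * Suc T ^ d \<le> C * (K * Suc s) ^ d" by (intro mult_left_mono power_mono) auto
  with L(2)[of T] have "card (L T) \<le> C * (K * Suc s) ^ d" by (rule le_trans)
  then have "card (G \<times> L T) \<le> card G * (C * (K * Suc s) ^ d)"
    by (simp add: card_cartesian_product)
  also have "\<dots> = (card G * C * K ^ d) * Suc s ^ d" by (simp only: power_mult_distrib mult.assoc)
  also have "\<dots> = s * Suc s ^ d" by (simp only: s_def)
  also have "\<dots> < Suc s ^ Suc d" by simp
  finally have "card (G \<times> L T) < card \<Gamma>" using card\<Gamma> by simp
  \<comment> \<open>This combination of power products has zero coordinates after multiplication
    with each member of \<open>G\<close>, so it annihilates \<open>U/V\<close> and lies in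
    \<open>P 0\<close>.\<close>
  then obtain c where c: "\<exists>\<gamma>\<in>\<Gamma>. c \<gamma> \<noteq> 0"
    "\<forall>z\<in>G \<times> L T. (\<Sum>\<gamma>\<in>\<Gamma>. c \<gamma> * cf (power_list gs \<gamma> * fst z) (snd z)) = 0"
    using exists_nontrivial_kernel_vector[of "G \<times> L T" \<Gamma> "\<lambda>\<gamma> z. cf (power_list gs \<gamma> * fst z) (snd z)"]
      G(1) L(1) fin\<Gamma> by auto
  define x where "x = (\<Sum>\<gamma>\<in>\<Gamma>. \<iota> (c \<gamma>) * power_list gs \<gamma>)"
  have xS: "x \<in> S" unfolding x_def using \<iota>_in power_list_in[OF gsS] by (intro sum_in) auto
  have cf0: "cf 0 m = 0" for m using cf_scal[of 0 0 m] ideal_ofD(2)[OF UV(1)] by simp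
  have cf_sum: "cf (\<Sum>\<gamma>\<in>A. f \<gamma>) m = (\<Sum>\<gamma>\<in>A. cf (f \<gamma>) m)" if "\<And>\<gamma>. \<gamma> \<in> A \<Longrightarrow> f \<gamma> \<in> U"
    for A m and f :: "nat list \<Rightarrow> 'a"
    using that
  proof (induction A rule: infinite_finite_induct)
    case (insert a A)
    then show ?case using cf_add[of "f a" "sum f A" m] ideal_of_sum[OF UV(1), of A f] by simp
  qed (auto simp: cf0)
  have "x * g \<in> V" if g: "g \<in> G" for g
  proof (rule cf_zero)
    have gU: "g \<in> U" using g G(2) by auto
    then show "x * g \<in> U" using ideal_ofD(4)[OF UV(1) xS] by simp
    fix m
    have in_U: "power_list gs \<gamma> * g \<in> U" for \<gamma> using ideal_ofD(4)[OF UV(1) power_list_in[OF gsS] gU] .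
    have "cf (x * g) m = (\<Sum>\<gamma>\<in>\<Gamma>. cf (\<iota> (c \<gamma>) * (power_list gs \<gamma> * g)) m)"
      unfolding x_def sum_distrib_right mult.assoc
      by (rule cf_sum) (rule ideal_ofD(4)[OF UV(1) \<iota>_in in_U])
    also have "\<dots> = (\<Sum>\<gamma>\<in>\<Gamma>. c \<gamma> * cf (power_list gs \<gamma> * g) m)"
      by (simp add: cf_scal in_U)
    also have "\<dots> = 0"
    proof (cases "m \<in> L T")
      case True
      then show ?thesis using c(2) g by auto
    next
      case False
      have "power_list gs \<gamma> * g \<in> F T" if "\<gamma> \<in> \<Gamma>" for \<gamma>
        using F(2)[OF mon[of gs \<gamma> s] \<delta>[OF g]] D that by (simp add: T_def \<Gamma>_def gs_def)
      then show ?thesis using cf_deg[OF in_U] False by (intro sum.neutral) fastforce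
    qed
    finally show "cf (x * g) m = 0" .
  qed
  then have "x \<in> colon V U" using G(3) xS by blast
  then have xP: "x \<in> P 0" using chain by (auto simp: prime_chain_def)
  define \<Gamma>' where "\<Gamma>' = {\<gamma> \<in> \<Gamma>. c \<gamma> \<noteq> 0}"
  have "x = (\<Sum>\<gamma>\<in>\<Gamma>'. \<iota> (c \<gamma>) * power_list gs \<gamma>)"
    unfolding x_def \<Gamma>'_def using fin\<Gamma> by (intro sum.mono_neutral_right) (auto simp: \<iota>_zero)
  then have rel: "(\<Sum>\<gamma>\<in>\<Gamma>'. \<iota> (c \<gamma>) * power_list gs \<gamma>) \<in> P 0" using xP by simp
  show False
  proof (rule no_relation_along_prime_chain[of gs P \<Gamma>' c])
    show "prime_of (P i)" if "i \<le> length gs" for i using that prm by (simp add: gs_def)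
    show "P i \<subseteq> P (Suc i)" if "i < length gs" for i using that less by (auto simp: gs_def)
    show "gs ! i \<in> P (Suc i) \<and> gs ! i \<notin> P i" if "i < length gs" for i
      using that g by (simp add: gs_def del: upt_Suc)
    show "finite \<Gamma>'" "\<Gamma>' \<noteq> {}" using fin\<Gamma> c(1) by (auto simp: \<Gamma>'_def)
    show "length \<gamma> = length gs" if "\<gamma> \<in> \<Gamma>'" for \<gamma> using that by (simp add: \<Gamma>'_def \<Gamma>_def gs_def)
    show "c \<gamma> \<noteq> 0" if "\<gamma> \<in> \<Gamma>'" for \<gamma> using that by (simp add: \<Gamma>'_def)
  qed (rule rel)
qed

end

section \<open>Regular sequences from triangular bases\<close>

text \<open>The quotient \<open>U/V\<close> has the basis \<open>h\<^sub>m\<close>, \<open>m \<in> L\<close>, with coordinates \<open>cf\<close>.  Multiplication by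
  \<open>\<theta>\<^sub>q\<close> maps \<open>h\<^sub>m\<close> to \<open>h\<^bsub>sh q m\<^esub>\<close> plus terms of lower rank.  The index set is a disjoint union of
  copies of \<open>\<nat>\<^sup>d\<close>, on which \<open>sh\<close> acts by unit shifts: \<open>\<beta>\<close> gives the coordinates and \<open>base\<close> the
  origin.  Hence \<open>U/V\<close> is free over the polynomial ring in the \<open>\<theta>\<^sub>q\<close>.\<close>

locale triangular_basis = subalgebra_type R S \<iota>
  for R :: "'a::comm_ring_1 ring" and S and \<iota> :: "'k::field \<Rightarrow> 'a" +
  fixes U V :: "'a set" and L :: "'i set" and cf :: "'a \<Rightarrow> 'i \<Rightarrow> 'k" and h :: "'i \<Rightarrow> 'a"
    and d :: nat and \<theta> :: "nat \<Rightarrow> 'a" and sh :: "nat \<Rightarrow> 'i \<Rightarrow> 'i" and \<beta> :: "nat \<Rightarrow> 'i \<Rightarrow> nat"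
    and base :: "'i \<Rightarrow> 'i" and \<rho> :: "'i \<Rightarrow> 'o::wellorder"
  assumes U: "ideal_of U" and V: "ideal_of V" and VU: "V \<subseteq> U"
    and cf_add: "u \<in> U \<Longrightarrow> v \<in> U \<Longrightarrow> cf (u + v) m = cf u m + cf v m"
    and cf_scal: "u \<in> U \<Longrightarrow> cf (\<iota> k * u) m = k * cf u m"
    and cf_finite: "u \<in> U \<Longrightarrow> finite {m. cf u m \<noteq> 0}"
    and cf_supp: "u \<in> U \<Longrightarrow> cf u m \<noteq> 0 \<Longrightarrow> m \<in> L"
    and cf_zero_iff: "u \<in> U \<Longrightarrow> u \<in> V \<longleftrightarrow> (\<forall>m. cf u m = 0)"
    and h_in: "m \<in> L \<Longrightarrow> h m \<in> U"
    and cf_h: "m \<in> L \<Longrightarrow> cf (h m) m' = (if m' = m then 1 else 0)"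
    and \<theta>_in: "q < d \<Longrightarrow> \<theta> q \<in> S"
    and sh_in: "m \<in> L \<Longrightarrow> q < d \<Longrightarrow> sh q m \<in> L"
    and sh_inj: "m \<in> L \<Longrightarrow> m' \<in> L \<Longrightarrow> q < d \<Longrightarrow> sh q m = sh q m' \<Longrightarrow> m = m'"
    and cf_\<theta>_sh: "m \<in> L \<Longrightarrow> q < d \<Longrightarrow> cf (\<theta> q * h m) (sh q m) = 1"
    and cf_\<theta>_lower: "m \<in> L \<Longrightarrow> q < d \<Longrightarrow> m' \<noteq> sh q m \<Longrightarrow> cf (\<theta> q * h m) m' \<noteq> 0 \<Longrightarrow> \<rho> m' < \<rho> (sh q m)"
    and \<rho>_sh: "m \<in> L \<Longrightarrow> m' \<in> L \<Longrightarrow> q < d \<Longrightarrow> \<rho> m < \<rho> m' \<Longrightarrow> \<rho> (sh q m) < \<rho> (sh q m')"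
    and \<beta>_sh: "m \<in> L \<Longrightarrow> p < d \<Longrightarrow> q < d \<Longrightarrow> \<beta> p (sh q m) = \<beta> p m + (if p = q then 1 else 0)"
    and \<beta>_pos: "m \<in> L \<Longrightarrow> q < d \<Longrightarrow> \<beta> q m > 0 \<Longrightarrow> \<exists>m'\<in>L. m = sh q m'"
    and base_in: "m \<in> L \<Longrightarrow> base m \<in> L"
    and base_sh: "m \<in> L \<Longrightarrow> q < d \<Longrightarrow> base (sh q m) = base m"
    and base_id: "m \<in> L \<Longrightarrow> (\<And>q. q < d \<Longrightarrow> \<beta> q m = 0) \<Longrightarrow> base m = m"
    and \<beta>_base: "m \<in> L \<Longrightarrow> q < d \<Longrightarrow> \<beta> q (base m) = 0"
begin

lemmas UD = ideal_ofD[OF U] and VD = ideal_ofD[OF V]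

lemma \<theta>_mult_in: "q < d \<Longrightarrow> u \<in> U \<Longrightarrow> \<theta> q * u \<in> U"
  using UD(4) \<theta>_in by blast

lemma scal_in: "u \<in> U \<Longrightarrow> \<iota> k * u \<in> U"
  using UD(4) \<iota>_in by blast

lemma cf_sum:
  assumes "\<And>i. i \<in> A \<Longrightarrow> f i \<in> U"
  shows "cf (sum f A) m = (\<Sum>i\<in>A. cf (f i) m)"
  using assms
proof (induction A rule: infinite_finite_induct)
  case (insert a A)
  then show ?case using cf_add[of "f a" "sum f A" m] ideal_of_sum[OF U, of A f] by simp
qed (use cf_scal[of 0 0 m] UD(2) in auto)

lemma cf_diff: "u \<in> U \<Longrightarrow> v \<in> U \<Longrightarrow> cf (u - v) m = cf u m - cf v m"
  using cf_add[of "u - v" v m] UD(6)[of u v] by simp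

lemma expand:
  assumes "u \<in> U"
  shows "u - (\<Sum>m\<in>{m. cf u m \<noteq> 0}. \<iota> (cf u m) * h m) \<in> V"
proof -
  let ?A = "{m. cf u m \<noteq> 0}" and ?f = "\<lambda>m. \<iota> (cf u m) * h m"
  have fin: "finite ?A" using cf_finite[OF assms] .
  have fU: "?f m \<in> U" if "m \<in> ?A" for m using that scal_in h_in cf_supp[OF assms] by auto
  have sU: "sum ?f ?A \<in> U" by (rule ideal_of_sum[OF U fU])
  have "cf (sum ?f ?A) n = cf u n" for n
  proof -
    have "cf (sum ?f ?A) n = (\<Sum>m\<in>?A. cf (?f m) n)" by (rule cf_sum) (rule fU)
    also have "\<dots> = (\<Sum>m\<in>?A. if n = m then cf u m else 0)"
      using cf_supp[OF assms] h_in by (intro sum.cong) (auto simp: cf_scal cf_h)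
    also have "\<dots> = cf u n" using fin by (simp add: sum.delta')
    finally show ?thesis .
  qed
  then show ?thesis
    using cf_zero_iff[of "u - sum ?f ?A"] UD(6)[OF assms sU] cf_diff[OF assms sU] by simp
qed

text \<open>The difference between \<open>u\<close> and its expansion lies in the ideal
  \<open>V\<close>, so multiplication by \<open>\<theta> q\<close> can be computed on the
  basis.\<close>

lemma cf_\<theta>_mult:
  assumes "u \<in> U" "q < d"
  shows "cf (\<theta> q * u) n = (\<Sum>m\<in>{m. cf u m \<noteq> 0}. cf u m * cf (\<theta> q * h m) n)"
proof -
  let ?A = "{m. cf u m \<noteq> 0}" and ?f = "\<lambda>m. \<iota> (cf u m) * h m"
  have fU: "?f m \<in> U" if "m \<in> ?A" for m using that scal_in h_in cf_supp[OF assms(1)] by auto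
  have sU: "sum ?f ?A \<in> U" by (rule ideal_of_sum[OF U fU])
  have "\<theta> q * (u - sum ?f ?A) \<in> V" using VD(4)[OF \<theta>_in expand] assms by blast
  then have "cf (\<theta> q * (u - sum ?f ?A)) n = 0"
    using cf_zero_iff VU by blast
  then have "cf (\<theta> q * u) n = cf (\<theta> q * sum ?f ?A) n"
    using cf_diff[OF \<theta>_mult_in[OF assms(2,1)] \<theta>_mult_in[OF assms(2) sU], of n]
    by (simp add: right_diff_distrib)
  also have "\<theta> q * sum ?f ?A = (\<Sum>m\<in>?A. \<iota> (cf u m) * (\<theta> q * h m))"
    by (simp add: sum_distrib_left algebra_simps)
  also have "cf \<dots> n = (\<Sum>m\<in>?A. cf (\<iota> (cf u m) * (\<theta> q * h m)) n)"
    using cf_supp[OF assms(1)] assms(2) h_in \<theta>_mult_in scal_in by (intro cf_sum) auto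
  also have "\<dots> = (\<Sum>m\<in>?A. cf u m * cf (\<theta> q * h m) n)"
    using cf_supp[OF assms(1)] assms(2) h_in \<theta>_mult_in by (intro sum.cong) (auto simp: cf_scal)
  finally show ?thesis .
qed

text \<open>The origin of the copy containing \<open>m\<close>, multiplied by the actual powers of
  the forms. On these elements \<open>\<theta> q\<close> acts exactly as \<open>sh q\<close>,
  without lower terms.\<close>

definition E :: "'i \<Rightarrow> 'a" where
  "E m = (\<Prod>q<d. \<theta> q ^ \<beta> q m) * h (base m)"

lemma E_in: "m \<in> L \<Longrightarrow> E m \<in> U"
  unfolding E_def by (rule UD(4)[OF prod_in]) (auto intro: \<theta>_in h_in base_in)

lemma E_sh:
  assumes "m \<in> L" "q < d"
  shows "E (sh q m) = \<theta> q * E m"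
proof -
  have "(\<Prod>p<d. \<theta> p ^ \<beta> p (sh q m)) = (\<Prod>p<d. (if p = q then \<theta> q else 1) * \<theta> p ^ \<beta> p m)"
    using assms by (intro prod.cong) (auto simp: \<beta>_sh)
  also have "\<dots> = \<theta> q * (\<Prod>p<d. \<theta> p ^ \<beta> p m)"
    using assms by (simp add: prod.distrib prod.delta')
  finally show ?thesis using assms by (simp add: E_def base_sh mult.assoc)
qed

text \<open>Unitriangularity with respect to \<open>h\<close>, one factor at a time:
  \<open>\<theta> q\<close> moves the leading index by \<open>sh q\<close>, and lower terms stay
  lower because \<open>sh q\<close> is monotone for \<open>\<rho>\<close>.\<close>

lemma E_lead:
  assumes "m \<in> L"
  shows "cf (E m) m = 1 \<and> (\<forall>m'. m' \<noteq> m \<longrightarrow> cf (E m) m' \<noteq> 0 \<longrightarrow> \<rho> m' < \<rho> m)"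
  using assms
proof (induction "\<Sum>q<d. \<beta> q m" arbitrary: m rule: less_induct)
  case less
  show ?case
  proof (cases "\<forall>q<d. \<beta> q m = 0")
    case True
    then have "base m = m" "E m = h m" using base_id less.prems by (auto simp: E_def)
    then show ?thesis using less.prems by (auto simp: cf_h)
  next
    case False
    then obtain q where q: "q < d" "\<beta> q m > 0" by auto
    then obtain m' where m': "m' \<in> L" "m = sh q m'" using \<beta>_pos less.prems by blast
    have "(\<Sum>p<d. \<beta> p m) = (\<Sum>p<d. \<beta> p m' + (if p = q then 1 else 0))"
      using m' q by (intro sum.cong) (auto simp: \<beta>_sh)
    also have "\<dots> = (\<Sum>p<d. \<beta> p m') + 1" using q by (simp add: sum.distrib)
    finally have IH: "cf (E m') m' = 1" "\<And>n. n \<noteq> m' \<Longrightarrow> cf (E m') n \<noteq> 0 \<Longrightarrow> \<rho> n < \<rho> m'"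
      using less.hyps[of m'] m' by auto
    let ?A = "{n. cf (E m') n \<noteq> 0}"
    have fin: "finite ?A" using cf_finite E_in m' by blast
    have AL: "n \<in> L" if "n \<in> ?A" for n using that cf_supp[OF E_in[OF m'(1)]] by blast
    have eq: "cf (E m) n = cf (\<theta> q * h m') n + (\<Sum>k\<in>?A - {m'}. cf (E m') k * cf (\<theta> q * h k) n)" for n
      using cf_\<theta>_mult[OF E_in[OF m'(1)] q(1), of n] IH(1) fin m' q
      by (simp add: E_sh sum.remove[of ?A m'])
    have low: "\<rho> n < \<rho> m" if "k \<in> ?A - {m'}" "cf (\<theta> q * h k) n \<noteq> 0" for k n
    proof -
      have "k \<in> L" "\<rho> k < \<rho> m'" using that AL IH(2) by auto
      then have "\<rho> (sh q k) < \<rho> m" using \<rho>_sh m' q by blast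
      moreover have "\<rho> n \<le> \<rho> (sh q k)"
        using cf_\<theta>_lower[OF \<open>k \<in> L\<close> q(1), of n] that by (cases "n = sh q k") auto
      ultimately show ?thesis by simp
    qed
    have "(\<Sum>k\<in>?A - {m'}. cf (E m') k * cf (\<theta> q * h k) m) = 0"
      using low[of _ m] by (intro sum.neutral) auto
    then have "cf (E m) m = 1" using eq[of m] cf_\<theta>_sh m' q by simp
    moreover have "\<rho> n < \<rho> m" if "n \<noteq> m" "cf (E m) n \<noteq> 0" for n
    proof (cases "cf (\<theta> q * h m') n = 0")
      case True
      then have "(\<Sum>k\<in>?A - {m'}. cf (E m') k * cf (\<theta> q * h k) n) \<noteq> 0" using eq[of n] that by simp
      then obtain k where "k \<in> ?A - {m'}" "cf (E m') k * cf (\<theta> q * h k) n \<noteq> 0"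
        by (meson sum.neutral)
      then show ?thesis using low[of k n] by auto
    next
      case False
      then show ?thesis using cf_\<theta>_lower[OF m'(1) q(1), of n] that m' by auto
    qed
    ultimately show ?thesis by auto
  qed
qed

text \<open>Coefficients are taken from the field only, and everything is modulo \<open>V\<close>;
  the action of the forms is already built into the index set.\<close>

definition span_E :: "'i set \<Rightarrow> 'a set" where
  "span_E A = {(\<Sum>m\<in>F. \<iota> (a m) * E m) + v | F a v. finite F \<and> F \<subseteq> A \<and> v \<in> V}"

lemma span_E_I: "finite F \<Longrightarrow> F \<subseteq> A \<Longrightarrow> v \<in> V \<Longrightarrow> (\<Sum>m\<in>F. \<iota> (a m) * E m) + v \<in> span_E A"
  unfolding span_E_def by blast

lemma span_E_V: "v \<in> V \<Longrightarrow> v \<in> span_E A"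
  using span_E_I[of "{}" A v] by simp

lemma span_E_E: "m \<in> A \<Longrightarrow> E m \<in> span_E A"
  using span_E_I[of "{m}" A 0 "\<lambda>_. 1"] VD(2) by (simp add: \<iota>_one)

lemma span_E_add:
  assumes "x \<in> span_E A" "y \<in> span_E A"
  shows "x + y \<in> span_E A"
proof -
  obtain F a v where x: "finite F" "F \<subseteq> A" "v \<in> V" "x = (\<Sum>m\<in>F. \<iota> (a m) * E m) + v"
    using assms(1) unfolding span_E_def by blast
  obtain G b w where y: "finite G" "G \<subseteq> A" "w \<in> V" "y = (\<Sum>m\<in>G. \<iota> (b m) * E m) + w"
    using assms(2) unfolding span_E_def by blast
  let ?c = "\<lambda>m. (if m \<in> F then a m else 0) + (if m \<in> G then b m else 0)"
  have "(\<Sum>m\<in>F. \<iota> (a m) * E m) = (\<Sum>m\<in>F \<union> G. \<iota> (if m \<in> F then a m else 0) * E m)"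
    using x y by (intro sum.mono_neutral_cong_left) (auto simp: \<iota>_zero)
  moreover have "(\<Sum>m\<in>G. \<iota> (b m) * E m) = (\<Sum>m\<in>F \<union> G. \<iota> (if m \<in> G then b m else 0) * E m)"
    using x y by (intro sum.mono_neutral_cong_left) (auto simp: \<iota>_zero)
  ultimately have eq: "x + y = (\<Sum>m\<in>F \<union> G. \<iota> (?c m) * E m) + (v + w)"
    by (simp add: x y \<iota>_add distrib_right sum.distrib)
  show ?thesis unfolding eq using x y VD(3) by (intro span_E_I) auto
qed

lemma span_E_scal:
  assumes "x \<in> span_E A"
  shows "\<iota> k * x \<in> span_E A"
proof -
  obtain F a v where x: "finite F" "F \<subseteq> A" "v \<in> V" "x = (\<Sum>m\<in>F. \<iota> (a m) * E m) + v"
    using assms(1) unfolding span_E_def by blast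
  have "\<iota> k * x = (\<Sum>m\<in>F. \<iota> (k * a m) * E m) + \<iota> k * v"
    by (simp add: x distrib_left sum_distrib_left \<iota>_mult mult.assoc)
  then show ?thesis using span_E_I[of F A "\<iota> k * v" "\<lambda>m. k * a m"] x VD(4)[OF \<iota>_in] by simp
qed

lemma span_E_sum: "(\<And>i. i \<in> B \<Longrightarrow> f i \<in> span_E A) \<Longrightarrow> sum f B \<in> span_E A"
  by (induction B rule: infinite_finite_induct) (auto intro: span_E_add span_E_V VD(2))

lemma span_E_least:
  assumes "ideal_of W" "V \<subseteq> W" "\<And>m. m \<in> A \<Longrightarrow> E m \<in> W"
  shows "span_E A \<subseteq> W"
proof
  fix x assume "x \<in> span_E A"
  then obtain F a v where x: "finite F" "F \<subseteq> A" "v \<in> V" "x = (\<Sum>m\<in>F. \<iota> (a m) * E m) + v"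
    unfolding span_E_def by blast
  have "(\<Sum>m\<in>F. \<iota> (a m) * E m) \<in> W"
    using x assms ideal_ofD(4)[OF assms(1) \<iota>_in] by (intro ideal_of_sum[OF assms(1)]) auto
  then show "x \<in> W" using x assms ideal_ofD(3)[OF assms(1)] by blast
qed

text \<open>Inverts the unitriangular change of basis by induction on the well-ordered rank.\<close>

lemma h_in_span: "m \<in> L \<Longrightarrow> h m \<in> span_E L"
proof (induction "\<rho> m" arbitrary: m rule: less_induct)
  case less
  note lead = E_lead[OF less.prems]
  define u where "u = h m - E m"
  have u: "u \<in> U" unfolding u_def using UD(6) h_in E_in less.prems by blast
  have cfu: "cf u n = (if n = m then 1 else 0) - cf (E m) n" for n
    unfolding u_def using cf_diff h_in E_in less.prems by (simp add: cf_h)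
  have "\<iota> (cf u n) * h n \<in> span_E L" if "cf u n \<noteq> 0" for n
  proof -
    have "n \<noteq> m" using cfu[of m] lead that by auto
    then have "\<rho> n < \<rho> m" using lead that cfu[of n] by auto
    then show ?thesis using less.hyps cf_supp[OF u that] span_E_scal by blast
  qed
  then have "(\<Sum>n\<in>{n. cf u n \<noteq> 0}. \<iota> (cf u n) * h n) \<in> span_E L" by (intro span_E_sum) auto
  then have "u \<in> span_E L" using span_E_add[OF span_E_V[OF expand[OF u]]] by fastforce
  then have "E m + u \<in> span_E L" using span_E_add span_E_E less.prems by blast
  then show ?case by (simp add: u_def)
qed

lemma span_E_L: "span_E L = U"
proof
  show "span_E L \<subseteq> U" using span_E_least[OF U VU] E_in by blast
  show "U \<subseteq> span_E L"
  proof
    fix u assume u: "u \<in> U"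
    have "(\<Sum>n\<in>{n. cf u n \<noteq> 0}. \<iota> (cf u n) * h n) \<in> span_E L"
      using cf_supp[OF u] h_in_span span_E_scal by (intro span_E_sum) auto
    then show "u \<in> span_E L" using span_E_add[OF span_E_V[OF expand[OF u]]] by fastforce
  qed
qed

text \<open>Among the indices with nonzero coefficient take \<open>n\<close> of largest rank: no
  other \<open>E k\<close> with nonzero coefficient has a coordinate at \<open>n\<close>, even if
  ranks tie.\<close>

lemma E_independent:
  assumes "finite F" "F \<subseteq> L" "(\<Sum>m\<in>F. \<iota> (a m) * E m) \<in> V" "m \<in> F"
  shows "a m = 0"
proof (rule ccontr)
  assume "a m \<noteq> 0"
  let ?B = "{m \<in> F. a m \<noteq> 0}"
  have B: "finite (\<rho> ` ?B)" "\<rho> ` ?B \<noteq> {}" using assms \<open>a m \<noteq> 0\<close> by auto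
  obtain n where n: "n \<in> ?B" "\<rho> n = Max (\<rho> ` ?B)" using Max_in[OF B] by (metis (no_types, lifting) imageE)
  have max: "\<rho> k \<le> \<rho> n" if "k \<in> ?B" for k using n(2) B(1) that by simp
  have inU: "\<iota> (a k) * E k \<in> U" if "k \<in> F" for k using that assms(2) E_in scal_in by blast
  have "0 = cf (\<Sum>m\<in>F. \<iota> (a m) * E m) n" using cf_zero_iff assms(3) VU by (metis subsetD)
  also have "\<dots> = (\<Sum>m\<in>F. cf (\<iota> (a m) * E m) n)" by (rule cf_sum) (rule inU)
  also have "\<dots> = (\<Sum>m\<in>F. a m * cf (E m) n)"
    using assms(2) E_in by (intro sum.cong) (auto simp: cf_scal)
  also have "\<dots> = (\<Sum>m\<in>F. if m = n then a n else 0)"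
  proof (rule sum.cong[OF refl])
    fix k assume k: "k \<in> F"
    then have kL: "k \<in> L" using assms(2) by auto
    show "a k * cf (E k) n = (if k = n then a n else 0)"
    proof (cases "k = n \<or> a k = 0")
      case True then show ?thesis using E_lead[OF kL] by auto
    next
      case False
      then have "\<not> \<rho> n < \<rho> k" using max[of k] k by auto
      then show ?thesis using E_lead[OF kL] False by auto
    qed
  qed
  also have "\<dots> = a n" using n assms(1) by simp
  finally show False using n by simp
qed

lemma \<theta>_sum:
  assumes "F \<subseteq> L" "q < d"
  shows "\<theta> q * (\<Sum>m\<in>F. \<iota> (a m) * E m) = (\<Sum>m\<in>F. \<iota> (a m) * E (sh q m))"
  unfolding sum_distrib_left using assms
  by (intro sum.cong) (auto simp: E_sh mult.left_commute)

abbreviation divisible :: "nat \<Rightarrow> 'i set" where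
  "divisible q \<equiv> {m \<in> L. \<exists>p<q. \<beta> p m > 0}"

text \<open>As \<open>\<theta> q\<close> maps \<open>E m\<close> to \<open>E (sh q m)\<close> and
  the image of \<open>sh q\<close> consists of the indices with positive \<open>\<beta> q\<close>,
  the first \<open>q\<close> forms generate the analogue of a monomial ideal.\<close>

lemma foldl_\<theta>:
  assumes "q \<le> d"
  shows "foldl (add_mult U) V (map \<theta> [0..<q]) = span_E (divisible q)"
  using assms
proof (induction q)
  case 0
  show ?case using span_E_V by (auto simp: span_E_def)
next
  case (Suc q)
  then have q: "q < d" by simp
  let ?W = "span_E (divisible q)"
  have sub: "set (map \<theta> [0..<q]) \<subseteq> S" using \<theta>_in q by auto
  have Wid: "ideal_of ?W" "V \<subseteq> ?W"
    using ideal_foldl_add_mult[OF U V VU sub] Suc by auto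
  have W'id: "ideal_of (add_mult U ?W (\<theta> q))" using ideal_add_mult[OF U Wid(1) \<theta>_in[OF q]] .
  have "add_mult U ?W (\<theta> q) = span_E (divisible (Suc q))"
  proof
    show "add_mult U ?W (\<theta> q) \<subseteq> span_E (divisible (Suc q))"
    proof
      fix x assume "x \<in> add_mult U ?W (\<theta> q)"
      then obtain w u where x: "x = w + \<theta> q * u" "w \<in> ?W" "u \<in> U" by (auto simp: add_mult_def)
      have w: "w \<in> span_E (divisible (Suc q))" using x(2) unfolding span_E_def by (blast intro: less_SucI)
      obtain F a v where u: "finite F" "F \<subseteq> L" "v \<in> V" "u = (\<Sum>m\<in>F. \<iota> (a m) * E m) + v"
        using x(3) span_E_L unfolding span_E_def by blast
      have "\<theta> q * u = (\<Sum>m\<in>F. \<iota> (a m) * E (sh q m)) + \<theta> q * v"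
        using \<theta>_sum[OF u(2) q] by (simp add: u(4) distrib_left)
      moreover have "\<iota> (a m) * E (sh q m) \<in> span_E (divisible (Suc q))" if "m \<in> F" for m
        using that u(2) q sh_in \<beta>_sh by (intro span_E_scal span_E_E) (auto intro!: exI[of _ q])
      moreover have "\<theta> q * v \<in> V" using VD(4) \<theta>_in q u by blast
      ultimately have "\<theta> q * u \<in> span_E (divisible (Suc q))"
        by (simp only: span_E_add span_E_sum span_E_V)
      then show "x \<in> span_E (divisible (Suc q))" using span_E_add w x by blast
    qed
    show "span_E (divisible (Suc q)) \<subseteq> add_mult U ?W (\<theta> q)"
    proof (rule span_E_least[OF W'id])
      show "V \<subseteq> add_mult U ?W (\<theta> q)" by (rule subset_trans[OF Wid(2) add_mult_supset[OF U]])
      fix m assume m: "m \<in> divisible (Suc q)"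
      show "E m \<in> add_mult U ?W (\<theta> q)"
      proof (cases "m \<in> divisible q")
        case True
        show ?thesis by (rule subsetD[OF add_mult_supset[OF U] span_E_E[OF True]])
      next
        case False
        then have "m \<in> L" "\<beta> q m > 0" using m by (auto simp: less_Suc_eq)
        then obtain m' where m': "m' \<in> L" "m = sh q m'" using \<beta>_pos q by blast
        have "0 + \<theta> q * E m' \<in> add_mult U ?W (\<theta> q)"
          using E_in m' span_E_V VD(2) by (intro add_multI) auto
        then show ?thesis using m' q by (simp add: E_sh)
      qed
    qed
  qed
  then show ?case using Suc by simp
qed

text \<open>The shift \<open>sh q\<close> leaves the exponents \<open>\<beta> p\<close> with
  \<open>p < q\<close> unchanged. Comparing coefficients, a product \<open>\<theta> q * u\<close>
  supported on divisible indices forces the same of \<open>u\<close>.\<close>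

theorem regular_on_\<theta>: "regular_on U V (map \<theta> [0..<d])"
  unfolding regular_on_nth
proof (intro allI impI ballI)
  fix q u assume "q < length (map \<theta> [0..<d])" and u: "u \<in> U"
    and "map \<theta> [0..<d] ! q * u \<in> foldl (add_mult U) V (take q (map \<theta> [0..<d]))"
  then have q: "q < d" and mem: "\<theta> q * u \<in> span_E (divisible q)"
    using foldl_\<theta>[of q] by (auto simp: take_map)
  obtain F a v where F: "finite F" "F \<subseteq> L" "v \<in> V" "u = (\<Sum>m\<in>F. \<iota> (a m) * E m) + v"
    using u span_E_L unfolding span_E_def by blast
  obtain G b w where G: "finite G" "G \<subseteq> divisible q" "w \<in> V" "\<theta> q * u = (\<Sum>m\<in>G. \<iota> (b m) * E m) + w"
    using mem unfolding span_E_def by blast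
  have inj: "inj_on (sh q) F" using F(2) q sh_inj by (intro inj_onI) blast
  \<comment> \<open>Coefficients are carried along the injective shift and extended by zero, so that
    both expansions of \<open>\<theta> q * u\<close> have a common index set.\<close>
  define a' where "a' = (\<lambda>x. if x \<in> sh q ` F then a (inv_into F (sh q) x) else 0)"
  define b' where "b' = (\<lambda>x. if x \<in> G then b x else 0)"
  have a': "a' (sh q m) = a m" if "m \<in> F" for m using that inj by (simp add: a'_def)
  have "\<theta> q * u = (\<Sum>m\<in>F. \<iota> (a m) * E (sh q m)) + \<theta> q * v"
    using \<theta>_sum[OF F(2) q] by (simp add: F(4) distrib_left)
  also have "(\<Sum>m\<in>F. \<iota> (a m) * E (sh q m)) = (\<Sum>x\<in>sh q ` F. \<iota> (a' x) * E x)"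
    using inj a' by (simp add: sum.reindex)
  also have "\<dots> = (\<Sum>x\<in>sh q ` F \<union> G. \<iota> (a' x) * E x)"
    using F G by (intro sum.mono_neutral_left) (auto simp: a'_def \<iota>_zero)
  finally have 1: "\<theta> q * u = (\<Sum>x\<in>sh q ` F \<union> G. \<iota> (a' x) * E x) + \<theta> q * v" .
  have "(\<Sum>m\<in>G. \<iota> (b m) * E m) = (\<Sum>x\<in>sh q ` F \<union> G. \<iota> (b' x) * E x)"
    using F G by (intro sum.mono_neutral_cong_left) (auto simp: b'_def \<iota>_zero)
  then have "(\<Sum>x\<in>sh q ` F \<union> G. \<iota> (a' x - b' x) * E x) = w - \<theta> q * v"
    using 1 G(4) by (simp add: \<iota>_diff left_diff_distrib sum_subtractf algebra_simps)
  also have "\<dots> \<in> V" using VD(4,6) \<theta>_in q F(3) G(3) by blast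
  finally have mem_V: "(\<Sum>x\<in>sh q ` F \<union> G. \<iota> (a' x - b' x) * E x) \<in> V" .
  have "a' x - b' x = 0" if "x \<in> sh q ` F \<union> G" for x
  proof (rule E_independent[OF _ _ mem_V that])
    show "finite (sh q ` F \<union> G)" "sh q ` F \<union> G \<subseteq> L" using F G q sh_in by auto
  qed
  then have zero: "a m = 0" if "m \<in> F" "m \<notin> divisible q" for m
  proof -
    have "\<beta> p (sh q m) = 0" if "p < q" for p
      using that \<open>m \<in> F\<close> \<open>m \<notin> divisible q\<close> F(2) q \<beta>_sh[of m p q] by auto
    then have "sh q m \<notin> divisible q" by auto
    then have "b' (sh q m) = 0" using G(2) by (auto simp: b'_def)
    then show ?thesis using \<open>\<And>x. x \<in> sh q ` F \<union> G \<Longrightarrow> a' x - b' x = 0\<close>[of "sh q m"] a' that by simp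
  qed
  have "\<iota> (a m) * E m \<in> span_E (divisible q)" if mF: "m \<in> F" for m
  proof (cases "m \<in> divisible q")
    case True show ?thesis by (rule span_E_scal[OF span_E_E[OF True]])
  next
    case False show ?thesis unfolding zero[OF mF False] \<iota>_zero using span_E_V[OF VD(2)] by simp
  qed
  then have "u \<in> span_E (divisible q)"
    unfolding F(4) by (rule span_E_add[OF span_E_sum span_E_V[OF F(3)]])
  then show "u \<in> foldl (add_mult U) V (take q (map \<theta> [0..<d]))"
    using foldl_\<theta>[of q] q by (simp add: take_map)
qed

text \<open>All exponents of \<open>base m\<close> vanish, so \<open>E (base m)\<close> is
  independent of the elements that span the left side.\<close>

theorem foldl_\<theta>_proper:
  assumes "L \<noteq> {}"
  shows "foldl (add_mult U) V (map \<theta> [0..<d]) \<noteq> U"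
proof
  assume "foldl (add_mult U) V (map \<theta> [0..<d]) = U"
  moreover obtain m where "m \<in> L" using assms by auto
  ultimately have b: "base m \<in> L" "E (base m) \<in> span_E (divisible d)"
    using foldl_\<theta>[of d] base_in E_in by auto
  then obtain G c w where G: "finite G" "G \<subseteq> divisible d" "w \<in> V" "E (base m) = (\<Sum>m\<in>G. \<iota> (c m) * E m) + w"
    unfolding span_E_def by blast
  have nG: "base m \<notin> G" using G(2) \<beta>_base \<open>m \<in> L\<close> by fastforce
  let ?a = "\<lambda>x. if x = base m then 1 else - c x"
  have "(\<Sum>x\<in>insert (base m) G. \<iota> (?a x) * E x) = E (base m) + (\<Sum>x\<in>G. \<iota> (?a x) * E x)"
    using G(1) nG by (simp add: \<iota>_one)
  also have "(\<Sum>x\<in>G. \<iota> (?a x) * E x) = - (\<Sum>x\<in>G. \<iota> (c x) * E x)"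
    using nG by (auto simp: \<iota>_uminus simp flip: sum_negf intro!: sum.cong)
  finally have "(\<Sum>x\<in>insert (base m) G. \<iota> (?a x) * E x) \<in> V" using G by simp
  then show False
    using E_independent[of "insert (base m) G" ?a "base m"] G b by auto
qed

end

section \<open>The polynomial ring as a graded subalgebra\<close>

abbreviation (input) keys :: "('a \<Rightarrow>\<^sub>0 'b::zero) \<Rightarrow> 'a set" where "keys \<equiv> Poly_Mapping.keys"
abbreviation (input) lookup :: "('a \<Rightarrow>\<^sub>0 'b::zero) \<Rightarrow> 'a \<Rightarrow> 'b" where "lookup \<equiv> Poly_Mapping.lookup"

lemma keys_uminus: "keys (- p :: 'a \<Rightarrow>\<^sub>0 'b::ab_group_add) = keys p"
  by (auto simp: in_keys_iff)

type_synonym mon = "var \<Rightarrow>\<^sub>0 nat"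

definition monoms :: "nat \<Rightarrow> mon set" where
  "monoms n = {m. keys m \<subseteq> vars_upto n}"

definition polys :: "nat \<Rightarrow> 'k::field mpoly set" where
  "polys n = {p. keys p \<subseteq> monoms n}"

definition const_poly :: "'k::field \<Rightarrow> 'k::field mpoly" where
  "const_poly k = Poly_Mapping.single 0 k"

abbreviation monomial :: "mon \<Rightarrow> 'k::field mpoly" where
  "monomial m \<equiv> Poly_Mapping.single m 1"

lemma zero_in_monoms [simp]: "0 \<in> monoms n"
  by (simp add: monoms_def)

lemma keys_add_nat: "keys (a + b :: mon) = keys a \<union> keys b"
  by (auto simp: in_keys_iff lookup_add)

lemma add_in_monoms_iff: "a + b \<in> monoms n \<longleftrightarrow> a \<in> monoms n \<and> b \<in> monoms n"
  by (simp add: monoms_def keys_add_nat)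

lemma single_in_monoms: "v \<in> vars_upto n \<Longrightarrow> Poly_Mapping.single v k \<in> monoms n"
  by (simp add: monoms_def)

lemma sum_monomials: "(p :: 'k::field mpoly) = (\<Sum>m\<in>keys p. Poly_Mapping.single m (lookup p m))"
proof (rule poly_mapping_eqI)
  fix k
  have "lookup (\<Sum>m\<in>keys p. Poly_Mapping.single m (lookup p m)) k = (\<Sum>m\<in>keys p. if m = k then lookup p k else 0)"
    by (auto simp: lookup_sum lookup_single when_def intro!: sum.cong)
  also have "\<dots> = lookup p k" by (simp add: in_keys_iff)
  finally show "lookup p k = lookup (\<Sum>m\<in>keys p. Poly_Mapping.single m (lookup p m)) k" by simp
qed

lemma lookup_const_poly_mult: "lookup (const_poly k * p) m = k * lookup p m"
  unfolding const_poly_def by (simp flip: mult_map_scale_conv_mult add: Poly_Mapping.map.rep_eq when_def)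

lemma const_poly_mult_single: "const_poly k * Poly_Mapping.single m c = Poly_Mapping.single m (k * c)"
  by (simp add: const_poly_def mult_single)

lemma poly_subring: "subring_type (poly_ring n) (polys n :: 'k::field mpoly set)"
proof
  show "poly_ring n = \<lparr>carrier = polys n :: 'k::field mpoly set, mult = (*), one = 1, zero = 0, add = (+)\<rparr>"
    by (auto simp: poly_ring_def polys_def monoms_def)
  fix a b :: "'k::field mpoly"
  assume a: "a \<in> polys n"
  show "- a \<in> polys n" using a by (simp add: polys_def keys_uminus)
  assume b: "b \<in> polys n"
  show "a + b \<in> polys n" using a b keys_add[of a b] by (auto simp: polys_def)
  show "a * b \<in> polys n"
  proof -
    have "x + y \<in> monoms n" if "x \<in> keys a" "y \<in> keys b" for x y
      using a b that add_in_monoms_iff by (auto simp: polys_def)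
    then show ?thesis using keys_mult[of a b] by (auto simp: polys_def)
  qed
qed (auto simp: polys_def)

lemma poly_subalgebra: "subalgebra_type (poly_ring n) (polys n) (const_poly :: 'k::field \<Rightarrow> _)"
proof -
  interpret subring_type "poly_ring n" "polys n :: 'k::field mpoly set" by (rule poly_subring)
  show ?thesis
  proof
    fix k l :: 'k
    show "const_poly k \<in> polys n" by (auto simp: polys_def const_poly_def)
  qed (auto simp: const_poly_def single_add mult_single)
qed

definition homogeneous_component :: "int \<Rightarrow> 'k::field mpoly \<Rightarrow> 'k::field mpoly" where
  "homogeneous_component d p =
    (\<Sum>m\<in>{m \<in> keys p. int (monom_degree m) = d}. Poly_Mapping.single m (lookup p m))"

lemma lookup_homogeneous_component:
  "lookup (homogeneous_component d p) m = (if int (monom_degree m) = d then lookup p m else 0)"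
proof -
  have "lookup (homogeneous_component d p) m =
      (\<Sum>x\<in>{x \<in> keys p. int (monom_degree x) = d}. if x = m then lookup p m else 0)"
    unfolding homogeneous_component_def lookup_sum
    by (intro sum.cong) (auto simp: lookup_single when_def)
  then show ?thesis by (auto simp: in_keys_iff)
qed

lemma monom_degree_eq_sum:
  assumes "finite A" "keys m \<subseteq> A"
  shows "monom_degree m = (\<Sum>v\<in>A. lookup m v)"
  unfolding monom_degree_def using assms by (intro sum.mono_neutral_left) (auto simp: in_keys_iff)

lemma monom_degree_add: "monom_degree (a + b) = monom_degree a + monom_degree b"
  using monom_degree_eq_sum[of "keys a \<union> keys b"] by (simp add: keys_add_nat lookup_add sum.distrib)

lemma poly_graded: "graded_subring_type (poly_ring n) (polys n) (poly_grading n) (homogeneous_component :: int \<Rightarrow> 'k::field mpoly \<Rightarrow> _)"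
proof -
  interpret subring_type "poly_ring n" "polys n :: 'k::field mpoly set" by (rule poly_subring)
  have grading: "p \<in> poly_grading n d \<longleftrightarrow> p \<in> polys n \<and> (\<forall>m\<in>keys p. int (monom_degree m) = d)"
    for p :: "'k::field mpoly" and d
    by (simp add: poly_grading_def)
  show ?thesis
  proof
    fix d e :: int and a b :: "'k::field mpoly"
    show "poly_grading n d \<subseteq> (polys n :: 'k::field mpoly set)" by (auto simp: grading)
    show "(0 :: 'k::field mpoly) \<in> poly_grading n d" by (simp add: grading)
    show "homogeneous_component d (a - b) = homogeneous_component d a - homogeneous_component d b"
      by (rule poly_mapping_eqI) (simp add: lookup_homogeneous_component lookup_minus)
    have fin: "{d. homogeneous_component d a \<noteq> 0} \<subseteq> (\<lambda>m. int (monom_degree m)) ` keys a"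
    proof
      fix d assume "d \<in> {d. homogeneous_component d a \<noteq> 0}"
      then obtain m where "lookup (homogeneous_component d a) m \<noteq> 0"
        using poly_mapping_eqI[of "homogeneous_component d a" 0] by auto
      then show "d \<in> (\<lambda>m. int (monom_degree m)) ` keys a"
        by (auto simp: lookup_homogeneous_component in_keys_iff split: if_splits)
    qed
    then show fin': "finite {d. homogeneous_component d a \<noteq> 0}" by (rule finite_subset) simp
    show "a = (\<Sum>d\<in>{d. homogeneous_component d a \<noteq> 0}. homogeneous_component d a)"
    proof (rule poly_mapping_eqI)
      fix m
      let ?D = "{d. homogeneous_component d a \<noteq> 0}"
      have "lookup (\<Sum>d\<in>?D. homogeneous_component d a) m =
          (\<Sum>d\<in>?D. if int (monom_degree m) = d then lookup a m else 0)"
        by (simp add: lookup_sum lookup_homogeneous_component)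
      also have "\<dots> = (if int (monom_degree m) \<in> ?D then lookup a m else 0)" using fin' by simp
      also have "\<dots> = lookup a m"
        using lookup_homogeneous_component[of "int (monom_degree m)" a m] by auto
      finally show "lookup a m = lookup (\<Sum>d\<in>?D. homogeneous_component d a) m" by simp
    qed
    { assume a: "a \<in> polys n"
      have "keys (homogeneous_component d a) \<subseteq> keys a \<inter> {m. int (monom_degree m) = d}"
        by (auto simp: in_keys_iff lookup_homogeneous_component split: if_splits)
      then show "homogeneous_component d a \<in> poly_grading n d"
        using a by (auto simp: grading polys_def) }
    { assume a: "a \<in> poly_grading n e"
      show "homogeneous_component d a = (if d = e then a else 0)"
        by (rule poly_mapping_eqI) (use a in \<open>auto simp: lookup_homogeneous_component grading in_keys_iff\<close>) }
    { assume a: "a \<in> poly_grading n d"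
      show "- a \<in> poly_grading n d" using a by (simp add: grading keys_uminus)
      { assume b: "b \<in> poly_grading n d"
        show "a + b \<in> poly_grading n d" using a b keys_add[of a b] by (auto simp: grading) }
      { assume b: "b \<in> poly_grading n e"
        show "a * b \<in> poly_grading n (d + e)"
          using a b keys_mult[of a b] by (fastforce simp: grading monom_degree_add) } }
  qed
qed

section \<open>Ideal membership through normal forms\<close>

text \<open>The coefficient of \<open>l\<close> after every monomial of \<open>p\<close> has been
  replaced by its normal form under \<open>r\<close>.\<close>

definition class_sum :: "(mon \<Rightarrow> mon) \<Rightarrow> 'k::field mpoly \<Rightarrow> mon \<Rightarrow> 'k" where
  "class_sum r p l = (\<Sum>m\<in>keys p. if r m = l then lookup p m else 0)"

lemma class_sum_eq:
  assumes "finite A" "keys p \<subseteq> A"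
  shows "class_sum r p l = (\<Sum>m\<in>A. if r m = l then lookup p m else 0)"
  unfolding class_sum_def using assms by (intro sum.mono_neutral_left) (auto simp: in_keys_iff)

lemma class_sum_add: "class_sum r (p + q) l = class_sum r p l + class_sum r q l"
  using class_sum_eq[of "keys p \<union> keys q" p r l] class_sum_eq[of "keys p \<union> keys q" q r l]
    class_sum_eq[of "keys p \<union> keys q" "p + q" r l] keys_add[of p q]
  by (auto simp: lookup_add simp flip: sum.distrib intro!: sum.cong)

lemma class_sum_const_poly_mult: "class_sum r (const_poly k * p) l = k * class_sum r p l"
proof -
  have "keys (const_poly k * p) \<subseteq> keys p" by (auto simp: in_keys_iff lookup_const_poly_mult)
  then show ?thesis
    using class_sum_eq[of "keys p" "const_poly k * p" r l]
    by (auto simp: class_sum_def lookup_const_poly_mult sum_distrib_left intro!: sum.cong)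
qed

lemma class_sum_0 [simp]: "class_sum r 0 l = 0"
  by (simp add: class_sum_def)

lemma class_sum_diff: "class_sum r (p - q) l = class_sum r p l - class_sum r q l"
  using class_sum_add[of r "p - q" q l] by simp

lemma class_sum_sum: "class_sum r (sum f A) l = (\<Sum>i\<in>A. class_sum r (f i) l)"
  by (induction A rule: infinite_finite_induct) (auto simp: class_sum_add)

lemma class_sum_single: "class_sum r (Poly_Mapping.single m c) l = (if r m = l then c else 0)"
  by (simp add: class_sum_def)

lemma class_sum_finite: "finite {l. class_sum r p l \<noteq> 0}"
proof (rule finite_subset)
  have "class_sum r p l = 0" if "l \<notin> r ` keys p" for l
    unfolding class_sum_def by (rule sum.neutral) (use that in auto)
  then show "{l. class_sum r p l \<noteq> 0} \<subseteq> r ` keys p" by blast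
qed simp

definition mX :: "nat \<Rightarrow> mon" where "mX i = Poly_Mapping.single (X i) 1"
definition mY :: "nat \<Rightarrow> mon" where "mY i = Poly_Mapping.single (Y i) 1"

lemma mvar_X: "mvar (X i) = monomial (mX i)" and mvar_Y: "mvar (Y i) = monomial (mY i)"
  by (simp_all add: mvar_def mX_def mY_def)

lemma edge_binomial:
  "monomial t * (mvar (X i) * mvar (Y j) - mvar (X j) * mvar (Y i)) =
    (monomial (t + mX i + mY j) - monomial (t + mX j + mY i) :: 'k::field mpoly)"
  by (simp add: mvar_X mvar_Y mult_single right_diff_distrib add.assoc)

context
  fixes n :: nat and E :: "nat set set"
begin

interpretation subalgebra_type "poly_ring n" "polys n" "const_poly :: 'k::field \<Rightarrow> _"
  by (rule poly_subalgebra)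

abbreviation (input) edge_ideal :: "'k::field mpoly set" where
  "edge_ideal \<equiv> binomial_edge_ideal n E"

lemma mvar_in: "i \<in> {1..n} \<Longrightarrow> mvar (X i) \<in> (polys n :: 'k::field mpoly set)"
  "i \<in> {1..n} \<Longrightarrow> mvar (Y i) \<in> (polys n :: 'k::field mpoly set)"
  by (auto simp: mvar_def polys_def monoms_def vars_upto_def)

lemma edge_ideal_subset:
  assumes "ideal_of I"
    and "\<And>i j. i \<in> {1..n} \<Longrightarrow> j \<in> {1..n} \<Longrightarrow> i < j \<Longrightarrow> {i, j} \<in> E \<Longrightarrow>
      mvar (X i) * mvar (Y j) - mvar (X j) * mvar (Y i) \<in> I"
  shows "edge_ideal \<subseteq> I"
  unfolding binomial_edge_ideal_def genideal_def using assms by (auto simp: ideal_iff)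

lemma ideal_edge_ideal: "ideal_of edge_ideal"
proof -
  interpret ring "poly_ring n :: 'k::field mpoly ring" by (rule ring_R)
  show ?thesis
    unfolding binomial_edge_ideal_def ideal_iff[symmetric]
    by (rule genideal_ideal) (auto intro!: mvar_in diff_in mult_in)
qed

lemma edge_ideal_generator:
  assumes "i \<in> {1..n}" "j \<in> {1..n}" "{i, j} \<in> E" "i \<noteq> j"
  shows "mvar (X i) * mvar (Y j) - mvar (X j) * mvar (Y i) \<in> edge_ideal"
proof -
  have *: "mvar (X i) * mvar (Y j) - mvar (X j) * mvar (Y i) \<in> edge_ideal"
    if "i \<in> {1..n}" "j \<in> {1..n}" "{i, j} \<in> E" "i < j" for i j
    unfolding binomial_edge_ideal_def genideal_def using that by blast
  show ?thesis
  proof (cases "i < j")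
    case True then show ?thesis using * assms by blast
  next
    case False
    then have "mvar (X j) * mvar (Y i) - mvar (X i) * mvar (Y j) \<in> edge_ideal"
      using *[of j i] assms by (simp add: insert_commute)
    then have "- (mvar (X j) * mvar (Y i) - mvar (X i) * mvar (Y j)) \<in> edge_ideal"
      by (rule ideal_ofD(5)[OF ideal_edge_ideal])
    then show ?thesis by simp
  qed
qed

lemma monomial_in_polys: "m \<in> monoms n \<Longrightarrow> Poly_Mapping.single m c \<in> (polys n :: 'k::field mpoly set)"
  by (simp add: polys_def)

lemma edge_ideal_swap:
  assumes "i \<in> {1..n}" "j \<in> {1..n}" "{i, j} \<in> E" "i \<noteq> j" "t \<in> monoms n"
  shows "monomial (t + mX i + mY j) - monomial (t + mX j + mY i) \<in> edge_ideal"
  unfolding edge_binomial[symmetric]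
  using ideal_ofD(4)[OF ideal_edge_ideal monomial_in_polys edge_ideal_generator] assms by blast

text \<open>Class sums vanish on monomial multiples of the generators, whose two terms have the same
  normal form. Conversely, if all class sums of \<open>p\<close> vanish, then \<open>p\<close> is a
  combination of the differences of its monomials and their normal forms.\<close>

lemma edge_ideal_iff:
  assumes red: "\<And>m. m \<in> monoms n \<Longrightarrow> monomial m - monomial (r m) \<in> (edge_ideal :: 'k::field mpoly set)"
    and inv: "\<And>t i j. t \<in> monoms n \<Longrightarrow> i \<in> {1..n} \<Longrightarrow> j \<in> {1..n} \<Longrightarrow> i < j \<Longrightarrow> {i, j} \<in> E \<Longrightarrow>
      r (t + mX i + mY j) = r (t + mX j + mY i)"
    and p: "p \<in> (polys n :: 'k::field mpoly set)"
  shows "p \<in> edge_ideal \<longleftrightarrow> (\<forall>l. class_sum r p l = 0)"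
proof
  \<comment> \<open>All multiples \<open>q * p\<close> are tested, so that the set is closed under
    multiplication; \<open>q = 1\<close> gives back the claim.\<close>
  let ?Z = "{p \<in> polys n :: 'k::field mpoly set. \<forall>q\<in>polys n. \<forall>l. class_sum r (q * p) l = 0}"
  have "ideal_of ?Z"
    unfolding ideal_of_def
  proof (intro conjI ballI)
    fix a b :: "'k::field mpoly" assume "a \<in> ?Z" "b \<in> ?Z"
    then show "a + b \<in> ?Z" by (auto simp: distrib_left class_sum_add)
  next
    fix r' a :: "'k::field mpoly" assume r': "r' \<in> polys n" and a: "a \<in> ?Z"
    have "class_sum r (q * (r' * a)) l = 0" if "q \<in> polys n" for q :: "'k::field mpoly" and l
    proof -
      have "q * r' \<in> polys n" using that r' by blast
      then have "class_sum r ((q * r') * a) l = 0" using a by blast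
      then show ?thesis by (simp add: mult.assoc)
    qed
    then show "r' * a \<in> ?Z" using r' a by auto
  qed auto
  moreover have "mvar (X i) * mvar (Y j) - mvar (X j) * mvar (Y i) \<in> ?Z"
    if ij: "i \<in> {1..n}" "j \<in> {1..n}" "i < j" "{i, j} \<in> E" for i j
  proof -
    let ?f = "mvar (X i) * mvar (Y j) - mvar (X j) * mvar (Y i) :: 'k::field mpoly"
    have "class_sum r (q * ?f) l = 0" if q: "q \<in> polys n" for q :: "'k::field mpoly" and l
    proof -
      have "q * ?f = (\<Sum>t\<in>keys q. const_poly (lookup q t) * (monomial t * ?f))"
        by (subst sum_monomials[of q]) (simp add: sum_distrib_right mult.assoc[symmetric] const_poly_mult_single)
      then have "class_sum r (q * ?f) l = (\<Sum>t\<in>keys q. lookup q t * class_sum r (monomial t * ?f) l)"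
        by (simp only: class_sum_sum class_sum_const_poly_mult)
      also have "\<dots> = 0"
      proof (rule sum.neutral, rule ballI)
        fix t assume "t \<in> keys q"
        then have "t \<in> monoms n" using q by (auto simp: polys_def)
        then show "lookup q t * class_sum r (monomial t * ?f) l = 0"
          unfolding edge_binomial using inv[OF _ ij, of t] by (simp add: class_sum_diff class_sum_single)
      qed
      finally show ?thesis .
    qed
    moreover have "?f \<in> polys n" using ij mvar_in by blast
    ultimately show ?thesis by blast
  qed
  ultimately have sub: "edge_ideal \<subseteq> ?Z" by (rule edge_ideal_subset)
  assume "p \<in> edge_ideal"
  then have "p \<in> ?Z" using sub by blast
  then have "class_sum r (1 * p) l = 0" for l using one_in by blast
  then show "\<forall>l. class_sum r p l = 0" by simp
next
  assume zero: "\<forall>l. class_sum r p l = 0"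
  have "(\<Sum>m\<in>keys p. Poly_Mapping.single (r m) (lookup p m)) = 0"
    by (rule poly_mapping_eqI) (use zero in \<open>simp add: lookup_sum lookup_single when_def class_sum_def\<close>)
  moreover have "p = (\<Sum>m\<in>keys p. Poly_Mapping.single m (lookup p m))" by (rule sum_monomials)
  ultimately have "p = (\<Sum>m\<in>keys p. const_poly (lookup p m) * (monomial m - monomial (r m)))"
    by (simp add: right_diff_distrib const_poly_mult_single sum_subtractf)
  also have "\<dots> \<in> edge_ideal"
  proof (rule ideal_of_sum[OF ideal_edge_ideal])
    fix m assume "m \<in> keys p"
    then have "m \<in> monoms n" using p by (auto simp: polys_def)
    then show "const_poly (lookup p m) * (monomial m - monomial (r m)) \<in> edge_ideal"
      using ideal_ofD(4)[OF ideal_edge_ideal \<iota>_in red] by blast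
  qed
  finally show "p \<in> edge_ideal" .
qed

end

section \<open>Monomials along an ordering of the vertices\<close>

text \<open>An order of the vertices as a map from positions to names, so that what follows can be
  stated for every starting point of the cycle.\<close>

definition enum :: "nat \<Rightarrow> (nat \<Rightarrow> nat) \<Rightarrow> bool" where
  "enum n v \<longleftrightarrow> bij_betw v {..<n} {1..n}"

definition xe :: "(nat \<Rightarrow> nat) \<Rightarrow> mon \<Rightarrow> nat \<Rightarrow> nat" where "xe v m q = lookup m (X (v q))"
definition ye :: "(nat \<Rightarrow> nat) \<Rightarrow> mon \<Rightarrow> nat \<Rightarrow> nat" where "ye v m q = lookup m (Y (v q))"

lemma enum_inj: "enum n v \<Longrightarrow> p < n \<Longrightarrow> q < n \<Longrightarrow> v p = v q \<longleftrightarrow> p = q"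
  by (auto simp: enum_def bij_betw_def inj_on_def)

lemma enum_in: "enum n v \<Longrightarrow> q < n \<Longrightarrow> v q \<in> {1..n}"
  by (auto simp: enum_def bij_betw_def)

lemma enum_surj: "enum n v \<Longrightarrow> w \<in> {1..n} \<Longrightarrow> \<exists>q<n. w = v q"
  by (force simp: enum_def bij_betw_def)

lemma xe_add [simp]: "xe v (m + m') q = xe v m q + xe v m' q"
  and ye_add [simp]: "ye v (m + m') q = ye v m q + ye v m' q"
  by (simp_all add: xe_def ye_def lookup_add)

lemma xe_mY [simp]: "xe v (mY i) q = 0" and ye_mX [simp]: "ye v (mX i) q = 0"
  by (simp_all add: xe_def ye_def mX_def mY_def lookup_single)

lemma xe_mX: "xe v (mX i) q = (if v q = i then 1 else 0)"
  and ye_mY: "ye v (mY i) q = (if v q = i then 1 else 0)"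
  by (auto simp: xe_def ye_def mX_def mY_def lookup_single when_def)

lemma mX_in: "i \<in> {1..n} \<Longrightarrow> mX i \<in> monoms n" and mY_in: "i \<in> {1..n} \<Longrightarrow> mY i \<in> monoms n"
  by (auto simp: mX_def mY_def vars_upto_def intro!: single_in_monoms)

lemma monom_eqI:
  assumes "enum n v" "m \<in> monoms n" "m' \<in> monoms n"
    and "\<And>q. q < n \<Longrightarrow> xe v m q = xe v m' q" "\<And>q. q < n \<Longrightarrow> ye v m q = ye v m' q"
  shows "m = m'"
proof (rule poly_mapping_eqI)
  fix k
  show "lookup m k = lookup m' k"
  proof (cases "k \<in> vars_upto n")
    case True
    then obtain w where w: "w \<in> {1..n}" "k = X w \<or> k = Y w" by (auto simp: vars_upto_def)
    then obtain q where "q < n" "w = v q" using enum_surj assms(1) by blast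
    then show ?thesis using assms(4,5)[of q] w by (auto simp: xe_def ye_def)
  next
    case False
    then have "k \<notin> keys m" "k \<notin> keys m'" using assms(2,3) by (auto simp: monoms_def)
    then show ?thesis by (simp add: in_keys_iff)
  qed
qed

lemma monom_split:
  assumes "ye v m p > 0" "xe v m q > 0"
  obtains t where "m = t + mX (v q) + mY (v p)"
proof
  show "m = (m - mX (v q) - mY (v p)) + mX (v q) + mY (v p)"
    by (rule poly_mapping_eqI)
      (use assms in \<open>auto simp: lookup_add lookup_minus mX_def mY_def lookup_single when_def xe_def ye_def\<close>)
qed

text \<open>A strictly concave weight for which \<open>Y (v q)\<close> and \<open>X (v (q + 1))\<close> have the same weight.  Moving
  occurrences of \<open>X\<close> to earlier positions lowers it.\<close>

definition wt :: "nat \<Rightarrow> nat \<Rightarrow> nat" where "wt n q = q * (2 * n - q)"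

definition weight :: "nat \<Rightarrow> (nat \<Rightarrow> nat) \<Rightarrow> mon \<Rightarrow> nat" where
  "weight n v m = (\<Sum>q<n. xe v m q * wt n q + ye v m q * wt n (Suc q))"

lemma weight_add [simp]: "weight n v (m + m') = weight n v m + weight n v m'"
  by (simp add: weight_def distrib_right sum.distrib)

lemma weight_mX:
  assumes "enum n v" "p < n"
  shows "weight n v (mX (v p)) = wt n p"
proof -
  have "weight n v (mX (v p)) = (\<Sum>q<n. if q = p then wt n p else 0)"
    unfolding weight_def by (rule sum.cong) (use assms in \<open>auto simp: xe_mX enum_inj\<close>)
  then show ?thesis using assms by simp
qed

lemma weight_mY:
  assumes "enum n v" "p < n"
  shows "weight n v (mY (v p)) = wt n (Suc p)"
proof -
  have "weight n v (mY (v p)) = (\<Sum>q<n. if q = p then wt n (Suc p) else 0)"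
    unfolding weight_def by (rule sum.cong) (use assms in \<open>auto simp: ye_mY enum_inj\<close>)
  then show ?thesis using assms by simp
qed

text \<open>The increments \<open>2 * n - 2 * q - 1\<close> of \<open>wt n\<close> strictly
  decrease. By the index shift in \<open>weight\<close>, moving an \<open>X\<close> from
  \<open>q\<close> to \<open>p\<close> and a \<open>Y\<close> from \<open>p\<close> to
  \<open>q\<close> exchanges the increment at \<open>p\<close> for the smaller one at
  \<open>q\<close>. Integers avoid the truncated subtraction in \<open>wt\<close>.\<close>

lemma wt_swap:
  assumes "p < q" "q < n"
  shows "wt n p + wt n (Suc q) < wt n (Suc p) + wt n q"
proof -
  have *: "int (wt n a) = int a * (2 * int n - int a)" if "a \<le> n" for a
    using that by (simp add: wt_def of_nat_diff)
  have "int (wt n p) + int (wt n (Suc q)) < int (wt n (Suc p)) + int (wt n q)"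
    using assms by (simp add: * algebra_simps)
  then show ?thesis by simp
qed

text \<open>Terminates by the weight. The inversions \<open>A\<close> to be removed are all pairs of
  positions for the complete graph and consecutive ones for the cycle; \<open>sim\<close> collects
  what the swaps preserve and yields uniqueness later. The last alternative, that a proper reduction
  is strictly lighter, feeds the triangularity proofs.\<close>

lemma exists_normal_form:
  assumes v: "enum n v"
    and A: "\<And>p q. (p, q) \<in> A \<Longrightarrow> p < q \<and> q < n \<and> {v p, v q} \<in> E"
    and sim_refl: "\<And>m. sim m m" and sim_trans: "\<And>a b c. sim a b \<Longrightarrow> sim b c \<Longrightarrow> sim a c"
    and sim_swap: "\<And>t p q. (p, q) \<in> A \<Longrightarrow> sim (t + mX (v q) + mY (v p)) (t + mX (v p) + mY (v q))"
    and m: "m \<in> monoms n"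
  shows "\<exists>m'\<in>monoms n. sim m m' \<and> (\<forall>(p, q)\<in>A. ye v m' p = 0 \<or> xe v m' q = 0) \<and>
    monomial m - monomial m' \<in> (binomial_edge_ideal n E :: 'k::field mpoly set) \<and>
    (m' = m \<or> weight n v m' < weight n v m)"
  using m
proof (induction "weight n v m" arbitrary: m rule: less_induct)
  case less
  interpret subalgebra_type "poly_ring n" "polys n" "const_poly :: 'k::field \<Rightarrow> _" by (rule poly_subalgebra)
  let ?J = "binomial_edge_ideal n E :: 'k::field mpoly set"
  have J: "ideal_of ?J" by (rule ideal_edge_ideal)
  show ?case
  proof (cases "\<forall>(p, q)\<in>A. ye v m p = 0 \<or> xe v m q = 0")
    case True
    then show ?thesis using less.prems sim_refl ideal_ofD(2)[OF J] by (intro bexI[of _ m]) auto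
  next
    case False
    then obtain p q where pq: "(p, q) \<in> A" "ye v m p > 0" "xe v m q > 0" by auto
    obtain t where t: "m = t + mX (v q) + mY (v p)" using monom_split pq(2,3) .
    have lt: "p < q" "q < n" "{v p, v q} \<in> E" using A pq(1) by auto
    define m1 where "m1 = t + mX (v p) + mY (v q)"
    have tm: "t \<in> monoms n" using less.prems t by (simp add: add_in_monoms_iff)
    have vs: "v p \<in> {1..n}" "v q \<in> {1..n}" "v p \<noteq> v q"
      using enum_in[OF v] enum_inj[OF v, of p q] lt by auto
    have m1: "m1 \<in> monoms n" unfolding m1_def using tm vs by (simp only: add_in_monoms_iff mX_in mY_in simp_thms)
    have less1: "weight n v m1 < weight n v m"
      using wt_swap[OF lt(1,2)] lt by (simp add: m1_def t weight_mX[OF v] weight_mY[OF v])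
    have J1: "monomial m - monomial m1 \<in> ?J"
      unfolding t m1_def using vs lt tm by (intro edge_ideal_swap) (auto simp: insert_commute)
    obtain m' where m': "m' \<in> monoms n" "sim m1 m'" "\<forall>(p, q)\<in>A. ye v m' p = 0 \<or> xe v m' q = 0"
      "monomial m1 - monomial m' \<in> ?J" "m' = m1 \<or> weight n v m' < weight n v m1"
      using less.hyps[OF less1 m1] by blast
    have "(monomial m - monomial m1) + (monomial m1 - monomial m') \<in> ?J"
      using ideal_ofD(3)[OF J J1 m'(4)] .
    then have "monomial m - monomial m' \<in> ?J" by simp
    moreover have "sim m m'" using sim_trans[OF sim_swap[OF pq(1)] m'(2)[unfolded m1_def]] t by simp
    ultimately show ?thesis using m' less1 by (intro bexI[of _ m']) auto
  qed
qed

text \<open>If \<open>m\<close> and \<open>m'\<close> first differ at a position where \<open>m\<close> has fewer \<open>X\<close>, then \<open>m\<close> has a \<open>Y\<close> there, so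
  it has no \<open>X\<close> up to the next checkpoint \<open>g\<close>, where the prefix sums must agree.\<close>

definition checkpoints :: "nat \<Rightarrow> (nat \<Rightarrow> nat) \<Rightarrow> mon \<Rightarrow> mon \<Rightarrow> bool" where
  "checkpoints n v m m' \<longleftrightarrow> (\<forall>q<n. ye v m q > 0 \<longrightarrow>
    (\<exists>g. q < g \<and> g \<le> n \<and> (\<forall>p. q < p \<and> p < g \<longrightarrow> xe v m p = 0) \<and> (\<Sum>p<g. xe v m p) = (\<Sum>p<g. xe v m' p)))"

lemma monom_unique:
  assumes v: "enum n v" and m: "m \<in> monoms n" "m' \<in> monoms n"
    and tot: "\<And>q. q < n \<Longrightarrow> xe v m q + ye v m q = xe v m' q + ye v m' q"
    and chk: "checkpoints n v m m'" "checkpoints n v m' m"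
  shows "m = m'"
proof -
  have main: False
    if i: "i < n" "\<And>p. p < i \<Longrightarrow> xe v a p = xe v b p" "xe v a i < xe v b i"
      and c: "checkpoints n v a b" and t: "xe v a i + ye v a i = xe v b i + ye v b i" for a b i
  proof -
    have "ye v a i > 0" using i t by linarith
    then obtain g where g: "i < g" "g \<le> n" "\<forall>p. i < p \<and> p < g \<longrightarrow> xe v a p = 0"
      "(\<Sum>p<g. xe v a p) = (\<Sum>p<g. xe v b p)"
      using c i(1) unfolding checkpoints_def by blast
    have split: "(\<Sum>p<g. f p) = (\<Sum>p<i. f p) + f i + (\<Sum>p\<in>{Suc i..<g}. f p)" for f :: "nat \<Rightarrow> nat"
      using sum.atLeastLessThan_concat[of 0 i g f] sum.atLeast_Suc_lessThan[of i g f] g(1)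
      by (simp add: lessThan_atLeast0)
    have "(\<Sum>p\<in>{Suc i..<g}. xe v a p) = 0" using g(3) by auto
    moreover have "(\<Sum>p<i. xe v a p) = (\<Sum>p<i. xe v b p)" using i(2) by (intro sum.cong) auto
    ultimately show False using g(4) i(3) unfolding split[of "xe v a"] split[of "xe v b"] by linarith
  qed
  have eq: "xe v m q = xe v m' q" if "q < n" for q
    using that
  proof (induction q rule: less_induct)
    case (less q)
    then have IH: "xe v m p = xe v m' p" if "p < q" for p using that by simp
    show ?case
    proof (rule ccontr)
      assume "xe v m q \<noteq> xe v m' q"
      then show False
        using main[of q m m'] main[of q m' m] IH less.prems chk tot[of q] by (metis nat_neq_iff)
    qed
  qed
  show ?thesis
    by (rule monom_eqI[OF v m]) (use eq tot in force)+
qed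

section \<open>Normal forms for the complete graph\<close>

definition ordered :: "nat \<Rightarrow> (nat \<Rightarrow> nat) \<Rightarrow> mon \<Rightarrow> bool" where
  "ordered n v m \<longleftrightarrow> (\<forall>p q. p < q \<and> q < n \<longrightarrow> ye v m p = 0 \<or> xe v m q = 0)"

lemma orderedD: "ordered n v m \<Longrightarrow> ye v m q > 0 \<Longrightarrow> q < p \<Longrightarrow> p < n \<Longrightarrow> xe v m p = 0"
  unfolding ordered_def by (metis less_irrefl)

text \<open>The closing edge between positions \<open>n - 1\<close> and \<open>0\<close> is left
  out: when a vertex is missing, the order is chosen so that position \<open>0\<close> is
  missing.\<close>

definition locally_ordered :: "nat \<Rightarrow> (nat \<Rightarrow> nat) \<Rightarrow> mon \<Rightarrow> bool" where
  "locally_ordered n v m \<longleftrightarrow> (\<forall>q. Suc q < n \<longrightarrow> ye v m q = 0 \<or> xe v m (Suc q) = 0)"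

definition vertex_deg :: "mon \<Rightarrow> nat \<Rightarrow> nat" where
  "vertex_deg m w = lookup m (X w) + lookup m (Y w)"

lemma vertex_deg_enum: "vertex_deg m (v q) = xe v m q + ye v m q"
  by (simp add: vertex_deg_def xe_def ye_def)

lemma vertex_deg_add: "vertex_deg (a + b) w = vertex_deg a w + vertex_deg b w"
  by (simp add: vertex_deg_def lookup_add)

lemma vertex_deg_mX: "vertex_deg (mX i) w = (if w = i then 1 else 0)"
  and vertex_deg_mY: "vertex_deg (mY i) w = (if w = i then 1 else 0)"
  by (auto simp: vertex_deg_def mX_def mY_def lookup_single when_def)

text \<open>Equality of images under the Segre map \<open>x\<^sub>i \<mapsto> s t\<^sub>i\<close>,
  \<open>y\<^sub>i \<mapsto> u t\<^sub>i\<close>, whose kernel is the ideal of 2-minors.\<close>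

definition same_clique :: "nat \<Rightarrow> mon \<Rightarrow> mon \<Rightarrow> bool" where
  "same_clique n m m' \<longleftrightarrow> vertex_deg m = vertex_deg m' \<and>
    (\<Sum>w\<in>{1..n}. lookup m (X w)) = (\<Sum>w\<in>{1..n}. lookup m' (X w))"

lemma same_clique_swap:
  assumes "i \<in> {1..n}" "j \<in> {1..n}"
  shows "same_clique n (t + mX i + mY j) (t + mX j + mY i)"
proof -
  have 1: "(\<Sum>w\<in>{1..n}. lookup (mX i) (X w)) = 1" if "i \<in> {1..n}" for i
    using that by (simp add: mX_def lookup_single when_def)
  have 2: "lookup (mY i) (X w) = 0" for i w by (simp add: mY_def lookup_single)
  have "vertex_deg (t + mX i + mY j) = vertex_deg (t + mX j + mY i)"
    by (rule ext) (simp add: vertex_deg_add vertex_deg_mX vertex_deg_mY)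
  then show ?thesis
    unfolding same_clique_def by (simp only: lookup_add sum.distrib 1[OF assms(1)] 1[OF assms(2)] 2)
qed

lemma sum_enum: "enum n v \<Longrightarrow> (\<Sum>q<n. xe v m q) = (\<Sum>w\<in>{1..n}. lookup m (X w))"
  unfolding enum_def xe_def by (rule sum.reindex_bij_betw)

text \<open>After a \<open>Y\<close> no \<open>X\<close> occurs up to the end, so the single
  checkpoint \<open>n\<close> suffices, where the prefix sums are the total numbers of
  \<open>X\<close>.\<close>

lemma ordered_unique:
  assumes v: "enum n v" and m: "m \<in> monoms n" "m' \<in> monoms n" and o: "ordered n v m" "ordered n v m'"
    and s: "same_clique n m m'"
  shows "m = m'"
proof (rule monom_unique[OF v m])
  show "xe v m q + ye v m q = xe v m' q + ye v m' q" for q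
    using s by (simp add: same_clique_def flip: vertex_deg_enum)
  have "(\<Sum>q<n. xe v m q) = (\<Sum>q<n. xe v m' q)"
    using s by (simp add: same_clique_def sum_enum[OF v])
  then show "checkpoints n v m m'" "checkpoints n v m' m"
    using o by (auto simp: checkpoints_def intro!: exI[of _ n] orderedD)
qed

definition complete_edges :: "nat \<Rightarrow> nat set set" where
  "complete_edges n = {{i, j} | i j. i \<in> {1..n} \<and> j \<in> {1..n} \<and> i \<noteq> j}"

lemma exists_ordered:
  assumes v: "enum n v" and m: "m \<in> monoms n"
  shows "\<exists>m'\<in>monoms n. same_clique n m m' \<and> ordered n v m' \<and>
    monomial m - monomial m' \<in> (binomial_edge_ideal n (complete_edges n) :: 'k::field mpoly set) \<and>
    (m' = m \<or> weight n v m' < weight n v m)"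
proof -
  let ?A = "{(p, q). p < q \<and> q < n}"
  have edges: "{v p, v q} \<in> complete_edges n" if "p < q" "q < n" for p q
  proof -
    have "v p \<in> {1..n}" "v q \<in> {1..n}" "v p \<noteq> v q"
      using that enum_in[OF v] enum_inj[OF v, of p q] by auto
    then show ?thesis unfolding complete_edges_def by blast
  qed
  have swap: "same_clique n (t + mX (v q) + mY (v p)) (t + mX (v p) + mY (v q))"
    if "p < q" "q < n" for t p q
    using that by (intro same_clique_swap enum_in[OF v]) auto
  have "\<exists>m'\<in>monoms n. same_clique n m m' \<and> (\<forall>(p, q)\<in>?A. ye v m' p = 0 \<or> xe v m' q = 0) \<and>
    monomial m - monomial m' \<in> (binomial_edge_ideal n (complete_edges n) :: 'k mpoly set) \<and>
    (m' = m \<or> weight n v m' < weight n v m)"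
  proof (rule exists_normal_form[OF v _ _ _ _ m])
    show "p < q \<and> q < n \<and> {v p, v q} \<in> complete_edges n" if "(p, q) \<in> ?A" for p q
      using that edges by auto
    show "same_clique n (t + mX (v q) + mY (v p)) (t + mX (v p) + mY (v q))" if "(p, q) \<in> ?A" for t p q
      using that swap by auto
  qed (simp_all add: same_clique_def)
  then show ?thesis unfolding ordered_def by auto
qed

definition ordered_form :: "nat \<Rightarrow> (nat \<Rightarrow> nat) \<Rightarrow> mon \<Rightarrow> mon" where
  "ordered_form n v m = (THE m'. m' \<in> monoms n \<and> ordered n v m' \<and> same_clique n m m')"

lemma ordered_form:
  assumes v: "enum n v" and m: "m \<in> monoms n"
  shows "ordered_form n v m \<in> monoms n" "ordered n v (ordered_form n v m)"
    "same_clique n m (ordered_form n v m)"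
    "monomial m - monomial (ordered_form n v m) \<in> (binomial_edge_ideal n (complete_edges n) :: 'k::field mpoly set)"
    "ordered_form n v m = m \<or> weight n v (ordered_form n v m) < weight n v m"
proof -
  obtain m' where m': "m' \<in> monoms n" "same_clique n m m'" "ordered n v m'"
    "monomial m - monomial m' \<in> (binomial_edge_ideal n (complete_edges n) :: 'k mpoly set)"
    "m' = m \<or> weight n v m' < weight n v m"
    using exists_ordered[OF v m] by blast
  have "ordered_form n v m = m'"
    unfolding ordered_form_def
  proof (rule the_equality)
    fix a assume a: "a \<in> monoms n \<and> ordered n v a \<and> same_clique n m a"
    then have "same_clique n a m'" using m'(2) by (simp add: same_clique_def)
    then show "a = m'" using ordered_unique[OF v] a m' by blast
  qed (use m' in auto)
  then show "ordered_form n v m \<in> monoms n" "ordered n v (ordered_form n v m)"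
    "same_clique n m (ordered_form n v m)"
    "monomial m - monomial (ordered_form n v m) \<in> (binomial_edge_ideal n (complete_edges n) :: 'k::field mpoly set)"
    "ordered_form n v m = m \<or> weight n v (ordered_form n v m) < weight n v m"
    using m' by auto
qed

lemma ordered_form_eq:
  assumes "enum n v" "m \<in> monoms n" "m' \<in> monoms n" "ordered n v m'" "same_clique n m m'"
  shows "ordered_form n v m = m'"
  using ordered_unique[OF assms(1) _ assms(3) _ assms(4), of "ordered_form n v m"] ordered_form(1-3)[OF assms(1,2)] assms(5)
  by (simp add: same_clique_def)

text \<open>Available for every order \<open>v\<close>: the comparison with the cycle applies it to
  an order that depends on a monomial.\<close>

lemma complete_ideal_iff:
  assumes v: "enum n v" and p: "p \<in> (polys n :: 'k::field mpoly set)"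
  shows "p \<in> binomial_edge_ideal n (complete_edges n) \<longleftrightarrow> (\<forall>l. class_sum (ordered_form n v) p l = 0)"
proof (rule edge_ideal_iff[OF _ _ p])
  show "monomial m - monomial (ordered_form n v m) \<in> (binomial_edge_ideal n (complete_edges n) :: 'k mpoly set)"
    if "m \<in> monoms n" for m using ordered_form(4)[OF v that] .
  fix t i j assume t: "t \<in> monoms n" "i \<in> {1..n}" "j \<in> {1..n}"
  have mem: "t + mX i + mY j \<in> monoms n" "t + mX j + mY i \<in> monoms n"
    using t by (simp_all only: add_in_monoms_iff mX_in mY_in simp_thms)
  have "same_clique n (t + mX i + mY j) (t + mX j + mY i)" by (rule same_clique_swap) fact+
  then show "ordered_form n v (t + mX i + mY j) = ordered_form n v (t + mX j + mY i)"
    using ordered_form(1-3)[OF v mem(2)] mem by (intro ordered_form_eq[OF v mem(1)]) (auto simp: same_clique_def)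
qed

section \<open>Monomial bases split into copies of free monomial modules\<close>

text \<open>Every monomial \<open>m \<in> L\<close> has a type \<open>D m\<close>.  The monomials of type \<open>\<delta>\<close> are exactly those in the
  \<open>N\<close> variables \<open>main \<delta> q\<close>, \<open>q < N\<close>, with exponents at least \<open>req \<delta> q\<close>.\<close>

locale colored_monomials =
  fixes n N :: nat and L :: "mon set" and D :: "mon \<Rightarrow> 'd" and main :: "'d \<Rightarrow> nat \<Rightarrow> var"
    and req :: "'d \<Rightarrow> nat \<Rightarrow> nat" and types :: "'d set"
  assumes L_sub: "L \<subseteq> monoms n"
    and finite_types: "finite types" and D_in: "m \<in> L \<Longrightarrow> D m \<in> types"
    and main_inj: "m \<in> L \<Longrightarrow> inj_on (main (D m)) {..<N}"
    and keys_main: "m \<in> L \<Longrightarrow> keys m \<subseteq> main (D m) ` {..<N}"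
    and req_le: "m \<in> L \<Longrightarrow> q < N \<Longrightarrow> req (D m) q \<le> lookup m (main (D m) q)"
    and main_vars: "m \<in> L \<Longrightarrow> q < N \<Longrightarrow> main (D m) q \<in> vars_upto n"
    and same_type: "m \<in> L \<Longrightarrow> m' \<in> monoms n \<Longrightarrow> keys m' \<subseteq> main (D m) ` {..<N} \<Longrightarrow>
      (\<And>q. q < N \<Longrightarrow> req (D m) q \<le> lookup m' (main (D m) q)) \<Longrightarrow> m' \<in> L \<and> D m' = D m"
begin

definition sh :: "nat \<Rightarrow> mon \<Rightarrow> mon" where
  "sh q m = m + Poly_Mapping.single (main (D m) q) 1"

definition \<beta> :: "nat \<Rightarrow> mon \<Rightarrow> nat" where
  "\<beta> q m = lookup m (main (D m) q) - req (D m) q"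

definition base :: "mon \<Rightarrow> mon" where
  "base m = (\<Sum>q<N. Poly_Mapping.single (main (D m) q) (req (D m) q))"

lemma main_eq_iff: "m \<in> L \<Longrightarrow> p < N \<Longrightarrow> q < N \<Longrightarrow> main (D m) p = main (D m) q \<longleftrightarrow> p = q"
  using main_inj[of m] by (auto simp: inj_on_def)

lemma lookup_sh:
  assumes "m \<in> L" "p < N" "q < N"
  shows "lookup (sh q m) (main (D m) p) = lookup m (main (D m) p) + (if p = q then 1 else 0)"
  using main_eq_iff[OF assms] by (auto simp: sh_def lookup_add lookup_single when_def)

lemma sh_props:
  assumes "m \<in> L" "q < N"
  shows sh_in: "sh q m \<in> L" and D_sh: "D (sh q m) = D m"
proof -
  have "sh q m \<in> L \<and> D (sh q m) = D m"
  proof (rule same_type[OF assms(1)])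
    show "sh q m \<in> monoms n"
      unfolding sh_def add_in_monoms_iff using assms L_sub main_vars single_in_monoms by blast
    show "keys (sh q m) \<subseteq> main (D m) ` {..<N}"
      using keys_main[OF assms(1)] assms(2) by (auto simp: sh_def keys_add_nat)
    show "req (D m) p \<le> lookup (sh q m) (main (D m) p)" if "p < N" for p
      using req_le[OF assms(1) that] by (simp add: sh_def lookup_add)
  qed
  then show "sh q m \<in> L" "D (sh q m) = D m" by auto
qed

lemma sh_inj: "m \<in> L \<Longrightarrow> m' \<in> L \<Longrightarrow> q < N \<Longrightarrow> sh q m = sh q m' \<Longrightarrow> m = m'"
  using D_sh[of m q] D_sh[of m' q] by (simp add: sh_def)

lemma \<beta>_sh: "m \<in> L \<Longrightarrow> p < N \<Longrightarrow> q < N \<Longrightarrow> \<beta> p (sh q m) = \<beta> p m + (if p = q then 1 else 0)"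
  using req_le[of m p] by (auto simp: \<beta>_def D_sh lookup_sh)

lemma \<beta>_pos:
  assumes "m \<in> L" "q < N" "\<beta> q m > 0"
  shows "\<exists>m'\<in>L. m = sh q m'"
proof -
  let ?x = "main (D m) q"
  let ?m' = "m - Poly_Mapping.single ?x 1"
  have gt: "req (D m) q < lookup m ?x" using assms(3) by (simp add: \<beta>_def)
  have m: "m = ?m' + Poly_Mapping.single ?x 1"
    by (rule poly_mapping_eqI) (use gt in \<open>auto simp: lookup_add lookup_minus lookup_single when_def\<close>)
  have "?m' \<in> L \<and> D ?m' = D m"
  proof (rule same_type[OF assms(1)])
    show "?m' \<in> monoms n" using m L_sub assms(1) add_in_monoms_iff by (metis subsetD)
    show "keys ?m' \<subseteq> main (D m) ` {..<N}"
      using keys_main[OF assms(1)] by (auto simp: in_keys_iff lookup_minus)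
    show "req (D m) p \<le> lookup ?m' (main (D m) p)" if "p < N" for p
      using req_le[OF assms(1) that] gt main_eq_iff[OF assms(1) that assms(2)]
      by (auto simp: lookup_minus lookup_single when_def)
  qed
  then show ?thesis using m by (intro bexI[of _ ?m']) (auto simp: sh_def)
qed

lemma lookup_base:
  assumes "m \<in> L" "p < N"
  shows "lookup (base m) (main (D m) p) = req (D m) p"
proof -
  have "lookup (base m) (main (D m) p) = (\<Sum>q<N. if q = p then req (D m) p else 0)"
    unfolding base_def lookup_sum
    by (rule sum.cong) (use main_eq_iff[OF assms(1)] assms in \<open>auto simp: lookup_single when_def\<close>)
  then show ?thesis using assms by simp
qed

lemma keys_base: "keys (base m) \<subseteq> main (D m) ` {..<N}"
proof
  fix x assume "x \<in> keys (base m)"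
  then have "(\<Sum>q<N. lookup (Poly_Mapping.single (main (D m) q) (req (D m) q)) x) \<noteq> 0"
    by (simp add: in_keys_iff base_def lookup_sum)
  then obtain q where "q < N" "lookup (Poly_Mapping.single (main (D m) q) (req (D m) q)) x \<noteq> 0"
    by (auto elim: sum.not_neutral_contains_not_neutral)
  then show "x \<in> main (D m) ` {..<N}" by (auto simp: lookup_single when_def split: if_splits)
qed

lemma base_props:
  assumes "m \<in> L"
  shows base_in: "base m \<in> L" and D_base: "D (base m) = D m"
proof -
  have "base m \<in> L \<and> D (base m) = D m"
  proof (rule same_type[OF assms])
    show "base m \<in> monoms n"
      using keys_base[of m] main_vars[OF assms] by (auto simp: monoms_def)
    show "req (D m) p \<le> lookup (base m) (main (D m) p)" if "p < N" for p
      using lookup_base[OF assms that] by simp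
  qed (rule keys_base)
  then show "base m \<in> L" "D (base m) = D m" by auto
qed

lemma base_sh: "m \<in> L \<Longrightarrow> q < N \<Longrightarrow> base (sh q m) = base m"
  by (simp add: base_def D_sh)

lemma \<beta>_base: "m \<in> L \<Longrightarrow> q < N \<Longrightarrow> \<beta> q (base m) = 0"
  by (simp add: \<beta>_def D_base lookup_base)

lemma eq_by_main:
  assumes "m \<in> L" "m' \<in> L" "D m = D m'" "\<And>q. q < N \<Longrightarrow> lookup m (main (D m) q) = lookup m' (main (D m) q)"
  shows "m = m'"
proof (rule poly_mapping_eqI)
  fix x
  show "lookup m x = lookup m' x"
  proof (cases "x \<in> main (D m) ` {..<N}")
    case True then show ?thesis using assms(4) by auto
  next
    case False
    then have "x \<notin> keys m" "x \<notin> keys m'" using keys_main assms by fastforce+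
    then show ?thesis by (simp add: in_keys_iff)
  qed
qed

lemma base_id:
  assumes "m \<in> L" "\<And>q. q < N \<Longrightarrow> \<beta> q m = 0"
  shows "base m = m"
proof (rule eq_by_main[OF base_in[OF assms(1)] assms(1) D_base[OF assms(1)]])
  show "lookup (base m) (main (D (base m)) q) = lookup m (main (D (base m)) q)" if "q < N" for q
    using assms(2)[OF that] req_le[OF assms(1) that] lookup_base[OF assms(1) that]
    by (simp add: D_base[OF assms(1)] \<beta>_def)
qed

lemma lookup_le_degree: "lookup m x \<le> monom_degree m"
proof (cases "x \<in> keys m")
  case True
  then show ?thesis unfolding monom_degree_def by (intro member_le_sum) auto
qed (simp add: in_keys_iff)

text \<open>A monomial is determined by its type and its \<open>N\<close> exponents at the main
  variables, each of which is at most the degree.\<close>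

lemma bounded_degree:
  shows finite_bounded_degree: "finite {m \<in> L. monom_degree m \<le> t}"
    and card_bounded_degree: "card {m \<in> L. monom_degree m \<le> t} \<le> card types * Suc t ^ N"
proof -
  let ?A = "{m \<in> L. monom_degree m \<le> t}" and ?B = "types \<times> ({..<N} \<rightarrow>\<^sub>E {..t})"
  let ?f = "\<lambda>m. (D m, \<lambda>q\<in>{..<N}. lookup m (main (D m) q))"
  have inj: "inj_on ?f ?A"
  proof (rule inj_onI)
    fix m m' assume m: "m \<in> ?A" "m' \<in> ?A" "?f m = ?f m'"
    then have eq: "D m = D m'" "(\<lambda>q\<in>{..<N}. lookup m (main (D m) q)) = (\<lambda>q\<in>{..<N}. lookup m' (main (D m') q))"
      by auto
    have "lookup m (main (D m) q) = lookup m' (main (D m) q)" if "q < N" for q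
      using fun_cong[OF eq(2), of q] that eq(1) by simp
    then show "m = m'" using eq_by_main m eq(1) by blast
  qed
  have img: "?f ` ?A \<subseteq> ?B"
  proof
    fix z assume "z \<in> ?f ` ?A"
    then obtain m where m: "m \<in> ?A" "z = ?f m" by blast
    have "(\<lambda>q\<in>{..<N}. lookup m (main (D m) q)) \<in> {..<N} \<rightarrow>\<^sub>E {..t}"
      using le_trans[OF lookup_le_degree] m(1) by (intro restrict_PiE_iff[THEN iffD2]) auto
    then show "z \<in> ?B" using D_in m by auto
  qed
  have fin: "finite ?B" using finite_types by (intro finite_cartesian_product finite_PiE) auto
  show "finite ?A" using inj_on_finite[OF inj img fin] .
  have "card ?A \<le> card ?B" using card_inj_on_le[OF inj img fin] .
  then show "card ?A \<le> card types * Suc t ^ N"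
    by (simp add: card_cartesian_product card_PiE)
qed

end

lemma class_sum_nonzero: "class_sum r p l \<noteq> 0 \<Longrightarrow> \<exists>m\<in>keys p. r m = l"
  unfolding class_sum_def by (erule contrapos_np) (auto intro!: sum.neutral)

text \<open>The coordinates on \<open>U/V\<close> are the class sums at \<open>L\<close> alone. An
  element of \<open>U\<close> may have further nonzero class sums; \<open>V_iff\<close> says that
  those at \<open>L\<close> already detect membership in \<open>V\<close>. The finite set
  \<open>G\<close> serves to test annihilation of \<open>U/V\<close>.\<close>

locale colored_quotient = colored_monomials n N L D main req types
  for n N L and D :: "mon \<Rightarrow> 'd" and main req types +
  fixes U V :: "'k::field mpoly set" and r :: "mon \<Rightarrow> mon" and h :: "mon \<Rightarrow> 'k mpoly"
    and \<theta> :: "nat \<Rightarrow> 'k mpoly" and \<rho> :: "mon \<Rightarrow> 'o::wellorder" and G :: "'k mpoly set"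
  assumes U: "subring_type.ideal_of (polys n) U" and V: "subring_type.ideal_of (polys n) V" and VU: "V \<subseteq> U"
    and r_degree: "m \<in> monoms n \<Longrightarrow> monom_degree (r m) = monom_degree m"
    and V_iff: "u \<in> U \<Longrightarrow> u \<in> V \<longleftrightarrow> (\<forall>m\<in>L. class_sum r u m = 0)"
    and h_in: "m \<in> L \<Longrightarrow> h m \<in> U"
    and class_sum_h: "m \<in> L \<Longrightarrow> m' \<in> L \<Longrightarrow> class_sum r (h m) m' = (if m' = m then 1 else 0)"
    and \<theta>_in: "q < N \<Longrightarrow> \<theta> q \<in> polys n"
    and class_sum_sh: "m \<in> L \<Longrightarrow> q < N \<Longrightarrow> class_sum r (\<theta> q * h m) (sh q m) = 1"
    and class_sum_lower: "m \<in> L \<Longrightarrow> q < N \<Longrightarrow> m' \<in> L \<Longrightarrow> m' \<noteq> sh q m \<Longrightarrow>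
      class_sum r (\<theta> q * h m) m' \<noteq> 0 \<Longrightarrow> \<rho> m' < \<rho> (sh q m)"
    and \<rho>_sh: "m \<in> L \<Longrightarrow> m' \<in> L \<Longrightarrow> q < N \<Longrightarrow> \<rho> m < \<rho> m' \<Longrightarrow> \<rho> (sh q m) < \<rho> (sh q m')"
    and G: "finite G" "G \<subseteq> U" "s \<in> polys n \<Longrightarrow> (\<And>g. g \<in> G \<Longrightarrow> s * g \<in> V) \<Longrightarrow> s \<in> subring_type.colon (polys n) V U"
    and L_nonempty: "L \<noteq> {}"
begin

definition cf :: "'k mpoly \<Rightarrow> mon \<Rightarrow> 'k" where
  "cf u m = (if m \<in> L then class_sum r u m else 0)"

interpretation subalgebra_type "poly_ring n" "polys n" "const_poly :: 'k \<Rightarrow> _"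
  by (rule poly_subalgebra)

interpretation T: triangular_basis "poly_ring n" "polys n" "const_poly :: 'k \<Rightarrow> _"
  U V L cf h N \<theta> sh \<beta> base \<rho>
proof
  fix u v :: "'k mpoly" and k :: 'k and m m' p q
  show "finite {m. cf u m \<noteq> 0}"
    by (rule finite_subset[OF _ class_sum_finite[of r u]]) (auto simp: cf_def)
  show "ideal_of U" "ideal_of V" "V \<subseteq> U" by (fact U V VU)+
  show "cf (u + v) m = cf u m + cf v m" by (simp add: cf_def class_sum_add)
  show "cf (const_poly k * u) m = k * cf u m" by (simp add: cf_def class_sum_const_poly_mult)
  show "cf u m \<noteq> 0 \<Longrightarrow> m \<in> L" by (simp add: cf_def split: if_splits)
  show "u \<in> U \<Longrightarrow> (u \<in> V) = (\<forall>m. cf u m = 0)" using V_iff[of u] by (auto simp: cf_def)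
  show "q < N \<Longrightarrow> \<theta> q \<in> polys n" by (rule \<theta>_in)
  assume m: "m \<in> L"
  show "h m \<in> U" by (rule h_in[OF m])
  show "cf (h m) m' = (if m' = m then 1 else 0)" using class_sum_h[OF m, of m'] m by (auto simp: cf_def)
  show "base m \<in> L" by (rule base_in[OF m])
  show "(\<And>q. q < N \<Longrightarrow> \<beta> q m = 0) \<Longrightarrow> base m = m" by (rule base_id[OF m])
  assume q: "q < N"
  show "sh q m \<in> L" by (rule sh_in[OF m q])
  show "cf (\<theta> q * h m) (sh q m) = 1" using class_sum_sh[OF m q] sh_in[OF m q] by (simp add: cf_def)
  show "m' \<noteq> sh q m \<Longrightarrow> cf (\<theta> q * h m) m' \<noteq> 0 \<Longrightarrow> \<rho> m' < \<rho> (sh q m)"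
    using class_sum_lower[OF m q, of m'] by (simp add: cf_def split: if_splits)
  show "\<beta> q m > 0 \<Longrightarrow> \<exists>m'\<in>L. m = sh q m'" by (rule \<beta>_pos[OF m q])
  show "base (sh q m) = base m" by (rule base_sh[OF m q])
  show "\<beta> q (base m) = 0" by (rule \<beta>_base[OF m q])
  show "p < N \<Longrightarrow> \<beta> p (sh q m) = \<beta> p m + (if p = q then 1 else 0)" using \<beta>_sh[OF m _ q] .
  show "m' \<in> L \<Longrightarrow> sh q m = sh q m' \<Longrightarrow> m = m'" using sh_inj[OF m _ q] .
  show "m' \<in> L \<Longrightarrow> \<rho> m < \<rho> m' \<Longrightarrow> \<rho> (sh q m) < \<rho> (sh q m')" using \<rho>_sh[OF m _ q] .
qed

lemmas regular = T.regular_on_\<theta> and proper = T.foldl_\<theta>_proper[OF L_nonempty]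

text \<open>Normal forms keep the degree, so elements of degree at most \<open>t\<close> have
  coordinates only at members of \<open>L\<close> of degree at most \<open>t\<close>, whose number
  grows like a polynomial of degree \<open>N\<close>.\<close>

lemma dimension_bound:
  assumes "prime_chain (colon V U) k P"
  shows "k \<le> N"
proof (rule prime_chain_le_of_growth[OF U V VU, where cf = cf and
      F = "\<lambda>t. {p \<in> polys n. \<forall>m\<in>keys p. monom_degree m \<le> t}" and
      L = "\<lambda>t. {m \<in> L. monom_degree m \<le> t}" and C = "card types" and G = G])
  fix u t m assume u: "u \<in> U" "u \<in> {p \<in> polys n. \<forall>m\<in>keys p. monom_degree m \<le> t}" "cf u m \<noteq> 0"
  then have m: "m \<in> L" "class_sum r u m \<noteq> 0" by (auto simp: cf_def split: if_splits)
  then obtain m0 where "m0 \<in> keys u" "r m0 = m" using class_sum_nonzero by blast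
  then show "m \<in> {m \<in> L. monom_degree m \<le> t}" using u(2) r_degree[of m0] m by (auto simp: polys_def)
next
  fix s t and a b :: "'k mpoly"
  assume ab: "a \<in> {p \<in> polys n. \<forall>m\<in>keys p. monom_degree m \<le> s}" "b \<in> {p \<in> polys n. \<forall>m\<in>keys p. monom_degree m \<le> t}"
  have "monom_degree m \<le> s + t" if m: "m \<in> keys (a * b)" for m
  proof -
    obtain x y where "x \<in> keys a" "y \<in> keys b" "m = x + y" using subsetD[OF keys_mult m] by blast
    then show ?thesis using ab by (auto simp: monom_degree_add intro: add_mono)
  qed
  then show "a * b \<in> {p \<in> polys n. \<forall>m\<in>keys p. monom_degree m \<le> s + t}"
    using mult_in ab by blast
next
  fix a :: "'k mpoly" assume "a \<in> polys n"
  moreover have "monom_degree m \<le> Max (monom_degree ` keys a)" if "m \<in> keys a" for m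
    using that by simp
  ultimately show "\<exists>t. a \<in> {p \<in> polys n. \<forall>m\<in>keys p. monom_degree m \<le> t}" by blast
next
  fix t show "finite {m \<in> L. monom_degree m \<le> t}" by (rule finite_bounded_degree)
  show "card {m \<in> L. monom_degree m \<le> t} \<le> card types * Suc t ^ N" by (rule card_bounded_degree)
next
  show "(1 :: 'k mpoly) \<in> {p \<in> polys n. \<forall>m\<in>keys p. monom_degree m \<le> 0}"
    using one_in by (simp add: monom_degree_def)
next
  fix u v :: "'k mpoly" and k :: 'k and m
  show "cf (u + v) m = cf u m + cf v m" by (simp add: cf_def class_sum_add)
  show "cf (const_poly k * u) m = k * cf u m" by (simp add: cf_def class_sum_const_poly_mult)
next
  fix u assume "u \<in> U" "\<And>m. cf u m = 0"
  then show "u \<in> V" using T.cf_zero_iff by simp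
next
  fix s t :: nat and a :: "'k mpoly"
  assume "a \<in> {p \<in> polys n. \<forall>m\<in>keys p. monom_degree m \<le> s}" "s \<le> t"
  then show "a \<in> {p \<in> polys n. \<forall>m\<in>keys p. monom_degree m \<le> t}" using le_trans by blast
next
  show "finite G" "G \<subseteq> U" by (fact G)+
  show "s \<in> colon V U" if "s \<in> polys n" "\<And>g. g \<in> G \<Longrightarrow> s * g \<in> V" for s using G(3) that .
  show "prime_chain (colon V U) k P" by (rule assms)
qed

end

section \<open>The complete graph\<close>

lemma monom_degree_eq_sum_vertex_deg:
  assumes "m \<in> monoms n"
  shows "monom_degree m = (\<Sum>w\<in>{1..n}. vertex_deg m w)"
proof -
  have "monom_degree m = (\<Sum>x\<in>vars_upto n. lookup m x)"
    using assms by (intro monom_degree_eq_sum) (auto simp: monoms_def vars_upto_def)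
  also have "\<dots> = (\<Sum>x\<in>X ` {1..n}. lookup m x) + (\<Sum>x\<in>Y ` {1..n}. lookup m x)"
    unfolding vars_upto_def by (intro sum.union_disjoint) auto
  also have "\<dots> = (\<Sum>w\<in>{1..n}. lookup m (X w)) + (\<Sum>w\<in>{1..n}. lookup m (Y w))"
    by (simp add: sum.reindex inj_on_def)
  finally show ?thesis by (simp add: vertex_deg_def sum.distrib)
qed

lemma same_clique_degree:
  assumes "m \<in> monoms n" "m' \<in> monoms n" "vertex_deg m = vertex_deg m'"
  shows "monom_degree m = monom_degree m'"
  using assms by (simp add: monom_degree_eq_sum_vertex_deg)

text \<open>A \<open>Y\<close> at the last position precedes no \<open>X\<close>, so it is ignored;
  \<open>n - 1\<close> is the value when no earlier \<open>Y\<close> occurs.\<close>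

definition first_Y :: "nat \<Rightarrow> (nat \<Rightarrow> nat) \<Rightarrow> mon \<Rightarrow> nat" where
  "first_Y n v m = (if \<exists>q. Suc q < n \<and> ye v m q > 0 then LEAST q. Suc q < n \<and> ye v m q > 0 else n - 1)"

text \<open>Type \<open>j\<close> admits \<open>X\<close> up to position \<open>j\<close> and
  \<open>Y\<close> from \<open>j\<close> on, \<open>n + 1\<close> variables in all, numbered so that
  the one at \<open>q\<close> occurs in \<open>clique_theta n v q\<close>.\<close>

definition clique_var :: "(nat \<Rightarrow> nat) \<Rightarrow> nat \<Rightarrow> nat \<Rightarrow> var" where
  "clique_var v j q = (if j < q then Y (v (q - 1)) else X (v q))"

text \<open>The variable numbered \<open>Suc j\<close> is \<open>Y (v j)\<close>, whose presence
  identifies \<open>j\<close>. The last type requires nothing, so its origin is the monomial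
  1.\<close>

definition clique_req :: "nat \<Rightarrow> nat \<Rightarrow> nat \<Rightarrow> nat" where
  "clique_req n j q = (if q = Suc j \<and> Suc j < n then 1 else 0)"

lemma first_Y_Least:
  assumes "\<exists>q. Suc q < n \<and> ye v m q > 0"
  shows "Suc (first_Y n v m) < n \<and> ye v m (first_Y n v m) > 0"
  using LeastI_ex[OF assms] assms by (simp add: first_Y_def)

lemma first_Y_less: "n > 0 \<Longrightarrow> first_Y n v m < n"
  using first_Y_Least[of n v m] by (cases "\<exists>q. Suc q < n \<and> ye v m q > 0") (auto simp: first_Y_def)

lemma ye_before_first_Y: "q < first_Y n v m \<Longrightarrow> n > 0 \<Longrightarrow> ye v m q = 0"
proof (rule ccontr)
  assume q: "q < first_Y n v m" "n > 0" "ye v m q \<noteq> 0"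
  then have *: "Suc q < n \<and> ye v m q > 0" using first_Y_less[of n v m] by simp
  then have "first_Y n v m \<le> q" unfolding first_Y_def by (auto intro: Least_le)
  then show False using q by simp
qed

lemma ye_first_Y: "Suc (first_Y n v m) < n \<Longrightarrow> ye v m (first_Y n v m) > 0"
  using first_Y_Least[of n v m] by (cases "\<exists>q. Suc q < n \<and> ye v m q > 0") (auto simp: first_Y_def)

lemma first_Y_eqI:
  assumes "j < n" "\<And>q. q < j \<Longrightarrow> ye v m q = 0" "Suc j < n \<Longrightarrow> ye v m j > 0"
  shows "first_Y n v m = j"
proof (cases "Suc j < n")
  case True
  have "(LEAST q. Suc q < n \<and> ye v m q > 0) = j"
  proof (rule Least_equality)
    show "j \<le> q" if "Suc q < n \<and> ye v m q > 0" for q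
      using that assms(2)[of q] by (cases "q < j") auto
  qed (use True assms(3) in simp)
  then show ?thesis using True assms(3) by (auto simp: first_Y_def)
next
  case False
  then have n: "n = Suc j" using assms(1) by simp
  then have "\<not> (\<exists>q. Suc q < n \<and> ye v m q > 0)" using assms(2) by simp
  then show ?thesis using n unfolding first_Y_def by (simp only: if_False diff_Suc_1)
qed

lemma xe_after_first_Y:
  assumes "ordered n v m" "first_Y n v m < q" "q < n"
  shows "xe v m q = 0"
  using orderedD[OF assms(1) ye_first_Y assms(2,3)] assms by simp

lemma colored_complete:
  assumes v: "enum n v" and n: "n > 0"
  shows "colored_monomials n (Suc n) {m \<in> monoms n. ordered n v m} (first_Y n v) (clique_var v) (clique_req n) {..<n}"
proof
  show "finite {..<n}" by simp
  fix m assume "m \<in> {m \<in> monoms n. ordered n v m}"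
  then have m: "m \<in> monoms n" "ordered n v m" by auto
  let ?j = "first_Y n v m"
  have j: "?j < n" using first_Y_less n by blast
  show "first_Y n v m \<in> {..<n}" using j by simp
  show "inj_on (clique_var v ?j) {..<Suc n}"
    using j by (auto simp: inj_on_def clique_var_def enum_inj[OF v])
  show "keys m \<subseteq> clique_var v ?j ` {..<Suc n}"
  proof
    fix x assume x: "x \<in> keys m"
    then have "x \<in> vars_upto n" using m by (auto simp: monoms_def)
    then obtain w where w: "w \<in> {1..n}" "x = X w \<or> x = Y w" by (auto simp: vars_upto_def)
    then obtain q where q: "q < n" "w = v q" using enum_surj v by blast
    from w(2) show "x \<in> clique_var v ?j ` {..<Suc n}"
    proof
      assume x': "x = X w"
      then have "xe v m q \<noteq> 0" using x q by (simp add: xe_def in_keys_iff)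
      then have "q \<le> ?j" using xe_after_first_Y[OF m(2)] q by (meson not_le)
      then show ?thesis using q x' by (intro image_eqI[of _ _ q]) (auto simp: clique_var_def)
    next
      assume x': "x = Y w"
      then have "ye v m q \<noteq> 0" using x q by (simp add: ye_def in_keys_iff)
      then have "?j \<le> q" using ye_before_first_Y n by (meson not_le)
      then show ?thesis using q x' by (intro image_eqI[of _ _ "Suc q"]) (auto simp: clique_var_def)
    qed
  qed
  show "clique_req n ?j q \<le> lookup m (clique_var v ?j q)" for q
    using ye_first_Y[of n v m] by (auto simp: clique_req_def clique_var_def ye_def)
  show "clique_var v ?j q \<in> vars_upto n" if "q < Suc n" for q
    using that j enum_in[OF v, of "q - 1"] enum_in[OF v, of q] by (auto simp: clique_var_def vars_upto_def)
  fix m' assume m': "m' \<in> monoms n" "keys m' \<subseteq> clique_var v ?j ` {..<Suc n}"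
    "\<And>q. q < Suc n \<Longrightarrow> clique_req n ?j q \<le> lookup m' (clique_var v ?j q)"
  have X0: "xe v m' q = 0" if q: "?j < q" "q < n" for q
  proof -
    have "X (v q) \<notin> clique_var v ?j ` {..<Suc n}"
    proof
      assume "X (v q) \<in> clique_var v ?j ` {..<Suc n}"
      then obtain x where "\<not> ?j < x" "v q = v x" by (auto simp: clique_var_def split: if_splits)
      then show False using enum_inj[OF v, of q x] q j by simp
    qed
    then show ?thesis using m'(2) by (auto simp: xe_def in_keys_iff)
  qed
  have Y0: "ye v m' q = 0" if q: "q < ?j" for q
  proof -
    have "Y (v q) \<notin> clique_var v ?j ` {..<Suc n}"
    proof
      assume "Y (v q) \<in> clique_var v ?j ` {..<Suc n}"
      then obtain x where "x < Suc n" "?j < x" "v q = v (x - 1)" by (auto simp: clique_var_def split: if_splits)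
      then show False using enum_inj[OF v, of q "x - 1"] q j by simp
    qed
    then show ?thesis using m'(2) by (auto simp: ye_def in_keys_iff)
  qed
  have Yj: "ye v m' ?j > 0" if "Suc ?j < n"
    using m'(3)[of "Suc ?j"] that by (simp add: clique_req_def clique_var_def ye_def)
  have "ordered n v m'"
    unfolding ordered_def using X0 Y0 by (metis less_trans linorder_neqE_nat)
  then show "m' \<in> {m \<in> monoms n. ordered n v m} \<and> first_Y n v m' = ?j"
    using first_Y_eqI[OF j Y0 Yj] m'(1) by simp
qed auto

definition clique_theta :: "nat \<Rightarrow> (nat \<Rightarrow> nat) \<Rightarrow> nat \<Rightarrow> 'k::field mpoly" where
  "clique_theta n v q = (if q > 0 then mvar (Y (v (q - 1))) else 0) + (if q < n then mvar (X (v q)) else 0)"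

text \<open>The unchosen product has the same weight as the chosen one. Either its reduction is
  lighter, or it is ordered already; the latter happens only for a \<open>Y\<close> placed before
  the first one, which lowers the second component of the rank.\<close>

lemma colored_quotient_complete:
  assumes v: "enum n v" and n: "n > 0"
  shows "colored_quotient n (Suc n) {m \<in> monoms n. ordered n v m} (first_Y n v) (clique_var v) (clique_req n) {..<n}
    (polys n) (binomial_edge_ideal n (complete_edges n) :: 'k::field mpoly set) (ordered_form n v) monomial
    (clique_theta n v) (\<lambda>m. (weight n v m, first_Y n v m)) {1}"
proof -
  let ?L = "{m \<in> monoms n. ordered n v m}"
  let ?J = "binomial_edge_ideal n (complete_edges n) :: 'k mpoly set"
  let ?\<rho> = "\<lambda>m. (weight n v m, first_Y n v m)"
  interpret colored_monomials n "Suc n" ?L "first_Y n v" "clique_var v" "clique_req n" "{..<n}"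
    using colored_complete[OF assms] .
  interpret subalgebra_type "poly_ring n" "polys n" "const_poly :: 'k \<Rightarrow> _"
    by (rule poly_subalgebra)
  note of = ordered_form[OF v]
  have of_id: "ordered_form n v m = m" if "m \<in> ?L" for m
    using that by (intro ordered_form_eq[OF v]) (auto simp: same_clique_def)
  have sh_eq: "sh q m = (if first_Y n v m < q then m + mY (v (q - 1)) else m + mX (v q))" for q m
    by (simp add: sh_def clique_var_def mX_def mY_def)
  have weight_sh: "weight n v (sh q m) = weight n v m + wt n q" if "q < Suc n" for q m
    using that first_Y_less[OF n, of v m] by (simp add: sh_eq weight_mX[OF v] weight_mY[OF v])
  have \<theta>_mult: "class_sum r (clique_theta n v q * monomial m) l =
      (if q > 0 \<and> r (m + mY (v (q - 1))) = l then 1 else 0) + (if q < n \<and> r (m + mX (v q)) = l then 1 else (0 :: 'k))"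
    for r q m l
    by (simp add: clique_theta_def mvar_X mvar_Y distrib_right mult_single class_sum_add class_sum_single add.commute)
  have other: "?\<rho> (ordered_form n v a) < ?\<rho> (sh q m)"
    if m: "m \<in> ?L" and q: "q < Suc n"
      and a: "first_Y n v m < q \<and> q < n \<and> a = m + mX (v q) \<or> q \<le> first_Y n v m \<and> 0 < q \<and> a = m + mY (v (q - 1))" for m q a
  proof -
    let ?j = "first_Y n v m"
    have j: "?j < n" using first_Y_less[OF n] .
    have aM: "a \<in> monoms n"
      using a m j q enum_in[OF v, of q] enum_in[OF v, of "q - 1"] by (auto simp: add_in_monoms_iff mX_in mY_in)
    have wa: "weight n v a = weight n v (sh q m)"
      using a j unfolding weight_sh[OF q] by (auto simp: weight_mX[OF v] weight_mY[OF v])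
    show ?thesis
    proof (cases "ordered_form n v a = a")
      case False
      then show ?thesis using of(5)[OF aM] wa by (simp add: less_prod_def)
    next
      case True
      then have ord: "ordered n v a" using of(2)[OF aM] by simp
      from a show ?thesis
      proof
        assume *: "?j < q \<and> q < n \<and> a = m + mX (v q)"
        then have "ye v a ?j > 0" using ye_first_Y[of n v m] by simp
        moreover have "xe v a q > 0" using * by (simp add: xe_mX)
        ultimately show ?thesis using orderedD[OF ord, of ?j q] * by simp
      next
        assume *: "q \<le> ?j \<and> 0 < q \<and> a = m + mY (v (q - 1))"
        then have "ye v a (q - 1) > 0" by (simp add: ye_mY)
        then have "first_Y n v a \<le> q - 1" using ye_before_first_Y[of "q - 1" n v a] n by (cases "q - 1 < first_Y n v a") auto
        then have "first_Y n v a < first_Y n v (sh q m)" using * D_sh[OF m q] by linarith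
        then show ?thesis using True wa by (simp add: less_prod_def)
      qed
    qed
  qed
  have prod: "class_sum (ordered_form n v) (clique_theta n v q * monomial m) l =
      (if sh q m = l then 1 else 0) + (if (first_Y n v m < q \<and> q < n \<and> ordered_form n v (m + mX (v q)) = l \<or>
        q \<le> first_Y n v m \<and> 0 < q \<and> ordered_form n v (m + mY (v (q - 1))) = l) then 1 else (0 :: 'k))"
    if m: "m \<in> ?L" and q: "q < Suc n" for m q l
  proof (cases "first_Y n v m < q")
    case True
    then have "sh q m = m + mY (v (q - 1))" by (simp add: sh_eq)
    then show ?thesis unfolding \<theta>_mult using of_id[OF sh_in[OF m q]] True by simp
  next
    case False
    then have "sh q m = m + mX (v q)" "q < n" using first_Y_less[OF n, of v m] by (simp_all add: sh_eq)
    then show ?thesis unfolding \<theta>_mult using of_id[OF sh_in[OF m q]] False by (simp add: add.commute)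
  qed
  show ?thesis
  proof
    show "ideal_of (polys n)" by (rule ideal_of_S)
    show "ideal_of ?J" by (rule ideal_edge_ideal)
    show "?J \<subseteq> polys n" using ideal_ofD(1)[OF ideal_edge_ideal] by blast
    show "monom_degree (ordered_form n v m) = monom_degree m" if "m \<in> monoms n" for m
      using of(1,3)[OF that] that by (intro same_clique_degree[of _ n]) (simp_all add: same_clique_def)
    show "u \<in> ?J \<longleftrightarrow> (\<forall>m\<in>?L. class_sum (ordered_form n v) u m = 0)" if u: "u \<in> polys n" for u
    proof -
      have "class_sum (ordered_form n v) u l = 0" if "l \<notin> ?L" for l
      proof (rule ccontr)
        assume "class_sum (ordered_form n v) u l \<noteq> 0"
        then obtain m where "m \<in> keys u" "ordered_form n v m = l" using class_sum_nonzero by blast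
        then show False using of(1,2)[of m] u that by (auto simp: polys_def)
      qed
      then show ?thesis unfolding complete_ideal_iff[OF v u] by blast
    qed
    show "monomial m \<in> (polys n :: 'k mpoly set)" if "m \<in> ?L" for m using that by (simp add: polys_def)
    show "class_sum (ordered_form n v) (monomial m) m' = (if m' = m then 1 else (0 :: 'k))" if "m \<in> ?L" for m m'
      using of_id[OF that] by (simp add: class_sum_single)
    show "clique_theta n v q \<in> (polys n :: 'k mpoly set)" if "q < Suc n" for q
      using that n enum_in[OF v, of q] enum_in[OF v, of "q - 1"]
      by (auto simp: clique_theta_def intro!: add_in mvar_in)
    fix m q assume m: "m \<in> ?L" and q: "q < Suc n"
    have ne: "?\<rho> (sh q m) \<noteq> ?\<rho> (ordered_form n v a)"
      if "first_Y n v m < q \<and> q < n \<and> a = m + mX (v q) \<or> q \<le> first_Y n v m \<and> 0 < q \<and> a = m + mY (v (q - 1))" for a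
      using other[OF m q that] by auto
    show "class_sum (ordered_form n v) (clique_theta n v q * monomial m) (sh q m) = (1 :: 'k)"
      unfolding prod[OF m q] using ne by auto
    show "?\<rho> m' < ?\<rho> (sh q m)" if "m' \<noteq> sh q m"
      "class_sum (ordered_form n v) (clique_theta n v q * monomial m) m' \<noteq> (0 :: 'k)" for m'
      using that other[OF m q] unfolding prod[OF m q] by (auto split: if_splits)
    show "?\<rho> (sh q m) < ?\<rho> (sh q m')" if "m' \<in> ?L" "?\<rho> m < ?\<rho> m'" for m'
      using that q D_sh[OF m q] D_sh[OF that(1) q] by (auto simp: less_prod_def weight_sh)
  next
    show "s \<in> colon ?J (polys n)" if "s \<in> polys n" "\<And>g. g \<in> {1} \<Longrightarrow> s * g \<in> ?J" for s
    proof -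
      have "u * s \<in> ?J" if "u \<in> polys n" for u
        using ideal_ofD(4)[OF ideal_edge_ideal that, of s "complete_edges n"] \<open>\<And>g. g \<in> {1} \<Longrightarrow> s * g \<in> ?J\<close> by simp
      then show ?thesis using that(1) by (simp add: colon_def mult.commute)
    qed
    show "{1} \<subseteq> (polys n :: 'k mpoly set)" by auto
    have "0 \<in> ?L" by (simp add: ordered_def ye_def)
    then show "?L \<noteq> {}" by blast
  qed simp
qed

section \<open>Normal forms modulo the ideal of a cycle\<close>

text \<open>Normalization in two stages: each fibre of the coarser map \<open>s\<close> is a union
  of fibres of \<open>r\<close>.\<close>

lemma class_sum_compose:
  assumes "\<And>m. m \<in> keys p \<Longrightarrow> s (r m) = s m"
  shows "class_sum s p l = (\<Sum>l'\<in>{l' \<in> r ` keys p. s l' = l}. class_sum r p l')"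
proof -
  let ?A = "{l' \<in> r ` keys p. s l' = l}"
  have fin: "finite ?A" by simp
  have "(\<Sum>l'\<in>?A. class_sum r p l') = (\<Sum>m\<in>keys p. \<Sum>l'\<in>?A. if r m = l' then lookup p m else 0)"
    unfolding class_sum_def by (rule sum.swap)
  also have "\<dots> = (\<Sum>m\<in>keys p. if r m \<in> ?A then lookup p m else 0)"
    using fin by (intro sum.cong) auto
  also have "\<dots> = class_sum s p l"
    unfolding class_sum_def using assms by (intro sum.cong) auto
  finally show ?thesis by simp
qed

lemma ordered_imp_locally_ordered: "ordered n v m \<Longrightarrow> locally_ordered n v m"
  by (simp add: ordered_def locally_ordered_def)

lemma locally_orderedD: "locally_ordered n v m \<Longrightarrow> Suc q < n \<Longrightarrow> ye v m q > 0 \<Longrightarrow> xe v m (Suc q) = 0"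
  unfolding locally_ordered_def by (metis less_irrefl)

text \<open>At a vertex that is present, absence of \<open>X\<close> means presence of
  \<open>Y\<close>, which excludes \<open>X\<close> at the next position. Local order thus
  propagates up to the next missing vertex.\<close>

lemma locally_ordered_run:
  assumes "locally_ordered n v m" "ye v m q > 0" "q < p" "p < n"
    "\<And>x. q < x \<Longrightarrow> x < p \<Longrightarrow> vertex_deg m (v x) > 0"
  shows "xe v m p = 0"
proof -
  have "xe v m (q + Suc d) = 0" if "q + Suc d \<le> p" for d
    using that
  proof (induction d)
    case 0
    then show ?case using locally_orderedD[OF assms(1), of q] assms(2,4) by simp
  next
    case (Suc d)
    then have "vertex_deg m (v (q + Suc d)) > 0" "xe v m (q + Suc d) = 0"
      using assms(5)[of "q + Suc d"] by auto
    then have "ye v m (q + Suc d) > 0" by (simp add: vertex_deg_enum)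
    then show ?case using locally_orderedD[OF assms(1), of "q + Suc d"] Suc.prems assms(4) by simp
  qed
  from this[of "p - Suc q"] show ?thesis using assms(3) by simp
qed

section \<open>The cycle read from an arbitrary starting index\<close>

locale cycle =
  fixes n :: nat and c :: "nat \<Rightarrow> nat"
  assumes n: "n \<ge> 4" and c: "bij_betw c {..<n} {1..n}"
begin

definition cycle_edges :: "nat set set" where
  "cycle_edges = {{c i, c (Suc i mod n)} | i. i < n}"

definition cyc :: "nat \<Rightarrow> nat \<Rightarrow> nat" where
  "cyc l q = c ((l + q) mod n)"

lemma n_pos: "n > 0" using n by simp

lemma enum_cyc:
  assumes "l < n"
  shows "enum n (cyc l)"
proof -
  let ?f = "\<lambda>q. (l + q) mod n"
  have f: "?f q = (if l + q < n then l + q else l + q - n)" if "q < n" for q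
    using that assms by (simp add: mod_if)
  have inj: "inj_on ?f {..<n}" by (rule inj_onI) (use f assms in \<open>auto split: if_splits\<close>)
  have "?f ` {..<n} \<subseteq> {..<n}" using n by auto
  then have "bij_betw ?f {..<n} {..<n}"
    using inj endo_inj_surj[of "{..<n}" ?f] by (simp add: bij_betw_def)
  then have "bij_betw (c \<circ> ?f) {..<n} {1..n}" using c by (rule bij_betw_trans)
  then show ?thesis by (simp add: enum_def cyc_def[abs_def] comp_def)
qed

lemma cyc_0: "l < n \<Longrightarrow> cyc l 0 = c l"
  by (simp add: cyc_def)

lemma cyc_n: "l < n \<Longrightarrow> cyc l n = cyc l 0"
  by (simp add: cyc_def)

lemma cyc_Suc_index: "cyc l q = c i \<Longrightarrow> i < n \<Longrightarrow> q < n \<Longrightarrow> l < n \<Longrightarrow> cyc l (Suc q) = c (Suc i mod n)"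
proof -
  assume a: "cyc l q = c i" "i < n" "q < n" "l < n"
  then have "(l + q) mod n = i"
    using c n_pos unfolding cyc_def bij_betw_def by (metis inj_onD lessThan_iff mod_less_divisor)
  then show ?thesis unfolding cyc_def by (metis add_Suc_right mod_Suc_eq)
qed

lemma edge_cyc_Suc:
  assumes "l < n" "Suc q < n"
  shows "{cyc l q, cyc l (Suc q)} \<in> cycle_edges"
proof -
  have "cyc l (Suc q) = c (Suc ((l + q) mod n) mod n)" by (simp add: cyc_def mod_Suc_eq)
  moreover have "cyc l q = c ((l + q) mod n)" by (simp add: cyc_def)
  moreover have "(l + q) mod n < n" using n_pos by simp
  ultimately show ?thesis
    unfolding cycle_edges_def by (intro CollectI exI[of _ "(l + q) mod n"]) simp
qed

lemma cycle_edge_positions: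
  assumes l: "l < n" and pq: "p < n" "q < n" and E: "{cyc l p, cyc l q} \<in> cycle_edges"
  shows "q = Suc p \<or> p = Suc q \<or> p = 0 \<and> Suc q = n \<or> q = 0 \<and> Suc p = n"
proof -
  note enum = enum_inj[OF enum_cyc[OF l]]
  have *: "q = Suc p \<or> q = 0 \<and> Suc p = n"
    if H: "cyc l p = c i" "cyc l q = c (Suc i mod n)" "i < n" "p < n" "q < n" for p q i
  proof -
    have eq: "cyc l q = cyc l (Suc p)" unfolding H(2) by (rule cyc_Suc_index[OF H(1,3,4) l, symmetric])
    show ?thesis
    proof (cases "Suc p = n")
      case True
      have "cyc l q = cyc l 0" unfolding eq True by (rule cyc_n[OF l])
      then have "q = 0" using enum[OF H(5) n_pos] by blast
      then show ?thesis using True by blast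
    next
      case False
      then have "Suc p < n" using H(4) by simp
      then have "q = Suc p" using enum[OF H(5)] eq by blast
      then show ?thesis by blast
    qed
  qed
  obtain i where i: "i < n" "{cyc l p, cyc l q} = {c i, c (Suc i mod n)}"
    using E unfolding cycle_edges_def by blast
  then consider "cyc l p = c i \<and> cyc l q = c (Suc i mod n)" | "cyc l q = c i \<and> cyc l p = c (Suc i mod n)"
    by (auto simp: doubleton_eq_iff)
  then show ?thesis
  proof cases
    case 1
    then show ?thesis using *[of p i q] i(1) pq by blast
  next
    case 2
    then show ?thesis using *[of q i p] i(1) pq by blast
  qed
qed

lemma cycle_edges_complete: "cycle_edges \<subseteq> complete_edges n"
proof
  fix e assume "e \<in> cycle_edges"
  then obtain i where i: "i < n" "e = {c i, c (Suc i mod n)}" unfolding cycle_edges_def by blast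
  have lt: "Suc i mod n < n" using n_pos by simp
  have "Suc i mod n \<noteq> i" using i(1) n by (cases "Suc i = n") auto
  then have "c i \<noteq> c (Suc i mod n)" using c i(1) lt by (auto simp: bij_betw_def inj_on_def)
  moreover have "c i \<in> {1..n}" "c (Suc i mod n) \<in> {1..n}" using c i(1) lt by (auto simp: bij_betw_def)
  ultimately show "e \<in> complete_edges n" unfolding complete_edges_def i(2) by blast
qed

text \<open>The order on the vertices depends on the support: it starts at the last vertex missing from the
  support, so that no component of the support is cut.\<close>

definition gap :: "mon \<Rightarrow> nat \<Rightarrow> bool" where
  "gap m i \<longleftrightarrow> i < n \<and> vertex_deg m (c i) = 0"

definition start :: "mon \<Rightarrow> nat" where
  "start m = (if \<exists>i. gap m i then Max {i. gap m i} else 0)"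

abbreviation ord :: "mon \<Rightarrow> nat \<Rightarrow> nat" where
  "ord m \<equiv> cyc (start m)"

lemma finite_gaps: "finite {i. gap m i}"
  by (rule finite_subset[of _ "{..<n}"]) (auto simp: gap_def)

lemma gap_start: "\<exists>i. gap m i \<Longrightarrow> gap m (start m)"
  using Max_in[OF finite_gaps, of m] by (auto simp: start_def)

lemma gap_le_start: "gap m i \<Longrightarrow> i \<le> start m"
  using Max_ge[OF finite_gaps, of i m] by (auto simp: start_def)

lemma start_less: "start m < n"
proof (cases "\<exists>i. gap m i")
  case True
  then show ?thesis using gap_start[OF True] by (simp add: gap_def)
qed (use n_pos in \<open>simp add: start_def\<close>)

lemma start_eqI: "gap m l \<Longrightarrow> (\<And>i. gap m i \<Longrightarrow> i \<le> l) \<Longrightarrow> start m = l"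
  using gap_start[of m] gap_le_start[of m l] by (metis le_antisym)

lemma start_cong: "vertex_deg m = vertex_deg m' \<Longrightarrow> start m = start m'"
proof -
  assume "vertex_deg m = vertex_deg m'"
  then have "gap m = gap m'" by (simp add: gap_def fun_eq_iff)
  then show ?thesis by (simp add: start_def)
qed

lemma enum_ord: "enum n (ord m)"
  using enum_cyc[OF start_less] .

lemma vertex_deg_ord_0: "\<exists>i. gap m i \<Longrightarrow> vertex_deg m (ord m 0) = 0"
  using gap_start[of m] by (simp add: gap_def cyc_0)

text \<open>The invariants of swaps along edges. Prefix sums at the missing positions amount to the
  number of \<open>X\<close> in each path into which the missing vertices cut the cycle; with full
  support only the total number remains.\<close>

definition same_path :: "mon \<Rightarrow> mon \<Rightarrow> bool" where
  "same_path m m' \<longleftrightarrow> vertex_deg m = vertex_deg m' \<and>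
    (\<forall>g\<le>n. g = n \<or> vertex_deg m (ord m g) = 0 \<longrightarrow> (\<Sum>q<g. xe (ord m) m q) = (\<Sum>q<g. xe (ord m) m' q))"

lemma same_path_refl: "same_path m m"
  by (simp add: same_path_def)

lemma same_path_sym: "same_path m m' \<Longrightarrow> same_path m' m"
  using start_cong[of m m'] by (auto simp: same_path_def)

lemma same_path_trans: "same_path a b \<Longrightarrow> same_path b d \<Longrightarrow> same_path a d"
  using start_cong[of a b] by (auto simp: same_path_def)

lemma same_path_same_clique: "same_path m m' \<Longrightarrow> same_clique n m m'"
  unfolding same_path_def same_clique_def sum_enum[OF enum_ord[of m], symmetric] by blast

lemma sum_xe_swap:
  assumes "enum n v" "p < n" "g \<le> n"
  shows "(\<Sum>x<g. xe v (t + mX (v p) + mY w) x) = (\<Sum>x<g. xe v t x) + (if p < g then 1 else 0)"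
proof -
  have "(\<Sum>x<g. xe v (t + mX (v p) + mY w) x) = (\<Sum>x<g. xe v t x + (if x = p then 1 else 0))"
    by (rule sum.cong) (use assms in \<open>auto simp: xe_mX enum_inj\<close>)
  then show ?thesis by (simp add: sum.distrib)
qed

text \<open>Both ends of the swapped edge are present. If some vertex is missing, position
  \<open>0\<close> is, so the edge is not the closing one and no checkpoint separates its
  ends.\<close>

lemma same_path_swap:
  assumes ij: "i \<in> {1..n}" "j \<in> {1..n}" "{i, j} \<in> cycle_edges"
  shows "same_path (t + mX i + mY j) (t + mX j + mY i)"
proof -
  let ?m = "t + mX i + mY j" and ?m' = "t + mX j + mY i"
  let ?v = "ord ?m"
  note v = enum_ord[of ?m]
  obtain p q where pq: "p < n" "i = ?v p" "q < n" "j = ?v q" using enum_surj[OF v] ij by metis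
  have tot: "vertex_deg ?m (?v p) > 0" "vertex_deg ?m (?v q) > 0"
    using pq by (simp_all add: vertex_deg_add vertex_deg_mX vertex_deg_mY)
  have adj: "q = Suc p \<or> p = Suc q \<or> p = 0 \<and> Suc q = n \<or> q = 0 \<and> Suc p = n"
    using cycle_edge_positions[OF start_less[of ?m] pq(1,3)] ij(3) pq by simp
  have "vertex_deg ?m = vertex_deg ?m'" by (rule ext) (simp add: vertex_deg_add vertex_deg_mX vertex_deg_mY)
  moreover have "(\<Sum>x<g. xe ?v ?m x) = (\<Sum>x<g. xe ?v ?m' x)" if g: "g \<le> n" "g = n \<or> vertex_deg ?m (?v g) = 0" for g
  proof -
    have "p < g \<longleftrightarrow> q < g"
    proof (cases "g = n")
      case True then show ?thesis using pq by simp
    next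
      case False
      then have g': "g < n" "vertex_deg ?m (?v g) = 0" using g by auto
      then have "g \<noteq> p" "g \<noteq> q" using tot by auto
      have "\<exists>i. gap ?m i"
      proof -
        have "(start ?m + g) mod n < n" using n_pos by simp
        then show ?thesis using g' unfolding gap_def cyc_def by blast
      qed
      then have "vertex_deg ?m (?v 0) = 0" by (rule vertex_deg_ord_0)
      then have "p \<noteq> 0" "q \<noteq> 0" using tot by (metis less_irrefl)+
      then show ?thesis using adj \<open>g \<noteq> p\<close> \<open>g \<noteq> q\<close> by auto
    qed
    moreover have "(\<Sum>x<g. xe ?v ?m x) = (\<Sum>x<g. xe ?v t x) + (if p < g then 1 else 0)"
      using sum_xe_swap[OF v pq(1) g(1), of t j] pq by simp
    moreover have "(\<Sum>x<g. xe ?v ?m' x) = (\<Sum>x<g. xe ?v t x) + (if q < g then 1 else 0)"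
      using sum_xe_swap[OF v pq(3) g(1), of t i] pq by simp
    ultimately show ?thesis by simp
  qed
  ultimately show ?thesis by (simp add: same_path_def)
qed

text \<open>The checkpoint after a \<open>Y\<close> is the next missing position, or
  \<open>n\<close> if there is none; before it the run of present vertices contains no further
  \<open>X\<close>.\<close>

lemma locally_ordered_checkpoints:
  assumes "locally_ordered n (ord m) m" "same_path m m'"
  shows "checkpoints n (ord m) m m'"
  unfolding checkpoints_def
proof (intro allI impI)
  fix q assume q: "q < n" "ye (ord m) m q > 0"
  define g where "g = (LEAST g. q < g \<and> (g = n \<or> vertex_deg m (ord m g) = 0))"
  have ex: "q < n \<and> (n = n \<or> vertex_deg m (ord m n) = 0)" using q by simp
  have g: "q < g \<and> (g = n \<or> vertex_deg m (ord m g) = 0)"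
    unfolding g_def by (rule LeastI[where P = "\<lambda>g. q < g \<and> (g = n \<or> vertex_deg m (ord m g) = 0)", OF ex])
  have gn: "g \<le> n"
    unfolding g_def by (rule Least_le[where P = "\<lambda>g. q < g \<and> (g = n \<or> vertex_deg m (ord m g) = 0)", OF ex])
  have "xe (ord m) m p = 0" if p: "q < p" "p < g" for p
  proof (rule locally_ordered_run[OF assms(1) q(2) p(1)])
    show "p < n" using p gn by simp
    show "vertex_deg m (ord m x) > 0" if "q < x" "x < p" for x
    proof -
      have "\<not> (q < x \<and> (x = n \<or> vertex_deg m (ord m x) = 0))"
        using not_less_Least[of x "\<lambda>g. q < g \<and> (g = n \<or> vertex_deg m (ord m g) = 0)"] that p by (simp add: g_def)
      then show ?thesis using that by simp
    qed
  qed
  moreover have "(\<Sum>p<g. xe (ord m) m p) = (\<Sum>p<g. xe (ord m) m' p)"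
    using assms(2) g gn unfolding same_path_def by blast
  ultimately show "\<exists>g>q. g \<le> n \<and> (\<forall>p. q < p \<and> p < g \<longrightarrow> xe (ord m) m p = 0) \<and>
      (\<Sum>p<g. xe (ord m) m p) = (\<Sum>p<g. xe (ord m) m' p)"
    using g gn by blast
qed

lemma locally_ordered_unique:
  assumes "m \<in> monoms n" "m' \<in> monoms n" "same_path m m'"
    "locally_ordered n (ord m) m" "locally_ordered n (ord m') m'"
  shows "m = m'"
proof (rule monom_unique[OF enum_ord assms(1,2)])
  have eq: "ord m' = ord m" using assms(3) start_cong[of m m'] by (simp add: same_path_def)
  show "xe (ord m) m q + ye (ord m) m q = xe (ord m) m' q + ye (ord m) m' q" for q
    using assms(3) by (simp add: same_path_def flip: vertex_deg_enum)
  show "checkpoints n (ord m) m m'" using locally_ordered_checkpoints assms by blast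
  show "checkpoints n (ord m) m' m"
    using locally_ordered_checkpoints[OF assms(5) same_path_sym[OF assms(3)]] eq by simp
qed

definition path_form :: "mon \<Rightarrow> mon" where
  "path_form m = (THE m'. m' \<in> monoms n \<and> locally_ordered n (ord m) m' \<and> same_path m m')"

lemma path_form_eq:
  assumes "m' \<in> monoms n" "locally_ordered n (ord m) m'" "same_path m m'"
  shows "path_form m = m'"
  unfolding path_form_def
proof (rule the_equality)
  have ord: "ord a = ord m" if "same_path m a" for a
    using start_cong[of m a] that by (simp add: same_path_def)
  fix a assume a: "a \<in> monoms n \<and> locally_ordered n (ord m) a \<and> same_path m a"
  then have "same_path a m'" using same_path_trans[OF same_path_sym assms(3)] by blast
  then show "a = m'" using locally_ordered_unique[of a m'] a assms ord[of a] ord[of m'] by simp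
qed (use assms in blast)

lemma path_form:
  assumes m: "m \<in> monoms n"
  shows "path_form m \<in> monoms n" "locally_ordered n (ord m) (path_form m)" "same_path m (path_form m)"
    "monomial m - monomial (path_form m) \<in> (binomial_edge_ideal n cycle_edges :: 'k::field mpoly set)"
    "path_form m = m \<or> weight n (ord m) (path_form m) < weight n (ord m) m"
proof -
  let ?A = "{(p, q). q = Suc p \<and> q < n}"
  note v = enum_ord[of m]
  have "\<exists>m'\<in>monoms n. same_path m m' \<and> (\<forall>(p, q)\<in>?A. ye (ord m) m' p = 0 \<or> xe (ord m) m' q = 0) \<and>
    monomial m - monomial m' \<in> (binomial_edge_ideal n cycle_edges :: 'k mpoly set) \<and>
    (m' = m \<or> weight n (ord m) m' < weight n (ord m) m)"
  proof (rule exists_normal_form[OF v _ same_path_refl same_path_trans _ m])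
    show "p < q \<and> q < n \<and> {ord m p, ord m q} \<in> cycle_edges" if "(p, q) \<in> ?A" for p q
      using that edge_cyc_Suc[OF start_less] by auto
    show "same_path (t + mX (ord m q) + mY (ord m p)) (t + mX (ord m p) + mY (ord m q))"
      if "(p, q) \<in> ?A" for t p q
    proof -
      have "p < n" "q < n" "{ord m q, ord m p} \<in> cycle_edges"
        using that edge_cyc_Suc[OF start_less] by (auto simp: insert_commute)
      then show ?thesis using enum_in[OF v] by (intro same_path_swap) auto
    qed
  qed
  then obtain m' where m': "m' \<in> monoms n" "same_path m m'"
    "\<forall>(p, q)\<in>?A. ye (ord m) m' p = 0 \<or> xe (ord m) m' q = 0"
    "monomial m - monomial m' \<in> (binomial_edge_ideal n cycle_edges :: 'k mpoly set)"
    "m' = m \<or> weight n (ord m) m' < weight n (ord m) m"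
    by blast
  then have "locally_ordered n (ord m) m'" by (auto simp: locally_ordered_def)
  note m' = m' this
  have "path_form m = m'" using path_form_eq m' by blast
  then show "path_form m \<in> monoms n" "locally_ordered n (ord m) (path_form m)" "same_path m (path_form m)"
    "monomial m - monomial (path_form m) \<in> (binomial_edge_ideal n cycle_edges :: 'k::field mpoly set)"
    "path_form m = m \<or> weight n (ord m) (path_form m) < weight n (ord m) m"
    using m' by auto
qed

lemma start_path_form: "m \<in> monoms n \<Longrightarrow> start (path_form m) = start m"
  using path_form(3)[of m] start_cong[of m "path_form m"] by (simp add: same_path_def)

lemma path_form_id: "m \<in> monoms n \<Longrightarrow> locally_ordered n (ord m) m \<Longrightarrow> path_form m = m"
  using path_form_eq same_path_refl by blast

lemma cycle_ideal_iff:
  assumes p: "p \<in> (polys n :: 'k::field mpoly set)"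
  shows "p \<in> binomial_edge_ideal n cycle_edges \<longleftrightarrow> (\<forall>l. class_sum path_form p l = 0)"
proof (rule edge_ideal_iff[OF _ _ p])
  show "monomial m - monomial (path_form m) \<in> (binomial_edge_ideal n cycle_edges :: 'k mpoly set)"
    if "m \<in> monoms n" for m using path_form(4)[OF that] .
  fix t i j assume t: "t \<in> monoms n" "i \<in> {1..n}" "j \<in> {1..n}" "{i, j} \<in> cycle_edges"
  have mem: "t + mX j + mY i \<in> monoms n"
    using t by (simp_all only: add_in_monoms_iff mX_in mY_in simp_thms)
  have s: "same_path (t + mX i + mY j) (t + mX j + mY i)" using same_path_swap t by blast
  then have "ord (t + mX i + mY j) = ord (t + mX j + mY i)"
    using start_cong[of "t + mX i + mY j" "t + mX j + mY i"] by (simp add: same_path_def)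
  then show "path_form (t + mX i + mY j) = path_form (t + mX j + mY i)"
    using path_form(1-3)[OF mem] same_path_trans[OF s] by (intro path_form_eq) auto
qed

text \<open>Normal forms for the cycle that the complete graph reduces further in the same order;
  they index the basis of \<open>U/J\<close>.\<close>

definition broken :: "mon set" where
  "broken = {m \<in> monoms n. (\<exists>i. gap m i) \<and> locally_ordered n (ord m) m \<and> \<not> ordered n (ord m) m}"

text \<open>With full support local order propagates through all positions, so order can fail only
  across a missing vertex.\<close>

lemma ordered_of_not_broken:
  assumes "m \<in> monoms n" "locally_ordered n (ord m) m" "m \<notin> broken"
  shows "ordered n (ord m) m"
proof (cases "\<exists>i. gap m i")
  case True
  then show ?thesis using assms by (simp add: broken_def)
next
  case False
  then have "\<not> gap m ((start m + x) mod n)" for x by blast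
  then have pos: "vertex_deg m (ord m x) > 0" for x using n_pos by (simp add: gap_def cyc_def)
  show ?thesis
    unfolding ordered_def
  proof (intro allI impI)
    fix p q assume pq: "p < q \<and> q < n"
    show "ye (ord m) m p = 0 \<or> xe (ord m) m q = 0"
    proof (cases "ye (ord m) m p = 0")
      case False
      then have "xe (ord m) m q = 0"
        using pq pos by (intro locally_ordered_run[OF assms(2), of p q]) auto
      then show ?thesis ..
    qed simp
  qed
qed

text \<open>A cycle normal form outside \<open>broken\<close> is ordered, and a class modulo the
  ideal of the complete graph contains only one such form. If the coordinates at
  \<open>broken\<close> vanish, the coordinate at this form equals a class sum for the complete
  graph, which is 0 for \<open>u\<close>.\<close>

lemma cycle_ideal_iff_broken:
  assumes u: "u \<in> (binomial_edge_ideal n (complete_edges n) :: 'k::field mpoly set)"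
  shows "u \<in> binomial_edge_ideal n cycle_edges \<longleftrightarrow> (\<forall>m\<in>broken. class_sum path_form u m = 0)"
proof -
  interpret subalgebra_type "poly_ring n" "polys n" "const_poly :: 'k \<Rightarrow> _"
    by (rule poly_subalgebra)
  have uP: "u \<in> polys n" using ideal_ofD(1)[OF ideal_edge_ideal u] .
  have "class_sum path_form u l = 0" if zero: "\<forall>m\<in>broken. class_sum path_form u m = 0" for l
  proof (rule ccontr)
    assume l: "class_sum path_form u l \<noteq> 0"
    have nf: "l' \<in> monoms n \<and> ordered n (ord l') l'" if l': "class_sum path_form u l' \<noteq> 0" for l'
    proof -
      obtain m where "m \<in> keys u" "l' = path_form m" using class_sum_nonzero[OF l'] by blast
      then have "l' \<in> monoms n" "locally_ordered n (ord l') l'"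
        using path_form(1,2)[of m] start_path_form[of m] uP by (auto simp: polys_def)
      then show ?thesis using ordered_of_not_broken zero l' by blast
    qed
    \<comment> \<open>The order of \<open>l\<close> is applied to all monomials of \<open>u\<close>;
      those in the class of \<open>l\<close> have the same vertex degrees and hence the same
      start.\<close>
    let ?v = "ord l"
    let ?s = "ordered_form n ?v"
    have "?s (path_form m) = ?s m" if "m \<in> keys u" for m
    proof -
      have m: "m \<in> monoms n" using that uP by (auto simp: polys_def)
      have "same_clique n (path_form m) (?s m)"
        using same_path_same_clique[OF path_form(3)[OF m]] ordered_form(3)[OF enum_ord m, of l]
        by (simp add: same_clique_def)
      then show ?thesis
        using ordered_form(1,2)[OF enum_ord m] path_form(1)[OF m] by (intro ordered_form_eq enum_ord) auto
    qed
    then have "class_sum ?s u l = (\<Sum>l'\<in>{l' \<in> path_form ` keys u. ?s l' = l}. class_sum path_form u l')"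
      by (rule class_sum_compose)
    also have "\<dots> = (\<Sum>l'\<in>{l' \<in> path_form ` keys u. ?s l' = l}. if l' = l then class_sum path_form u l else 0)"
    proof (rule sum.cong[OF refl])
      fix l' assume l': "l' \<in> {l' \<in> path_form ` keys u. ?s l' = l}"
      show "class_sum path_form u l' = (if l' = l then class_sum path_form u l else 0)"
      proof (cases "class_sum path_form u l' = 0")
        case False
        have o: "l' \<in> monoms n" "ordered n (ord l') l'" using nf[OF False] by auto
        have "same_clique n l' l" using ordered_form(3)[OF enum_ord o(1), of l] l' by simp
        then have "start l' = start l" by (intro start_cong) (simp add: same_clique_def)
        then have "?s l' = l'" using o by (intro ordered_form_eq[OF enum_ord]) (auto simp: same_clique_def)
        then show ?thesis using l' by simp
      qed auto
    qed
    also have "\<dots> = class_sum path_form u l"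
    proof -
      have "l \<in> path_form ` keys u" using class_sum_nonzero[OF l] by blast
      moreover have "?s l = l" using nf[OF l] by (intro ordered_form_eq[OF enum_ord]) (auto simp: same_clique_def)
      ultimately show ?thesis by simp
    qed
    finally have "class_sum path_form u l = 0"
      using u complete_ideal_iff[OF enum_ord uP] by simp
    then show False using l by simp
  qed
  then show ?thesis using cycle_ideal_iff[OF uP] by blast
qed

lemma cycle_ideal_subset:
  "binomial_edge_ideal n cycle_edges \<subseteq> (binomial_edge_ideal n (complete_edges n) :: 'k::field mpoly set)"
  using cycle_edges_complete by (intro edge_ideal_subset ideal_edge_ideal edge_ideal_generator) auto

section \<open>The monomial basis of the quotient of the two ideals\<close>

text \<open>A monomial in \<open>broken\<close>, read from its starting vertex, begins with a run of \<open>X\<close>, followed from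
  position \<open>run_Y\<close> on by \<open>Y\<close>, up to the missing position \<open>break\<close>, after which comes an \<open>X\<close>.\<close>

definition run_Y :: "mon \<Rightarrow> nat" where
  "run_Y m = (LEAST q. ye (ord m) m q > 0)"

definition break :: "mon \<Rightarrow> nat" where
  "break m = (LEAST k. run_Y m \<le> k \<and> Suc k < n \<and> xe (ord m) m (Suc k) > 0)"

text \<open>Position \<open>q\<close> stands for the linear form with \<open>Y\<close> at
  \<open>q\<close> and \<open>X\<close> at \<open>Suc q\<close>; membership means that
  \<open>Y\<close> is the chosen variable. In the run before the break this holds even where
  \<open>Y\<close> is absent, and at \<open>n - 1\<close> the \<open>X\<close> belongs to the
  missing start vertex.\<close>

definition Y_colors :: "mon \<Rightarrow> nat set" where
  "Y_colors m = {q. q < n \<and> (ye (ord m) m q > 0 \<or> run_Y m \<le> q \<and> q < break m \<or> Suc q = n)}"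

lemma run_Y_eqI: "ye (ord m) m j > 0 \<Longrightarrow> (\<And>q. q < j \<Longrightarrow> ye (ord m) m q = 0) \<Longrightarrow> run_Y m = j"
  unfolding run_Y_def by (rule Least_equality) (auto simp: not_less[symmetric])

lemma break_eqI:
  assumes "run_Y m \<le> k" "Suc k < n" "xe (ord m) m (Suc k) > 0"
    "\<And>q. run_Y m \<le> q \<Longrightarrow> q < k \<Longrightarrow> xe (ord m) m (Suc q) = 0"
  shows "break m = k"
  unfolding break_def
proof (rule Least_equality)
  show "k \<le> q" if q: "run_Y m \<le> q \<and> Suc q < n \<and> xe (ord m) m (Suc q) > 0" for q
  proof (rule ccontr)
    assume "\<not> k \<le> q"
    then have "xe (ord m) m (Suc q) = 0" using assms(4)[of q] q by simp
    then show False using q by simp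
  qed
qed (use assms in blast)

lemma break_le: "run_Y m \<le> k \<Longrightarrow> Suc k < n \<Longrightarrow> xe (ord m) m (Suc k) > 0 \<Longrightarrow> break m \<le> k"
  unfolding break_def by (rule Least_le) blast

text \<open>The position of the break has neither \<open>X\<close>, by minimality, nor
  \<open>Y\<close>, by local order with the \<open>X\<close> behind it. As the start is the last
  missing index, the walk has wrapped around before it gets there, which is
  \<open>break_start\<close>.\<close>

lemma brokenD:
  assumes "m \<in> broken"
  shows "m \<in> monoms n" "locally_ordered n (ord m) m" "xe (ord m) m 0 = 0" "ye (ord m) m 0 = 0"
    and ye_run_Y: "ye (ord m) m (run_Y m) > 0" and ye_before_run_Y: "\<And>q. q < run_Y m \<Longrightarrow> ye (ord m) m q = 0"
    and "0 < run_Y m" "run_Y m < break m" "Suc (break m) < n"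
    and xe_break: "xe (ord m) m (Suc (break m)) > 0"
    and xe_run: "\<And>q. run_Y m < q \<Longrightarrow> q \<le> break m \<Longrightarrow> xe (ord m) m q = 0"
    and "ye (ord m) m (break m) = 0" and break_start: "n \<le> break m + start m"
proof -
  let ?v = "ord m" and ?j = "run_Y m" and ?k = "break m"
  have gap: "\<exists>i. gap m i" using assms by (simp add: broken_def)
  show M: "m \<in> monoms n" and lo: "locally_ordered n (ord m) m" using assms by (auto simp: broken_def)
  show x0: "xe ?v m 0 = 0" and y0: "ye ?v m 0 = 0" using vertex_deg_ord_0[OF gap] by (auto simp: vertex_deg_enum)
  have "\<not> ordered n ?v m" using assms by (simp add: broken_def)
  then obtain p q where pq: "p < q" "q < n" "ye ?v m p > 0" "xe ?v m q > 0"
    unfolding ordered_def by auto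
  show yj: "ye ?v m ?j > 0" unfolding run_Y_def by (rule LeastI[of "\<lambda>q. ye ?v m q > 0", OF pq(3)])
  show "ye ?v m q = 0" if "q < ?j" for q
    using not_less_Least[of q "\<lambda>q. ye ?v m q > 0"] that by (simp add: run_Y_def)
  have jp: "?j \<le> p" unfolding run_Y_def by (rule Least_le[of "\<lambda>q. ye ?v m q > 0", OF pq(3)])
  show "0 < ?j" using yj y0 by (cases "?j = 0") auto
  have "?j \<le> q - 1 \<and> Suc (q - 1) < n \<and> xe ?v m (Suc (q - 1)) > 0" using jp pq by auto
  then have k: "?j \<le> ?k \<and> Suc ?k < n \<and> xe ?v m (Suc ?k) > 0"
    unfolding break_def by (rule LeastI[of "\<lambda>k. ?j \<le> k \<and> Suc k < n \<and> xe ?v m (Suc k) > 0"])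
  then show kn: "Suc ?k < n" and xk: "xe ?v m (Suc ?k) > 0" by auto
  have "?k \<noteq> ?j" using locally_orderedD[OF lo kn] yj xk by auto
  then show jk: "?j < ?k" using k by simp
  show xr: "xe ?v m q = 0" if "?j < q" "q \<le> ?k" for q
  proof -
    have "\<not> (?j \<le> q - 1 \<and> Suc (q - 1) < n \<and> xe ?v m (Suc (q - 1)) > 0)"
      using not_less_Least[of "q - 1" "\<lambda>k. ?j \<le> k \<and> Suc k < n \<and> xe ?v m (Suc k) > 0"] that
      by (auto simp: break_def[symmetric])
    then show ?thesis using that kn by auto
  qed
  show yk: "ye ?v m ?k = 0"
  proof (rule ccontr)
    assume "ye ?v m ?k \<noteq> 0"
    then show False using locally_orderedD[OF lo kn] xk by simp
  qed
  show "n \<le> ?k + start m"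
  proof (rule ccontr)
    assume "\<not> ?thesis"
    then have lt: "start m + ?k < n" by simp
    moreover have "vertex_deg m (?v ?k) = 0" using xr[OF jk] yk by (simp add: vertex_deg_enum)
    ultimately have "gap m (start m + ?k)" by (simp add: gap_def cyc_def)
    then show False using gap_le_start[of m "start m + ?k"] jk by simp
  qed
qed

lemma Y_colors_facts:
  assumes "m \<in> broken"
  shows "q < run_Y m \<Longrightarrow> q \<notin> Y_colors m" "run_Y m \<le> q \<Longrightarrow> q < break m \<Longrightarrow> q \<in> Y_colors m"
    "break m \<notin> Y_colors m" "n - 1 \<in> Y_colors m" "0 \<notin> Y_colors m"
  using brokenD[OF assms] n_pos by (auto simp: Y_colors_def)

lemma xe_Suc_Y_color:
  assumes "m \<in> broken" "q \<in> Y_colors m"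
  shows "xe (ord m) m (Suc q) = 0"
proof (cases "Suc q = n")
  case True
  then show ?thesis using brokenD(3)[OF assms(1)] cyc_n[OF start_less, of m] by (simp add: xe_def)
next
  case False
  then have "Suc q < n" and "ye (ord m) m q > 0 \<or> run_Y m \<le> q \<and> q < break m"
    using assms(2) by (auto simp: Y_colors_def)
  then show ?thesis
    using locally_orderedD[OF brokenD(2)[OF assms(1)]] xe_run[OF assms(1), of "Suc q"] by auto
qed

lemma ye_X_color: "q < n \<Longrightarrow> q \<notin> Y_colors m \<Longrightarrow> ye (ord m) m q = 0"
  by (simp add: Y_colors_def)

text \<open>The position at which index \<open>i\<close> is met when reading from \<open>l\<close>.
  The linear forms are indexed by \<open>i\<close>, independently of any monomial, whereas types are
  described by positions.\<close>

definition pos :: "nat \<Rightarrow> nat \<Rightarrow> nat" where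
  "pos l i = (i + n - l) mod n"

lemma pos_less: "pos l i < n"
  using n_pos by (simp add: pos_def)

lemma pos_index:
  assumes "l < n" "i < n"
  shows "(l + pos l i) mod n = i" "cyc l (pos l i) = c i" "cyc l (Suc (pos l i)) = c (Suc i mod n)"
proof -
  have "(l + pos l i) mod n = (l + (i + n - l)) mod n" unfolding pos_def by (rule mod_add_right_eq)
  also have "l + (i + n - l) = i + n" using assms by simp
  finally show 1: "(l + pos l i) mod n = i" using assms by simp
  then show "cyc l (pos l i) = c i" by (simp add: cyc_def)
  then show "cyc l (Suc (pos l i)) = c (Suc i mod n)" using cyc_Suc_index assms pos_less by blast
qed

lemma pos_inj: "l < n \<Longrightarrow> i < n \<Longrightarrow> i' < n \<Longrightarrow> pos l i = pos l i' \<Longrightarrow> i = i'"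
  using pos_index(1) by metis

lemma pos_surj: "l < n \<Longrightarrow> q < n \<Longrightarrow> \<exists>i<n. pos l i = q"
proof -
  assume "l < n" "q < n"
  then have "inj_on (pos l) {..<n}" using pos_inj by (auto intro: inj_onI)
  moreover have "pos l ` {..<n} \<subseteq> {..<n}" using pos_less by auto
  ultimately have "pos l ` {..<n} = {..<n}" by (intro endo_inj_surj) auto
  then show ?thesis using \<open>q < n\<close> by (metis imageE lessThan_iff)
qed

fun broken_type :: "mon \<Rightarrow> nat \<times> nat \<times> nat \<times> nat set" where
  "broken_type m = (start m, run_Y m, break m, Y_colors m)"

fun cycle_var :: "nat \<times> nat \<times> nat \<times> nat set \<Rightarrow> nat \<Rightarrow> var" where
  "cycle_var (l, j, k, B) i = (if pos l i \<in> B then Y (cyc l (pos l i)) else X (cyc l (Suc (pos l i))))"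

text \<open>A variable is required if its presence is needed to recognize \<open>j\<close>, \<open>k\<close> and \<open>B\<close>, or to make \<open>l\<close>
  the last missing vertex.\<close>

fun cycle_req :: "nat \<times> nat \<times> nat \<times> nat set \<Rightarrow> nat \<Rightarrow> nat" where
  "cycle_req (l, j, k, B) i = (let q = pos l i in
    if q \<in> B then (if q = j \<or> j < q \<and> q < k \<and> q + l < n \<or> k < q \<and> Suc q < n then 1 else 0)
    else (if q = k \<or> Suc q < j \<and> Suc q + l < n then 1 else 0))"

lemma cyc_Suc_inj:
  assumes "l < n" "p < n" "q < n" "cyc l (Suc p) = cyc l (Suc q)"
  shows "p = q"
proof -
  let ?f = "\<lambda>x. if Suc x = n then 0 else Suc x"
  have "cyc l (Suc x) = cyc l (?f x)" for x using cyc_n[OF assms(1)] by simp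
  then have "cyc l (?f p) = cyc l (?f q)" using assms(4) by metis
  moreover have "?f p < n" "?f q < n" using assms(2,3) by auto
  ultimately have "?f p = ?f q" using enum_inj[OF enum_cyc[OF assms(1)]] by blast
  then show ?thesis by (simp split: if_splits)
qed

text \<open>The choice of variables excludes \<open>Y\<close> outside \<open>B\<close> and
  \<open>X\<close> right after a position in \<open>B\<close>, which gives local order and a missing
  start vertex. The required variables then make \<open>l\<close> the last missing index,
  \<open>j\<close> the first \<open>Y\<close>, \<open>k\<close> the break and \<open>B\<close> the
  color set.\<close>

lemma broken_same_type:
  assumes m: "m \<in> broken" and m': "m' \<in> monoms n"
    and sub: "keys m' \<subseteq> cycle_var (broken_type m) ` {..<n}"
    and req: "\<And>i. i < n \<Longrightarrow> cycle_req (broken_type m) i \<le> lookup m' (cycle_var (broken_type m) i)"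
  shows "m' \<in> broken \<and> broken_type m' = broken_type m"
proof -
  define l where "l = start m"
  define j where "j = run_Y m"
  define k where "k = break m"
  define B where "B = Y_colors m"
  let ?v = "cyc l"
  have l: "l < n" by (simp add: l_def start_less)
  note en = enum_inj[OF enum_cyc[OF l]]
  note D = brokenD[OF m, folded l_def j_def k_def]
  note BF = Y_colors_facts[OF m, folded j_def k_def B_def]
  have type: "broken_type m = (l, j, k, B)" by (simp add: l_def j_def k_def B_def)
  have BI: "q \<in> B \<Longrightarrow> q < n" for q by (simp add: B_def Y_colors_def)
  have reqq: "(if q \<in> B then (if q = j \<or> j < q \<and> q < k \<and> q + l < n \<or> k < q \<and> Suc q < n then 1 else 0)
    else (if q = k \<or> Suc q < j \<and> Suc q + l < n then 1 else 0)) \<le> (if q \<in> B then ye ?v m' q else xe ?v m' (Suc q))"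
    if q: "q < n" for q
  proof -
    obtain i where i: "i < n" "pos l i = q" using pos_surj[OF l q] by blast
    show ?thesis
      using req[OF i(1), unfolded type cycle_req.simps cycle_var.simps Let_def i(2)]
      unfolding xe_def ye_def by (simp only: if_distrib[of "lookup m'"])
  qed
  have X0: "xe ?v m' (Suc q) = 0" if q: "q \<in> B" for q
  proof (rule ccontr)
    assume "xe ?v m' (Suc q) \<noteq> 0"
    then have "X (?v (Suc q)) \<in> keys m'" by (simp add: xe_def in_keys_iff)
    then obtain i where "X (?v (Suc q)) = cycle_var (l, j, k, B) i" using sub unfolding type by blast
    then have "pos l i \<notin> B" "?v (Suc q) = ?v (Suc (pos l i))" by (simp_all split: if_splits)
    then show False using cyc_Suc_inj[OF l BI[OF q] pos_less] q by simp
  qed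
  have Y0: "ye ?v m' q = 0" if q: "q < n" "q \<notin> B" for q
  proof (rule ccontr)
    assume "ye ?v m' q \<noteq> 0"
    then have "Y (?v q) \<in> keys m'" by (simp add: ye_def in_keys_iff)
    then obtain i where "Y (?v q) = cycle_var (l, j, k, B) i" using sub unfolding type by blast
    then have "pos l i \<in> B" "?v q = ?v (pos l i)" by (simp_all split: if_splits)
    then show False using en[OF q(1) pos_less] q by simp
  qed
  have x00: "xe ?v m' 0 = 0"
    using X0[OF BF(4)] n_pos cyc_n[OF l] by (simp add: xe_def)
  have y00: "ye ?v m' 0 = 0" using Y0[OF n_pos BF(5)] .
  have Yj: "ye ?v m' j > 0"
    using reqq[of j] BF(2)[of j] D(8,9) by simp
  have Xk: "xe ?v m' (Suc k) > 0"
    using reqq[of k] BF(3) D(9) by simp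
  have st: "start m' = l"
  proof (rule start_eqI)
    show "gap m' l" using x00 y00 l by (simp add: gap_def vertex_deg_def xe_def ye_def cyc_0)
    show "i \<le> l" if g: "gap m' i" for i
    proof (rule ccontr)
      assume "\<not> i \<le> l"
      then have i: "l < i" "i < n" using g by (auto simp: gap_def)
      \<comment> \<open>An index beyond \<open>l\<close> is met before the walk wraps around, hence
        before \<open>k\<close>; there a required variable makes the vertex present.\<close>
      define q where "q = i - l"
      have q: "0 < q" "q + l < n" "q < k" "q < n" "?v q = c i"
        using i D(13) by (auto simp: q_def cyc_def)
      have "xe ?v m' q + ye ?v m' q > 0"
      proof (cases "q < j")
        case True
        have "q - 1 \<notin> B" using BF(1)[of "q - 1"] True by simp
        moreover have "q - 1 < n" using q(4) by simp
        ultimately show ?thesis using reqq[of "q - 1"] True q by simp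
      next
        case False
        then have "q \<in> B" using BF(2)[of q] q by simp
        then show ?thesis using reqq[of q] False q Yj by (cases "q = j") auto
      qed
      then show False using g q(5) by (simp add: gap_def vertex_deg_def xe_def ye_def)
    qed
  qed
  have rY: "run_Y m' = j"
  proof (rule run_Y_eqI)
    show "ye (ord m') m' j > 0" using Yj st by simp
    show "ye (ord m') m' q = 0" if "q < j" for q
      using Y0[of q] BF(1)[of q] that D(8,9) st by simp
  qed
  have br: "break m' = k"
  proof (rule break_eqI)
    show "xe (ord m') m' (Suc q) = 0" if "run_Y m' \<le> q" "q < k" for q
      using X0[of q] BF(2)[of q] that rY st by simp
  qed (use rY st Xk D(8,9) in auto)
  have YB: "Y_colors m' = B"
  proof (intro equalityI subsetI)
    fix q assume q: "q \<in> Y_colors m'"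
    show "q \<in> B"
    proof (rule ccontr)
      assume "q \<notin> B"
      moreover have "q < n" using q by (simp add: Y_colors_def)
      ultimately have "j \<le> q \<and> q < k \<or> Suc q = n" using q Y0[of q] rY br st by (auto simp: Y_colors_def)
      moreover have "q \<in> B" if "Suc q = n" using BF(4) that by (metis diff_Suc_1)
      ultimately show False using BF(2)[of q] \<open>q \<notin> B\<close> by auto
    qed
  next
    fix q assume q: "q \<in> B"
    have "j \<le> q" using BF(1)[of q] q by (meson not_le)
    have "ye ?v m' q > 0 \<or> q < k \<or> Suc q = n"
    proof (cases "q < k \<or> Suc q = n")
      case False
      moreover have "q \<noteq> k" using BF(3) q by blast
      ultimately show ?thesis using reqq[of q] q BI[OF q] by simp
    qed blast
    then show "q \<in> Y_colors m'"
      using BI[OF q] \<open>j \<le> q\<close> rY br st by (auto simp: Y_colors_def)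
  qed
  have "locally_ordered n ?v m'"
    unfolding locally_ordered_def
  proof (intro allI impI)
    fix q assume "Suc q < n"
    then show "ye ?v m' q = 0 \<or> xe ?v m' (Suc q) = 0" using X0[of q] Y0[of q] by (cases "q \<in> B") auto
  qed
  moreover have "\<not> ordered n ?v m'"
    using orderedD[of n ?v m' j "Suc k"] Yj Xk D(8,9) by auto
  moreover have "\<exists>i. gap m' i"
    using x00 y00 l by (intro exI[of _ l]) (simp add: gap_def vertex_deg_def xe_def ye_def cyc_0)
  ultimately have "m' \<in> broken" using m' st by (simp add: broken_def)
  then show ?thesis using st rY br YB by (simp add: l_def j_def k_def B_def)
qed

lemma colored_broken:
  "colored_monomials n n broken broken_type cycle_var cycle_req ({..<n} \<times> {..<n} \<times> {..<n} \<times> Pow {..<n})"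
proof
  show "broken \<subseteq> monoms n" by (auto simp: broken_def)
  show "finite ({..<n} \<times> {..<n} \<times> {..<n} \<times> Pow {..<n})" by simp
  fix m assume m: "m \<in> broken"
  note D = brokenD[OF m]
  let ?v = "ord m" and ?l = "start m"
  note en = enum_inj[OF enum_ord[of m]]
  show "broken_type m \<in> {..<n} \<times> {..<n} \<times> {..<n} \<times> Pow {..<n}"
    using D(8,9) start_less[of m] by (auto simp: Y_colors_def)
  show "inj_on (cycle_var (broken_type m)) {..<n}"
  proof (rule inj_onI)
    fix i i' assume i: "i \<in> {..<n}" "i' \<in> {..<n}" "cycle_var (broken_type m) i = cycle_var (broken_type m) i'"
    have "pos ?l i = pos ?l i'"
      using i(3) en[OF pos_less pos_less, of ?l i ?l i'] cyc_Suc_inj[OF start_less[of m] pos_less pos_less, of ?l i ?l i']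
      by (auto split: if_splits)
    then show "i = i'" using pos_inj[OF start_less[of m]] i by auto
  qed
  show "keys m \<subseteq> cycle_var (broken_type m) ` {..<n}"
  proof
    fix x assume x: "x \<in> keys m"
    then have "x \<in> vars_upto n" using D(1) by (auto simp: monoms_def)
    then obtain w where w: "w \<in> {1..n}" "x = X w \<or> x = Y w" by (auto simp: vars_upto_def)
    then obtain q where q: "q < n" "w = ?v q" using enum_surj[OF enum_ord[of m]] by blast
    from w(2) show "x \<in> cycle_var (broken_type m) ` {..<n}"
    proof
      assume x': "x = X w"
      then have xq: "xe ?v m q \<noteq> 0" using x q by (simp add: xe_def in_keys_iff)
      \<comment> \<open>Position \<open>0\<close> is missing, so every \<open>X\<close> belongs to
        the linear form at the preceding position.\<close>
      then obtain p where p: "q = Suc p" using D(3) by (cases q) auto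
      then have "p \<notin> Y_colors m" using xe_Suc_Y_color[OF m, of p] xq by auto
      moreover obtain i where "i < n" "pos ?l i = p"
        using pos_surj[OF start_less[of m], of p] q(1) p by auto
      ultimately have "x = cycle_var (broken_type m) i" "i \<in> {..<n}"
        using x' q(2) p by simp_all
      then show ?thesis by (rule image_eqI)
    next
      assume x': "x = Y w"
      then have "ye ?v m q \<noteq> 0" using x q by (simp add: ye_def in_keys_iff)
      then have "q \<in> Y_colors m" using ye_X_color[OF q(1), of m] by auto
      moreover obtain i where "i < n" "pos ?l i = q" using pos_surj[OF start_less[of m] q(1)] by blast
      ultimately have "x = cycle_var (broken_type m) i" "i \<in> {..<n}" using x' q(2) by simp_all
      then show ?thesis by (rule image_eqI)
    qed
  qed
  show "cycle_var (broken_type m) i \<in> vars_upto n" if "i < n" for i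
  proof -
    have "cyc ?l (pos ?l i) \<in> {1..n}" using enum_in[OF enum_ord[of m] pos_less] .
    moreover have "cyc ?l (Suc (pos ?l i)) \<in> {1..n}"
      using pos_index(3)[OF start_less that, of m] c n_pos by (auto simp: bij_betw_def)
    ultimately show ?thesis by (simp add: vars_upto_def)
  qed
  show "cycle_req (broken_type m) i \<le> lookup m (cycle_var (broken_type m) i)" if "i < n" for i
  proof -
    let ?q = "pos ?l i"
    have q: "?q < n" by (rule pos_less)
    \<comment> \<open>Indices beyond the start are present, because the start is the last missing
      one.\<close>
    have supp: "xe ?v m p + ye ?v m p > 0" if "0 < p" "p + ?l < n" for p
    proof (rule ccontr)
      assume "\<not> ?thesis"
      then have "gap m (?l + p)" using that by (simp add: gap_def cyc_def vertex_deg_def xe_def ye_def add.commute)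
      then show False using gap_le_start[of m "?l + p"] that by simp
    qed
    show ?thesis
    proof (cases "?q \<in> Y_colors m")
      case True
      have "ye ?v m ?q > 0" if "?q = run_Y m \<or> run_Y m < ?q \<and> ?q < break m \<and> ?q + ?l < n \<or> break m < ?q \<and> Suc ?q < n"
        using that
      proof (elim disjE)
        assume "run_Y m < ?q \<and> ?q < break m \<and> ?q + ?l < n"
        then show ?thesis using supp[of ?q] D(11)[of ?q] by simp
      qed (use D(5,8) True in \<open>auto simp: Y_colors_def\<close>)
      then show ?thesis using True by (auto simp: ye_def Let_def Suc_le_eq)
    next
      case False
      have "xe ?v m (Suc ?q) > 0" if "?q = break m \<or> Suc ?q < run_Y m \<and> Suc ?q + ?l < n"
        using that
      proof (elim disjE)
        assume "Suc ?q < run_Y m \<and> Suc ?q + ?l < n"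
        then show ?thesis using supp[of "Suc ?q"] D(6)[of "Suc ?q"] by simp
      qed (use D(10) in auto)
      then show ?thesis using False by (auto simp: xe_def Let_def Suc_le_eq)
    qed
  qed
  show "m' \<in> broken \<and> broken_type m' = broken_type m"
    if "m' \<in> monoms n" "keys m' \<subseteq> cycle_var (broken_type m) ` {..<n}"
      "\<And>q. q < n \<Longrightarrow> cycle_req (broken_type m) q \<le> lookup m' (cycle_var (broken_type m) q)" for m'
    using broken_same_type[OF m that] .
qed

section \<open>Triangularity\<close>

text \<open>Subtracting the ordered form puts \<open>m\<close> into the ideal of the complete graph.
  The subtracted monomial has the same start and is ordered, so the coordinates at
  \<open>broken\<close> see \<open>m\<close> alone.\<close>

definition broken_elem :: "mon \<Rightarrow> 'k::field mpoly" where
  "broken_elem m = monomial m - monomial (ordered_form n (ord m) m)"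

definition theta :: "nat \<Rightarrow> 'k::field mpoly" where
  "theta i = mvar (X (c (Suc i mod n))) + mvar (Y (c i))"

text \<open>Compared lexicographically. The start comes first because weights are comparable only in
  a common order; the last two components decide between products of equal weight.\<close>

definition rank :: "mon \<Rightarrow> nat \<times> nat \<times> nat \<times> nat" where
  "rank m = (start m, weight n (ord m) m, break m, card ({..<n} - Y_colors m))"

definition X_at :: "nat \<Rightarrow> mon" where "X_at i = mX (c (Suc i mod n))"
definition Y_at :: "nat \<Rightarrow> mon" where "Y_at i = mY (c i)"

interpretation B: colored_monomials n n broken broken_type cycle_var cycle_req
  "{..<n} \<times> {..<n} \<times> {..<n} \<times> Pow {..<n}"
  by (rule colored_broken)

lemma c_in: "i < n \<Longrightarrow> c i \<in> {1..n}"
  using c by (auto simp: bij_betw_def)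

lemma X_at_in: "X_at i \<in> monoms n" and Y_at_in: "i < n \<Longrightarrow> Y_at i \<in> monoms n"
  using mX_in mY_in c_in n_pos by (simp_all add: X_at_def Y_at_def)

lemma sh_eq:
  assumes "m \<in> broken" "i < n"
  shows "B.sh i m = m + (if pos (start m) i \<in> Y_colors m then Y_at i else X_at i)"
  using pos_index(2,3)[OF start_less assms(2), of m]
  by (simp add: B.sh_def X_at_def Y_at_def mX_def mY_def)

lemma start_sh: "m \<in> broken \<Longrightarrow> i < n \<Longrightarrow> start (B.sh i m) = start m"
  and break_sh: "m \<in> broken \<Longrightarrow> i < n \<Longrightarrow> break (B.sh i m) = break m"
  and Y_colors_sh: "m \<in> broken \<Longrightarrow> i < n \<Longrightarrow> Y_colors (B.sh i m) = Y_colors m"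
  using B.D_sh[of m i] by simp_all

lemma weight_at:
  assumes "l < n" "i < n"
  shows weight_Y_at: "weight n (cyc l) (Y_at i) = wt n (Suc (pos l i))"
    and weight_X_at: "Suc (pos l i) < n \<Longrightarrow> weight n (cyc l) (X_at i) = wt n (Suc (pos l i))"
  using weight_mY[OF enum_cyc[OF assms(1)] pos_less, of l i] weight_mX[OF enum_cyc[OF assms(1)], of "Suc (pos l i)"]
    pos_index(2,3)[OF assms] by (simp_all add: X_at_def Y_at_def)

lemma weight_sh:
  assumes "m \<in> broken" "i < n"
  shows "weight n (ord m) (B.sh i m) = weight n (ord m) m + wt n (Suc (pos (start m) i))"
proof (cases "pos (start m) i \<in> Y_colors m")
  case True
  then show ?thesis using assms by (simp add: sh_eq weight_Y_at start_less)
next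
  case False
  then have "pos (start m) i \<noteq> n - 1" using Y_colors_facts(4)[OF assms(1)] by auto
  then have "Suc (pos (start m) i) < n" using pos_less[of "start m" i] by linarith
  then show ?thesis using False assms by (simp add: sh_eq weight_X_at start_less)
qed

text \<open>Multiplication only fills vertices, so the last missing index cannot increase. If it
  stays, \<open>z\<close> avoids the start vertex and does not reach across it, where the weight
  would not fit the form.\<close>

lemma start_after_mult:
  assumes m: "m \<in> broken" and tot: "vertex_deg b = vertex_deg m" and i: "i < n"
    and z: "z = X_at i \<or> z = Y_at i" and gap: "\<exists>x. gap (b + z) x"
  shows "start (b + z) < start m \<or> start (b + z) = start m \<and>
    weight n (ord m) (b + z) = weight n (ord m) b + wt n (Suc (pos (start m) i)) \<and>
    (z = X_at i \<longrightarrow> Suc (pos (start m) i) < n) \<and> (z = Y_at i \<longrightarrow> 0 < pos (start m) i)"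
proof -
  have le: "start (b + z) \<le> start m"
  proof (rule gap_le_start)
    show "gap m (start (b + z))" using gap_start[OF gap] tot by (simp add: gap_def vertex_deg_add)
  qed
  show ?thesis
  proof (cases "start (b + z) = start m")
    case False then show ?thesis using le by simp
  next
    case True
    let ?l = "start m" and ?q = "pos (start m) i"
    have zero: "vertex_deg z (c ?l) = 0"
      using gap_start[OF gap] True by (simp add: gap_def vertex_deg_add)
    have X: "Suc ?q < n" if "z = X_at i"
    proof (rule ccontr)
      assume "\<not> Suc ?q < n"
      then have "Suc ?q = n" using pos_less[of ?l i] by simp
      then have "c (Suc i mod n) = c ?l"
        using pos_index(3)[OF start_less i, of m] cyc_n[OF start_less, of m] cyc_0[OF start_less, of m] by simp
      then show False using zero that by (simp add: X_at_def vertex_deg_mX)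
    qed
    have Y: "0 < ?q" if "z = Y_at i"
    proof (rule ccontr)
      assume "\<not> 0 < ?q"
      then have "c i = c ?l" using pos_index(2)[OF start_less i, of m] cyc_0[OF start_less, of m] by simp
      then show False using zero that by (simp add: Y_at_def vertex_deg_mY)
    qed
    have "weight n (ord m) z = wt n (Suc ?q)"
      using z X weight_X_at[OF start_less i, of m] weight_Y_at[OF start_less i, of m] by auto
    then show ?thesis using True X Y by simp
  qed
qed

lemma rank_less_iff: "rank a < rank b \<longleftrightarrow> start a < start b \<or> start a = start b \<and>
    (weight n (ord a) a < weight n (ord b) b \<or> weight n (ord a) a = weight n (ord b) b \<and>
      (break a < break b \<or> break a = break b \<and> card ({..<n} - Y_colors a) < card ({..<n} - Y_colors b)))"
  unfolding rank_def less_prod_simp by auto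

text \<open>The ordered form is properly reduced and so lighter than \<open>m\<close>. Unless the
  start drops, the product gains the same weight as the chosen product of \<open>m\<close>, and the
  strict inequality persists.\<close>

lemma rank_path_form_ordered:
  assumes m: "m \<in> broken" and i: "i < n" and z: "z = X_at i \<or> z = Y_at i"
    and br: "path_form (ordered_form n (ord m) m + z) \<in> broken"
  shows "rank (path_form (ordered_form n (ord m) m + z)) < rank (B.sh i m)"
proof -
  let ?s = "ordered_form n (ord m) m"
  let ?a = "?s + z"
  note mM = brokenD(1)[OF m]
  note of = ordered_form[OF enum_ord mM, of m]
  have tot: "vertex_deg ?s = vertex_deg m" using of(3) by (simp add: same_clique_def)
  have "?s \<noteq> m" using of(2) m by (auto simp: broken_def)
  then have less: "weight n (ord m) ?s < weight n (ord m) m" using of(5) by simp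
  have aM: "?a \<in> monoms n" using of(1) z X_at_in Y_at_in i by (auto simp: add_in_monoms_iff)
  have st: "start (path_form ?a) = start ?a" using start_path_form[OF aM] .
  have "\<exists>x. gap ?a x"
    using br path_form(3)[OF aM] by (auto simp: broken_def gap_def same_path_def)
  then have "start ?a < start m \<or> start ?a = start m \<and>
    weight n (ord m) ?a = weight n (ord m) ?s + wt n (Suc (pos (start m) i))"
    using start_after_mult[OF m tot i z] by blast
  then show ?thesis
  proof
    assume "start ?a < start m"
    then show ?thesis using st start_sh[OF m i] by (simp add: rank_less_iff)
  next
    assume *: "start ?a = start m \<and> weight n (ord m) ?a = weight n (ord m) ?s + wt n (Suc (pos (start m) i))"
    have "weight n (ord m) (path_form ?a) \<le> weight n (ord m) ?a" using path_form(5)[OF aM] * by auto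
    then have "weight n (ord m) (path_form ?a) < weight n (ord m) (B.sh i m)"
      using * less by (simp add: weight_sh[OF m i])
    then show ?thesis using st * start_sh[OF m i] by (simp add: rank_less_iff)
  qed
qed

text \<open>If neither start nor weight drops, \<open>m + z\<close> is itself in
  \<open>broken\<close>. An added \<open>X\<close> then falls into the run and makes the break
  earlier; an added \<open>Y\<close> never makes the break later and, if it stays, enlarges the set
  of \<open>Y\<close> colors.\<close>

lemma rank_path_form_other:
  assumes m: "m \<in> broken" and i: "i < n"
    and z: "z = (if pos (start m) i \<in> Y_colors m then X_at i else Y_at i)"
    and br: "path_form (m + z) \<in> broken"
  shows "rank (path_form (m + z)) < rank (B.sh i m)"
proof -
  let ?a = "m + z" and ?q = "pos (start m) i" and ?v = "ord m"
  note D = brokenD[OF m]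
  have aM: "?a \<in> monoms n" using D(1) z X_at_in Y_at_in i by (auto simp: add_in_monoms_iff)
  have st: "start (path_form ?a) = start ?a" using start_path_form[OF aM] .
  have "\<exists>x. gap ?a x"
    using br path_form(3)[OF aM] by (auto simp: broken_def gap_def same_path_def)
  moreover have "z = X_at i \<or> z = Y_at i" using z by simp
  ultimately have "start ?a < start m \<or> start ?a = start m \<and>
    weight n (ord m) ?a = weight n (ord m) m + wt n (Suc ?q) \<and>
    (z = X_at i \<longrightarrow> Suc ?q < n) \<and> (z = Y_at i \<longrightarrow> 0 < ?q)"
    using start_after_mult[OF m refl i] by blast
  then consider "start ?a < start m" | "start ?a = start m"
    "weight n (ord m) ?a = weight n (ord m) m + wt n (Suc ?q)" "z = X_at i \<Longrightarrow> Suc ?q < n" by blast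
  then show ?thesis
  proof cases
    case 1
    then show ?thesis using st start_sh[OF m i] by (simp add: rank_less_iff)
  next
    case 2
    show ?thesis
    proof (cases "path_form ?a = ?a")
      case False
      then have "weight n (ord m) (path_form ?a) < weight n (ord m) (B.sh i m)"
        using path_form(5)[OF aM] 2 by (simp add: weight_sh[OF m i])
      then show ?thesis using st 2 start_sh[OF m i] by (simp add: rank_less_iff)
    next
      case True
      then have ab: "?a \<in> broken" using br by simp
      have lo: "locally_ordered n ?v ?a" using brokenD(2)[OF ab] 2(1) by simp
      have ord_a: "ord ?a = ?v" using 2(1) by simp
      have weq: "weight n (ord ?a) ?a = weight n (ord (B.sh i m)) (B.sh i m)"
        using 2 start_sh[OF m i] by (simp add: weight_sh[OF m i])
      note en = enum_inj[OF enum_ord[of m]]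
      note idx = pos_index[OF start_less[of m] i]
      have "break ?a < break m \<or> break ?a = break m \<and> card ({..<n} - Y_colors ?a) < card ({..<n} - Y_colors m)"
      proof (cases "?q \<in> Y_colors m")
        case True
        then have zX: "z = X_at i" and Sq: "Suc ?q < n" using z 2(3) by auto
        have xq: "xe ?v ?a (Suc ?q) > 0" by (simp add: zX X_at_def xe_mX idx(3))
        have "ye ?v m ?q = ye ?v ?a ?q" by (simp add: zX X_at_def)
        moreover have "\<not> ye ?v ?a ?q > 0" using locally_orderedD[OF lo Sq] xq by linarith
        ultimately have "ye ?v m ?q = 0" by simp
        \<comment> \<open>The position has color \<open>Y\<close> without containing
          \<open>Y\<close> and is not the last one, so it lies in the run before the break.\<close>
        then have q: "run_Y m \<le> ?q" "?q < break m" using True Sq by (auto simp: Y_colors_def)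
        have "run_Y ?a = run_Y m"
          unfolding run_Y_def ord_a by (simp add: zX X_at_def)
        then have "break ?a \<le> ?q" using break_le[of ?a ?q] q Sq xq ord_a by simp
        then show ?thesis using q by simp
      next
        case False
        then have zY: "z = Y_at i" using z by simp
        have Sq: "Suc ?q < n" using False Y_colors_facts(4)[OF m] pos_less[of "start m" i]
          by (metis Suc_lessI diff_Suc_1)
        have yq: "ye ?v ?a ?q > 0" by (simp add: zY Y_at_def ye_mY idx(2))
        have ye_le: "ye ?v m x \<le> ye ?v ?a x" for x by simp
        have ye_other: "ye ?v ?a x = ye ?v m x" if "x < n" "x \<noteq> ?q" for x
          using en[OF that(1) pos_less, of "start m" i] that by (simp add: zY Y_at_def ye_mY idx(2)[symmetric])
        have xe_eq: "xe ?v ?a x = xe ?v m x" for x by (simp add: zY Y_at_def)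
        have qk: "?q \<noteq> break m"
        proof
          assume e: "?q = break m"
          then show False using locally_orderedD[OF lo Sq yq] xe_eq D(10) by simp
        qed
        have run_le: "run_Y ?a \<le> run_Y m"
          using D(5) unfolding run_Y_def[of ?a] ord_a by (intro Least_le) (simp add: add_pos_nonneg)
        have bk: "break ?a \<le> break m"
          using run_le D(8,9,10) ord_a xe_eq by (intro break_le) auto
        have "Y_colors m \<subset> Y_colors ?a" if eq: "break ?a = break m"
        proof
          show "Y_colors m \<subseteq> Y_colors ?a"
            using run_le eq ord_a ye_le unfolding Y_colors_def by (auto intro: le_trans simp: add_pos_nonneg)
          have "?q \<in> Y_colors ?a" using yq pos_less unfolding Y_colors_def ord_a by blast
          then show "Y_colors m \<noteq> Y_colors ?a" using False by metis
        qed
        moreover have "Y_colors ?a \<subseteq> {..<n}" unfolding Y_colors_def by blast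
        ultimately have "{..<n} - Y_colors ?a \<subset> {..<n} - Y_colors m" if "break ?a = break m"
          using that by blast
        then have "card ({..<n} - Y_colors ?a) < card ({..<n} - Y_colors m)" if "break ?a = break m"
          using that by (intro psubset_card_mono) simp_all
        then show ?thesis using bk by linarith
      qed
      then show ?thesis
        unfolding True using 2(1) weq start_sh[OF m i] break_sh[OF m i] Y_colors_sh[OF m i]
        by (auto simp: rank_less_iff)
    qed
  qed
qed

lemma theta_mult:
  "theta i * broken_elem m = monomial (m + X_at i) + monomial (m + Y_at i) -
    (monomial (ordered_form n (ord m) m + X_at i) + monomial (ordered_form n (ord m) m + Y_at i) :: 'k::field mpoly)"
  by (simp add: theta_def broken_elem_def mvar_X mvar_Y X_at_def Y_at_def algebra_simps mult_single)

lemma class_sum_theta_mult: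
  assumes m: "m \<in> broken" and i: "i < n"
  obtains z where "path_form (m + z) \<in> broken \<Longrightarrow> rank (path_form (m + z)) < rank (B.sh i m)"
    "\<And>l. class_sum path_form (theta i * broken_elem m) l =
      (if B.sh i m = l then 1 else 0) + (if path_form (m + z) = l then 1 else 0) -
      ((if path_form (ordered_form n (ord m) m + X_at i) = l then 1 else 0) +
       (if path_form (ordered_form n (ord m) m + Y_at i) = l then 1 else (0 :: 'k::field)))"
proof
  let ?z = "if pos (start m) i \<in> Y_colors m then X_at i else Y_at i"
  show "path_form (m + ?z) \<in> broken \<Longrightarrow> rank (path_form (m + ?z)) < rank (B.sh i m)"
    using rank_path_form_other[OF m i refl] .
  have shb: "B.sh i m \<in> broken" using B.sh_in[OF m i] .
  have "path_form (B.sh i m) = B.sh i m" using brokenD(1,2)[OF shb] by (rule path_form_id)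
  then show "class_sum path_form (theta i * broken_elem m) l =
      (if B.sh i m = l then 1 else 0) + (if path_form (m + ?z) = l then 1 else 0) -
      ((if path_form (ordered_form n (ord m) m + X_at i) = l then 1 else 0) +
       (if path_form (ordered_form n (ord m) m + Y_at i) = l then 1 else (0 :: 'k)))" for l
    unfolding theta_mult class_sum_diff class_sum_add class_sum_single sh_eq[OF m i]
    by (cases "pos (start m) i \<in> Y_colors m") simp_all
qed

text \<open>The monomial lives on the ends of a chord. Here \<open>n \<ge> 4\<close> enters: both
  \<open>c 1\<close> and \<open>c (n - 1)\<close> are missing, and read from
  \<open>c (n - 1)\<close> the \<open>Y\<close> is at position 1 and the \<open>X\<close> at
  position 3. For \<open>n = 3\<close> the two ideals coincide.\<close>

lemma broken_nonempty: "broken \<noteq> {}"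
proof -
  let ?m = "mY (c 0) + mX (c 2)"
  have inj: "c x = c y \<longleftrightarrow> x = y" if "x < n" "y < n" for x y
    using c that by (auto simp: bij_betw_def inj_on_def)
  have tot: "vertex_deg ?m (c x) = (if x = 0 \<or> x = 2 then 1 else 0)" if "x < n" for x
    using inj[OF that, of 0] inj[OF that, of 2] n by (auto simp: vertex_deg_add vertex_deg_mX vertex_deg_mY)
  have st: "start ?m = n - 1"
  proof (rule start_eqI)
    show "gap ?m (n - 1)" using n by (simp add: gap_def tot)
  qed (unfold gap_def, linarith)
  have v: "cyc (n - 1) (Suc x) = c x" if "x < n" for x
    using that n_pos by (simp add: cyc_def)
  have v0: "cyc (n - 1) 0 = c (n - 1)" using n_pos by (simp add: cyc_def)
  have y: "ye (ord ?m) ?m q = (if q = 1 then 1 else 0)" if "q < n" for q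
  proof (cases q)
    case 0
    then show ?thesis using inj[of "n - 1" 0] n v0 st by (simp add: ye_mY)
  next
    case (Suc x)
    then show ?thesis using inj[of x 0] v[of x] that n st by (auto simp: ye_mY)
  qed
  have x: "xe (ord ?m) ?m q = (if q = 3 then 1 else 0)" if "q < n" for q
  proof (cases q)
    case 0
    then show ?thesis using inj[of "n - 1" 2] n v0 st by (simp add: xe_mX)
  next
    case (Suc x)
    then show ?thesis using inj[of x 2] v[of x] that n st by (auto simp: xe_mX)
  qed
  have "locally_ordered n (ord ?m) ?m"
    unfolding locally_ordered_def using y x by auto
  moreover have "\<not> ordered n (ord ?m) ?m"
    unfolding ordered_def using y[of 1] x[of 3] n by (intro notI) (drule spec[of _ 1], drule spec[of _ 3], simp)
  moreover have "?m \<in> monoms n"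
    using mX_in[OF c_in, of 2] mY_in[OF c_in, of 0] n by (simp add: add_in_monoms_iff)
  moreover have "gap ?m (n - 1)" using n by (simp add: gap_def tot)
  ultimately have "?m \<in> broken" by (auto simp: broken_def)
  then show ?thesis by blast
qed

text \<open>All ordered pairs of distinct vertices occur, so this finite set generates the ideal of
  the complete graph; a polynomial that multiplies it into the cycle ideal annihilates the
  quotient.\<close>

definition chord_binomials :: "'k::field mpoly set" where
  "chord_binomials = (\<lambda>(i, j). mvar (X i) * mvar (Y j) - mvar (X j) * mvar (Y i)) `
    {(i, j). i \<in> {1..n} \<and> j \<in> {1..n} \<and> i \<noteq> j}"

lemma colored_quotient_cycle:
  "colored_quotient n n broken broken_type cycle_var cycle_req ({..<n} \<times> {..<n} \<times> {..<n} \<times> Pow {..<n})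
    (binomial_edge_ideal n (complete_edges n) :: 'k::field mpoly set) (binomial_edge_ideal n cycle_edges)
    path_form broken_elem theta rank chord_binomials"
proof -
  interpret subalgebra_type "poly_ring n" "polys n" "const_poly :: 'k \<Rightarrow> _"
    by (rule poly_subalgebra)
  let ?U = "binomial_edge_ideal n (complete_edges n) :: 'k mpoly set"
  let ?V = "binomial_edge_ideal n cycle_edges :: 'k mpoly set"
  have U: "ideal_of ?U" and V: "ideal_of ?V" by (rule ideal_edge_ideal)+
  have gen: "mvar (X i) * mvar (Y j) - mvar (X j) * mvar (Y i) \<in> ?U"
    if "i \<in> {1..n}" "j \<in> {1..n}" "i \<noteq> j" for i j
    using that by (intro edge_ideal_generator) (auto simp: complete_edges_def)
  show ?thesis
  proof
    show "ideal_of ?U" "ideal_of ?V" by (fact U V)+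
    show "?V \<subseteq> ?U" by (rule cycle_ideal_subset)
    show "monom_degree (path_form m) = monom_degree m" if "m \<in> monoms n" for m
      using path_form(1,3)[OF that] that by (intro same_clique_degree[of _ n]) (simp_all add: same_path_def)
    show "u \<in> ?V \<longleftrightarrow> (\<forall>m\<in>broken. class_sum path_form u m = 0)" if "u \<in> ?U" for u
      using cycle_ideal_iff_broken[OF that] .
    show "theta i \<in> (polys n :: 'k mpoly set)" if "i < n" for i
    proof -
      have "Suc i mod n < n" using n_pos by simp
      then show ?thesis
        unfolding theta_def by (rule add_in[OF mvar_in(1)[OF c_in] mvar_in(2)[OF c_in[OF that]]])
    qed
    show "finite (chord_binomials :: 'k mpoly set)"
    proof -
      have "finite {(i, j). i \<in> {1..n} \<and> j \<in> {1..n} \<and> i \<noteq> j}"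
        by (rule finite_subset[of _ "{1..n} \<times> {1..n}"]) auto
      then show ?thesis unfolding chord_binomials_def by (rule finite_imageI)
    qed
    show "chord_binomials \<subseteq> ?U"
      unfolding chord_binomials_def
    proof (rule image_subsetI)
      fix z assume "z \<in> {(i, j). i \<in> {1..n} \<and> j \<in> {1..n} \<and> i \<noteq> j}"
      then obtain i j where "z = (i, j)" "i \<in> {1..n}" "j \<in> {1..n}" "i \<noteq> j" by blast
      then show "(case z of (i, j) \<Rightarrow> mvar (X i) * mvar (Y j) - mvar (X j) * mvar (Y i)) \<in> ?U"
        using gen[of i j] by simp
    qed
    show "s \<in> colon ?V ?U" if s: "s \<in> polys n" "\<And>g. g \<in> chord_binomials \<Longrightarrow> s * g \<in> ?V" for s
    proof -
      \<comment> \<open>What \<open>s\<close> multiplies into the cycle ideal forms an ideal; it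
        contains the generators and hence all of \<open>?U\<close>.\<close>
      let ?W = "{u \<in> polys n. s * u \<in> ?V}"
      have "ideal_of ?W"
        unfolding ideal_of_def
      proof (intro conjI ballI)
        fix a b assume "a \<in> ?W" "b \<in> ?W"
        then show "a + b \<in> ?W" using ideal_ofD(3)[OF V, of "s * a" "s * b"] by (simp add: distrib_left)
      next
        fix t a :: "'k mpoly" assume "t \<in> polys n" "a \<in> ?W"
        then show "t * a \<in> ?W" using ideal_ofD(4)[OF V, of t "s * a"] by (simp add: mult.left_commute)
      qed (use ideal_ofD(2)[OF V] in auto)
      moreover have "mvar (X i) * mvar (Y j) - mvar (X j) * mvar (Y i) \<in> ?W"
        if "i \<in> {1..n}" "j \<in> {1..n}" "i < j" "{i, j} \<in> complete_edges n" for i j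
      proof -
        have "mvar (X i) * mvar (Y j) - mvar (X j) * mvar (Y i) \<in> (chord_binomials :: 'k mpoly set)"
          unfolding chord_binomials_def by (rule image_eqI[of _ _ "(i, j)"]) (use that in auto)
        then have "s * (mvar (X i) * mvar (Y j) - mvar (X j) * mvar (Y i)) \<in> ?V" by (rule s(2))
        moreover have "i \<noteq> j" using that by simp
        ultimately show ?thesis using ideal_ofD(1)[OF U gen] that by blast
      qed
      ultimately have "?U \<subseteq> ?W" by (rule edge_ideal_subset)
      then show ?thesis using s(1) by (auto simp: colon_def)
    qed
    show "broken \<noteq> {}" by (rule broken_nonempty)
  next
    fix m assume m: "m \<in> broken"
    note mM = brokenD(1)[OF m]
    note of = ordered_form[OF enum_ord mM, of m]
    show "broken_elem m \<in> ?U" unfolding broken_elem_def by (rule of(4))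
    show "class_sum path_form (broken_elem m) m' = (if m' = m then 1 else (0 :: 'k))" if m': "m' \<in> broken" for m'
    proof -
      let ?s = "ordered_form n (ord m) m"
      have os: "ord ?s = ord m" using of(3) start_cong[of m ?s] by (simp add: same_clique_def)
      then have "path_form ?s = ?s"
        using of(1,2) ordered_imp_locally_ordered by (intro path_form_id) auto
      moreover have "?s \<noteq> m'" using m' of(2) os by (auto simp: broken_def)
      moreover have "path_form m = m" using path_form_id brokenD(1,2)[OF m] by blast
      ultimately show ?thesis by (simp add: broken_elem_def class_sum_diff class_sum_single)
    qed
    fix i assume i: "i < n"
    obtain z where z: "path_form (m + z) \<in> broken \<Longrightarrow> rank (path_form (m + z)) < rank (B.sh i m)"
      "\<And>l. class_sum path_form (theta i * broken_elem m) l =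
        (if B.sh i m = l then 1 else 0) + (if path_form (m + z) = l then 1 else 0) -
        ((if path_form (ordered_form n (ord m) m + X_at i) = l then 1 else 0) +
         (if path_form (ordered_form n (ord m) m + Y_at i) = l then 1 else (0 :: 'k)))"
      using class_sum_theta_mult[OF m i] by blast
    have less: "rank l < rank (B.sh i m)"
      if "l \<in> broken" "path_form (m + z) = l \<or> path_form (ordered_form n (ord m) m + X_at i) = l \<or>
        path_form (ordered_form n (ord m) m + Y_at i) = l" for l
      using that z(1) rank_path_form_ordered[OF m i] by auto
    show "class_sum path_form (theta i * broken_elem m) (B.sh i m) = (1 :: 'k)"
      using less[OF B.sh_in[OF m i]] unfolding z(2) by auto
    show "rank l < rank (B.sh i m)"
      if "l \<in> broken" "l \<noteq> B.sh i m" "class_sum path_form (theta i * broken_elem m) l \<noteq> (0 :: 'k)" for l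
    proof (rule less[OF that(1)])
      show "path_form (m + z) = l \<or> path_form (ordered_form n (ord m) m + X_at i) = l \<or>
        path_form (ordered_form n (ord m) m + Y_at i) = l"
        using that(2,3) unfolding z(2) by (auto split: if_splits)
    qed
    show "rank (B.sh i m) < rank (B.sh i m')" if m': "m' \<in> broken" and less: "rank m < rank m'" for m'
      using less start_sh[OF m i] start_sh[OF m' i] break_sh[OF m i] break_sh[OF m' i]
        Y_colors_sh[OF m i] Y_colors_sh[OF m' i] weight_sh[OF m i] weight_sh[OF m' i]
      by (auto simp: rank_less_iff)
  qed
qed

end

section \<open>Homogeneity of the ideals and conclusion\<close>

lemma class_sum_homogeneous_component:
  assumes "p \<in> polys n" "\<And>m. m \<in> monoms n \<Longrightarrow> monom_degree (r m) = monom_degree m"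
  shows "class_sum r (homogeneous_component d p) l = (if int (monom_degree l) = d then class_sum r p l else 0)"
proof -
  have sub: "keys (homogeneous_component d p) \<subseteq> keys p"
    by (auto simp: in_keys_iff lookup_homogeneous_component split: if_splits)
  have "monom_degree m = monom_degree l" if "m \<in> keys p" "r m = l" for m
    using that assms by (auto simp: polys_def)
  moreover have "class_sum r (homogeneous_component d p) l =
      (\<Sum>m\<in>keys p. if r m = l then lookup (homogeneous_component d p) m else 0)"
    by (rule class_sum_eq[OF finite_keys sub])
  ultimately show ?thesis
    unfolding class_sum_def by (auto simp: lookup_homogeneous_component intro!: sum.cong sum.neutral)
qed

text \<open>Each class sum that tests membership involves monomials of a single degree, so it is
  unchanged or becomes 0 on a homogeneous component.\<close>

lemma homogeneous_edge_ideal: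
  assumes iff: "\<And>p. p \<in> polys n \<Longrightarrow> p \<in> (binomial_edge_ideal n E :: 'k::field mpoly set) \<longleftrightarrow> (\<forall>l. class_sum r p l = 0)"
    and deg: "\<And>m. m \<in> monoms n \<Longrightarrow> monom_degree (r m) = monom_degree m"
  shows "graded_subring_type.homogeneous_ideal (polys n) homogeneous_component (binomial_edge_ideal n E :: 'k mpoly set)"
proof -
  interpret graded_subring_type "poly_ring n" "polys n" "poly_grading n" "homogeneous_component :: int \<Rightarrow> 'k mpoly \<Rightarrow> _"
    by (rule poly_graded)
  let ?I = "binomial_edge_ideal n E :: 'k mpoly set"
  have id: "ideal_of ?I" by (rule ideal_edge_ideal)
  show ?thesis
    unfolding homogeneous_ideal_def
  proof (intro conjI ballI allI)
    fix a d assume a: "a \<in> ?I"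
    have aP: "a \<in> polys n" using ideal_ofD(1)[OF id a] .
    have "homogeneous_component d a \<in> polys n" using comp_in[OF aP] Rg_sub by blast
    then show "homogeneous_component d a \<in> ?I"
      using a iff aP class_sum_homogeneous_component[OF aP deg] by simp
  qed (rule id)
qed

lemma mvar_grading: "v \<in> vars_upto n \<Longrightarrow> mvar v \<in> (poly_grading n 1 :: 'k::field mpoly set)"
  by (simp add: poly_grading_def poly_ring_def mvar_def monom_degree_def)

theorem proposition2p2:
  fixes n :: nat and E :: "nat set set"
  assumes "n \<ge> 4" and "cycle_graph n E"
  shows "seq_cohen_macaulay_ideal (poly_ring n) (poly_grading n)
           (binomial_edge_ideal n E :: 'k::field mpoly set)"
proof -
  obtain c where c: "bij_betw c {..<n} {1..n}" and E: "E = {{c i, c (Suc i mod n)} | i. i < n}"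
    using assms(2) by (auto simp: cycle_graph_def)
  interpret cycle n c using assms(1) c by unfold_locales
  interpret graded_subring_type "poly_ring n" "polys n" "poly_grading n" "homogeneous_component :: int \<Rightarrow> 'k mpoly \<Rightarrow> _"
    by (rule poly_graded)
  define J where "J = (binomial_edge_ideal n E :: 'k mpoly set)"
  define U where "U = (binomial_edge_ideal n (complete_edges n) :: 'k mpoly set)"
  define as where "as = map (theta :: nat \<Rightarrow> 'k mpoly) [0..<n]"
  define bs where "bs = map (clique_theta n (cyc 0) :: nat \<Rightarrow> 'k mpoly) [0..<Suc n]"
  have E': "E = cycle_edges" by (simp add: E cycle_edges_def)
  \<comment> \<open>For \<open>S/U\<close> any order of the vertices serves; the cycle read from
    index 0 is at hand.\<close>
  have v: "enum n (cyc 0)" using enum_cyc n_pos .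
  interpret Q: colored_quotient n n broken broken_type cycle_var cycle_req "{..<n} \<times> {..<n} \<times> {..<n} \<times> Pow {..<n}"
    U J path_form broken_elem theta rank chord_binomials
    using colored_quotient_cycle unfolding U_def J_def E' .
  interpret P: colored_quotient n "Suc n" "{m \<in> monoms n. ordered n (cyc 0) m}" "first_Y n (cyc 0)"
    "clique_var (cyc 0)" "clique_req n" "{..<n}" "polys n" U "ordered_form n (cyc 0)" monomial
    "clique_theta n (cyc 0)" "\<lambda>m. (weight n (cyc 0) m, first_Y n (cyc 0) m)" "{1}"
    using colored_quotient_complete[OF v n_pos] unfolding U_def .
  have irr: "x \<in> irrelevant_ideal (poly_ring n) (poly_grading n)" if "x \<in> poly_grading n 1" for x :: "'k mpoly"
    using that unfolding irrelevant_ideal_def genideal_def by (force intro: bexI[of _ 1])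
  have Rg1: "x \<in> polys n" if "x \<in> poly_grading n 1" for x :: "'k mpoly"
    using that Rg_sub by blast
  have var: "mvar (X w) \<in> (poly_grading n 1 :: 'k mpoly set)" "mvar (Y w) \<in> (poly_grading n 1 :: 'k mpoly set)"
    if "w \<in> {1..n}" for w
    using that by (auto simp: vars_upto_def intro!: mvar_grading)
  have as1: "theta i \<in> (poly_grading n 1 :: 'k mpoly set)" if "i < n" for i
  proof -
    have "Suc i mod n < n" using n_pos by simp
    then show ?thesis
      unfolding theta_def by (rule Rg_add[OF var(1)[OF c_in] var(2)[OF c_in[OF that]]])
  qed
  have bs1: "clique_theta n (cyc 0) q \<in> (poly_grading n 1 :: 'k mpoly set)" if "q < Suc n" for q
    using that enum_in[OF v, of q] enum_in[OF v, of "q - 1"] Rg_zero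
    unfolding clique_theta_def by (intro Rg_add) (auto intro!: var)
  have asS: "set as \<subseteq> polys n" and asI: "set as \<subseteq> irrelevant_ideal (poly_ring n) (poly_grading n)"
    using as1 irr Rg1 by (auto simp: as_def)
  have bsS: "set bs \<subseteq> polys n" and bsI: "set bs \<subseteq> irrelevant_ideal (poly_ring n) (poly_grading n)"
    using bs1 irr Rg1 by (auto simp: bs_def simp del: upt_Suc)
  \<comment> \<open>If \<open>J\<close> were equal to \<open>U\<close>, the iterated sum, which lies
    between them, would be \<open>U\<close>, against its properness.\<close>
  have JU: "J \<noteq> U"
    using Q.proper ideal_foldl_add_mult[OF Q.U Q.V Q.VU asS] unfolding as_def by blast
  have US: "U \<noteq> polys n"
    using P.proper ideal_foldl_add_mult[OF P.U P.V P.VU bsS] unfolding bs_def by blast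
  have "seq_cohen_macaulay_ideal (poly_ring n) (poly_grading n) J"
  proof (rule seq_cohen_macaulay_ideal_two_steps[of J U as bs])
    show "homogeneous_ideal J"
      unfolding J_def E' by (rule homogeneous_edge_ideal[OF cycle_ideal_iff Q.r_degree])
    show "homogeneous_ideal U"
      unfolding U_def by (rule homogeneous_edge_ideal[OF complete_ideal_iff[OF v] P.r_degree])
    show "J \<subset> U" "U \<subset> polys n" using JU US Q.VU P.VU by auto
    show "regular_on U J as" "foldl (add_mult U) J as \<noteq> U"
      using Q.regular Q.proper unfolding as_def .
    show "regular_on (polys n) U bs" "foldl (add_mult (polys n)) U bs \<noteq> polys n"
      using P.regular P.proper unfolding bs_def .
    show "k \<le> length as" if "prime_chain (colon J U) k P" for k P
      using Q.dimension_bound[OF that] by (simp add: as_def)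
    show "k \<le> length bs" if "prime_chain (colon U (polys n)) k P" for k P
      using P.dimension_bound[OF that] by (simp add: bs_def)
    show "length as < length bs" by (simp add: as_def bs_def)
  qed (fact asS asI bsS bsI)+
  then show ?thesis by (simp add: J_def)
qed

end
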